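(* The Frobenius-Schur indicators of the simple objects of a pseudo-unitary fusion category are invariants of the category as a ($\mathbb C$-linear) monoidal category. That is, if $\mathcal F\colon\mathcal C\to\mathcal D$ is a $\mathbb C$-linear monoidal equivalence of pseudo-unitary fusion categories over $\mathbb C$, each equipped with its canonical pivotal structure, then $\nu_{n,r}(V)=\nu_{n,r}(\mathcal F(V))$ for every simple object $V$ of $\mathcal C$ and all positive integers $n,r$.
   Context: Conventions. In a monoidal category the associativity isomorphism is $\Phi\colon (U\otimes V)\otimes W\to U\otimes (V\otimes W)$ and the unit object $I$ is strict: $V\otimes I=V=I\otimes V$. An object also denotes its identity morphism; $\mathcal C(X,Y)$ is the set of morphisms. A (left) dual of $V$ is $(V^\vee,\mathrm{ev}_V\colon V^\vee\otimes V\to I,\mathrm{db}_V\colon I\to V\otimes V^\vee)$ with $(V\otimes \mathrm{ev}_V)\Phi(\mathrm{db}_V\otimes V)=\mathrm{id}_V$ and $(\mathrm{ev}_V\otimes V^\vee)\Phi^{-1}(V^\vee\otimes\mathrm{db}_V)=\mathrm{id}_{V^\vee}$. A category is rigid if all left duals exist; a choice is fixed with $I^\vee=I$. Then $(-)^\vee$ is a contravariant functor, with $f^\vee$ for $f\colon V\to W$ determined by $\mathrm{ev}_V(f^\vee\otimes V)=\mathrm{ev}_W(W^\vee\otimes f)$, and $(-)^{\vee\vee}$ is canonically a monoidal functor. A pivotal structure is a monoidal natural isomorphism $j_V\colon V\to V^{\vee\vee}$. A fusion category is a semisimple $\mathbb C$-linear rigid monoidal category (abelian, finite-dimensional morphism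 spaces, bilinear tensor product, every object a finite direct sum of simple objects, simple meaning endomorphism ring $\mathbb C$, unit object simple) with finitely many isomorphism classes of simple objects; let $V_1,\dots,V_m$ be representatives. For $V\in\mathcal C$, write $[V][V_i]=\sum_jN_{i,j}[V_j]$ in the Grothendieck ring; $\operatorname{FPdim}(V)$ is the largest nonnegative real eigenvalue of the matrix $[N_{i,j}]$, and $\operatorname{FPdim}(\mathcal C)=\sum_i\operatorname{FPdim}(V_i)^2$. For $a\colon V\to V^{\vee\vee}$ put $\underline{\mathrm{tr}}(a)=\mathrm{ev}_{V^\vee}(a\otimes V^\vee)\mathrm{db}_V\in\mathrm{End}(I)=\mathbb C$. Every simple $V$ admits an isomorphism $a\colon V\to V^{\vee\vee}$, and $|V|^2=\underline{\mathrm{tr}}(a)\,\underline{\mathrm{tr}}((a^{-1})^\vee)$ is independent of $a$. The global dimension is $\dim(\mathcal C)=\sum_i|V_i|^2$. $\mathcal C$ is pseudo-unitary if $\dim(\mathcal C)=\operatorname{FPdim}(\mathcal C)$. By Etingof–Nikshych–Ostrik, a pseudo-unitary fusion category has a unique pivotal structure $j$, called canonical, with $\underline{\mathrm{tr}}(j_V)=\operatorname{FPdim}(V)$ for every simple $V$. Indicators are formed with this pivotal structure. Indicators. Put $V^{\otimes 0}=I$, $V^{\otimes(n+1)}=V\otimes V^{\otimes n}$, and let $\Phi^{(n)}\colon V^{\otimes(n-1)}\otimes V\to V^{\otimes n}$ be the canonical associativity isomorphism ($\Phi^{(1)}=\mathrm{id}$, $\Phi^{(n+1)}=(V\otimes\Phi^{(n)})\Phi$).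 Let $A=A_{V,W}\colon\mathcal C(I,V\otimes W)\to\mathcal C(V^\vee,W)$ be the bijection $A(f)=(\mathrm{ev}_V\otimes W)\Phi^{-1}(V^\vee\otimes f)$, with inverse $A^{-1}(g)=(V\otimes g)\mathrm{db}_V$. Let $T_{VW}\colon\mathcal C(V^\vee,W)\to\mathcal C(W^\vee,V)$, $T_{VW}(f)=j_V^{-1}f^\vee$. Put $E_{VW}=A_{W,V}^{-1}\,T_{VW}\,A_{V,W}$ and, for $n\ge1$, $E_V^{(n)}\colon\mathcal C(I,V^{\otimes n})\to\mathcal C(I,V^{\otimes n})$, $E_V^{(n)}(f)=\Phi^{(n)}E_{V,V^{\otimes(n-1)}}(f)$. Then $\nu_{n,r}(V)=\mathrm{Tr}\big((E_V^{(n)})^r\big)$. *)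

theory Defs
  imports
    "Jordan_Normal_Form.VS_Connect"
    "Jordan_Normal_Form.Char_Poly"
    "HOL-Algebra.Free_Abelian_Groups"
begin

section \<open>Categories\<close>

record ('o, 'm) cat =
  Obj :: "'o set"
  Arr :: "'m set"
  Dom :: "'m \<Rightarrow> 'o"
  Cod :: "'m \<Rightarrow> 'o"
  Id  :: "'o \<Rightarrow> 'm"
  Comp :: "'m \<Rightarrow> 'm \<Rightarrow> 'm" (infixl "\<cdot>\<index>" 70)

definition Hom :: "('o, 'm, 'x) cat_scheme \<Rightarrow> 'o \<Rightarrow> 'o \<Rightarrow> 'm set" where
  "Hom C X Y = {f \<in> Arr C. Dom C f = X \<and> Cod C f = Y}"

locale category =
  fixes C :: "('o, 'm, 'x) cat_scheme" (structure)
  assumes Dom_Obj: "f \<in> Arr C \<Longrightarrow> Dom C f \<in> Obj C"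
    and Cod_Obj: "f \<in> Arr C \<Longrightarrow> Cod C f \<in> Obj C"
    and Id_hom: "X \<in> Obj C \<Longrightarrow> Id C X \<in> Hom C X X"
    and Comp_hom: "\<lbrakk>f \<in> Hom C X Y; g \<in> Hom C Y Z\<rbrakk> \<Longrightarrow> g \<cdot> f \<in> Hom C X Z"
    and Comp_Id: "f \<in> Hom C X Y \<Longrightarrow> f \<cdot> Id C X = f"
    and Id_Comp: "f \<in> Hom C X Y \<Longrightarrow> Id C Y \<cdot> f = f"
    and Comp_assoc: "\<lbrakk>f \<in> Hom C W X; g \<in> Hom C X Y; h \<in> Hom C Y Z\<rbrakk>
                      \<Longrightarrow> (h \<cdot> g) \<cdot> f = h \<cdot> (g \<cdot> f)"

definition is_inverse :: "('o, 'm, 'x) cat_scheme \<Rightarrow> 'm \<Rightarrow> 'm \<Rightarrow> bool" where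
  "is_inverse C f g \<longleftrightarrow>
     f \<in> Arr C \<and> g \<in> Hom C (Cod C f) (Dom C f) \<and>
     g \<cdot>\<^bsub>C\<^esub> f = Id C (Dom C f) \<and> f \<cdot>\<^bsub>C\<^esub> g = Id C (Cod C f)"

definition iso_arr :: "('o, 'm, 'x) cat_scheme \<Rightarrow> 'm \<Rightarrow> bool" where
  "iso_arr C f \<longleftrightarrow> (\<exists>g. is_inverse C f g)"

definition inv_arr :: "('o, 'm, 'x) cat_scheme \<Rightarrow> 'm \<Rightarrow> 'm" where
  "inv_arr C f = (THE g. is_inverse C f g)"

definition iso_obj :: "('o, 'm, 'x) cat_scheme \<Rightarrow> 'o \<Rightarrow> 'o \<Rightarrow> bool" where
  "iso_obj C X Y \<longleftrightarrow> (\<exists>f \<in> Hom C X Y. iso_arr C f)"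

definition mono_arr :: "('o, 'm, 'x) cat_scheme \<Rightarrow> 'm \<Rightarrow> bool" where
  "mono_arr C f \<longleftrightarrow> f \<in> Arr C \<and>
     (\<forall>X. \<forall>g \<in> Hom C X (Dom C f). \<forall>h \<in> Hom C X (Dom C f). f \<cdot>\<^bsub>C\<^esub> g = f \<cdot>\<^bsub>C\<^esub> h \<longrightarrow> g = h)"

definition epi_arr :: "('o, 'm, 'x) cat_scheme \<Rightarrow> 'm \<Rightarrow> bool" where
  "epi_arr C f \<longleftrightarrow> f \<in> Arr C \<and>
     (\<forall>Y. \<forall>g \<in> Hom C (Cod C f) Y. \<forall>h \<in> Hom C (Cod C f) Y. g \<cdot>\<^bsub>C\<^esub> f = h \<cdot>\<^bsub>C\<^esub> f \<longrightarrow> g = h)"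

locale cat_functor = C: category C + D: category D
  for C :: "('o, 'm, 'x) cat_scheme" and D :: "('p, 'n, 'y) cat_scheme" +
  fixes Fo :: "'o \<Rightarrow> 'p" and Fa :: "'m \<Rightarrow> 'n"
  assumes F_Obj: "X \<in> Obj C \<Longrightarrow> Fo X \<in> Obj D"
    and F_hom: "f \<in> Hom C X Y \<Longrightarrow> Fa f \<in> Hom D (Fo X) (Fo Y)"
    and F_Id: "X \<in> Obj C \<Longrightarrow> Fa (Id C X) = Id D (Fo X)"
    and F_Comp: "\<lbrakk>f \<in> Hom C X Y; g \<in> Hom C Y Z\<rbrakk> \<Longrightarrow> Fa (g \<cdot>\<^bsub>C\<^esub> f) = Fa g \<cdot>\<^bsub>D\<^esub> Fa f"

locale nat_iso = F: cat_functor C D Fo Fa + G: cat_functor C D Go Ga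
  for C :: "('o, 'm, 'x) cat_scheme" and D :: "('p, 'n, 'y) cat_scheme"
    and Fo :: "'o \<Rightarrow> 'p" and Fa :: "'m \<Rightarrow> 'n" and Go :: "'o \<Rightarrow> 'p" and Ga :: "'m \<Rightarrow> 'n" +
  fixes \<tau> :: "'o \<Rightarrow> 'n"
  assumes component_hom: "X \<in> Obj C \<Longrightarrow> \<tau> X \<in> Hom D (Fo X) (Go X)"
    and component_iso: "X \<in> Obj C \<Longrightarrow> iso_arr D (\<tau> X)"
    and naturality: "f \<in> Hom C X Y \<Longrightarrow> \<tau> Y \<cdot>\<^bsub>D\<^esub> Fa f = Ga f \<cdot>\<^bsub>D\<^esub> \<tau> X"

definition equivalence_functor ::
  "('o, 'm, 'x) cat_scheme \<Rightarrow> ('p, 'n, 'y) cat_scheme \<Rightarrow> ('o \<Rightarrow> 'p) \<Rightarrow> ('m \<Rightarrow> 'n) \<Rightarrow> bool" where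
  "equivalence_functor C D Fo Fa \<longleftrightarrow> cat_functor C D Fo Fa \<and>
     (\<exists>Go Ga \<eta> \<epsilon>. cat_functor D C Go Ga \<and>
        nat_iso C C (\<lambda>X. X) (\<lambda>f. f) (Go \<circ> Fo) (Ga \<circ> Fa) \<eta> \<and>
        nat_iso D D (Fo \<circ> Go) (Fa \<circ> Ga) (\<lambda>X. X) (\<lambda>f. f) \<epsilon>)"


section \<open>Linear, abelian and semisimple categories over the complex numbers\<close>

record ('o, 'm) lincat = "('o, 'm) cat" +
  Zero_arr :: "'o \<Rightarrow> 'o \<Rightarrow> 'm"
  Add_arr :: "'m \<Rightarrow> 'm \<Rightarrow> 'm"
  Scale_arr :: "complex \<Rightarrow> 'm \<Rightarrow> 'm"

text \<open>The fields \<open>mult\<close> and \<open>one\<close> of the library record are irrelevant for vector spaces.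
  \<open>class_ring\<close> is the field of complex numbers here.\<close>

definition hom_space ::
  "('o, 'm, 'x) lincat_scheme \<Rightarrow> 'o \<Rightarrow> 'o \<Rightarrow> (complex, 'm) module" where
  "hom_space C X Y =
     \<lparr>carrier = Hom C X Y, monoid.mult = (\<lambda>_ _. undefined), one = undefined,
      ring.zero = Zero_arr C X Y, add = Add_arr C, module.smult = Scale_arr C\<rparr>"

locale linear_category = category C
  for C :: "('o, 'm, 'x) lincat_scheme" (structure) +
  assumes hom_vectorspace:
      "\<lbrakk>X \<in> Obj C; Y \<in> Obj C\<rbrakk> \<Longrightarrow> vectorspace class_ring (hom_space C X Y)"
    and Comp_Add: "\<lbrakk>f \<in> Hom C X Y; f' \<in> Hom C X Y; g \<in> Hom C Y Z\<rbrakk>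
      \<Longrightarrow> g \<cdot> Add_arr C f f' = Add_arr C (g \<cdot> f) (g \<cdot> f')"
    and Add_Comp: "\<lbrakk>f \<in> Hom C X Y; g \<in> Hom C Y Z; g' \<in> Hom C Y Z\<rbrakk>
      \<Longrightarrow> Add_arr C g g' \<cdot> f = Add_arr C (g \<cdot> f) (g' \<cdot> f)"
    and Comp_Scale: "\<lbrakk>f \<in> Hom C X Y; g \<in> Hom C Y Z\<rbrakk>
      \<Longrightarrow> g \<cdot> Scale_arr C c f = Scale_arr C c (g \<cdot> f)"
    and Scale_Comp: "\<lbrakk>f \<in> Hom C X Y; g \<in> Hom C Y Z\<rbrakk>
      \<Longrightarrow> Scale_arr C c g \<cdot> f = Scale_arr C c (g \<cdot> f)"

definition zero_obj :: "('o, 'm, 'x) cat_scheme \<Rightarrow> 'o \<Rightarrow> bool" where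
  "zero_obj C Z \<longleftrightarrow> Z \<in> Obj C \<and>
     (\<forall>X \<in> Obj C. (\<exists>!f. f \<in> Hom C Z X) \<and> (\<exists>!f. f \<in> Hom C X Z))"

definition is_direct_sum :: "('o, 'm, 'x) lincat_scheme \<Rightarrow> 'o \<Rightarrow> 'o list \<Rightarrow> bool" where
  "is_direct_sum C S Xs \<longleftrightarrow> S \<in> Obj C \<and> set Xs \<subseteq> Obj C \<and>
     (\<exists>\<iota> \<pi>.
       (\<forall>k < length Xs. \<iota> k \<in> Hom C (Xs ! k) S \<and> \<pi> k \<in> Hom C S (Xs ! k)) \<and>
       (\<forall>k < length Xs. \<forall>l < length Xs.
          \<pi> k \<cdot>\<^bsub>C\<^esub> \<iota> l = (if k = l then Id C (Xs ! k) else Zero_arr C (Xs ! l) (Xs ! k))) \<and>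
       finsum (hom_space C S S) (\<lambda>k. \<iota> k \<cdot>\<^bsub>C\<^esub> \<pi> k) {..<length Xs} = Id C S)"

definition is_kernel :: "('o, 'm, 'x) lincat_scheme \<Rightarrow> 'm \<Rightarrow> 'm \<Rightarrow> bool" where
  "is_kernel C k f \<longleftrightarrow> k \<in> Arr C \<and> f \<in> Arr C \<and> Cod C k = Dom C f \<and>
     f \<cdot>\<^bsub>C\<^esub> k = Zero_arr C (Dom C k) (Cod C f) \<and>
     (\<forall>X. \<forall>g \<in> Hom C X (Dom C f). f \<cdot>\<^bsub>C\<^esub> g = Zero_arr C X (Cod C f) \<longrightarrow>
        (\<exists>!h. h \<in> Hom C X (Dom C k) \<and> k \<cdot>\<^bsub>C\<^esub> h = g))"

definition is_cokernel :: "('o, 'm, 'x) lincat_scheme \<Rightarrow> 'm \<Rightarrow> 'm \<Rightarrow> bool" where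
  "is_cokernel C q f \<longleftrightarrow> q \<in> Arr C \<and> f \<in> Arr C \<and> Dom C q = Cod C f \<and>
     q \<cdot>\<^bsub>C\<^esub> f = Zero_arr C (Dom C f) (Cod C q) \<and>
     (\<forall>Y. \<forall>g \<in> Hom C (Cod C f) Y. g \<cdot>\<^bsub>C\<^esub> f = Zero_arr C (Dom C f) Y \<longrightarrow>
        (\<exists>!h. h \<in> Hom C (Cod C q) Y \<and> h \<cdot>\<^bsub>C\<^esub> q = g))"

locale abelian_category = linear_category C
  for C :: "('o, 'm, 'x) lincat_scheme" (structure) +
  assumes ex_zero: "\<exists>Z. zero_obj C Z"
    and ex_biproduct: "\<lbrakk>X \<in> Obj C; Y \<in> Obj C\<rbrakk> \<Longrightarrow> \<exists>S. is_direct_sum C S [X, Y]"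
    and ex_kernel: "f \<in> Arr C \<Longrightarrow> \<exists>k. is_kernel C k f"
    and ex_cokernel: "f \<in> Arr C \<Longrightarrow> \<exists>q. is_cokernel C q f"
    and mono_kernel: "mono_arr C f \<Longrightarrow> \<exists>g. is_kernel C f g"
    and epi_cokernel: "epi_arr C f \<Longrightarrow> \<exists>g. is_cokernel C f g"

text \<open>\<open>End(V) = \<complex>\<close>: the map \<open>c \<mapsto> c id\<close> is a bijection, hence a ring isomorphism.\<close>

definition simple_obj :: "('o, 'm, 'x) lincat_scheme \<Rightarrow> 'o \<Rightarrow> bool" where
  "simple_obj C V \<longleftrightarrow> V \<in> Obj C \<and> bij_betw (\<lambda>c. Scale_arr C c (Id C V)) UNIV (Hom C V V)"

text \<open>Semisimplicity of the abelian category is the splitting of all subobjects. It does not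
  follow from the decomposition into objects with endomorphism ring \<open>\<complex>\<close>: every
  finite-dimensional representation of the quiver \<open>A\<^sub>2\<close> has such a decomposition.\<close>

locale semisimple_category = abelian_category C
  for C :: "('o, 'm, 'x) lincat_scheme" (structure) +
  assumes mono_splits: "mono_arr C f \<Longrightarrow> \<exists>r \<in> Hom C (Cod C f) (Dom C f). r \<cdot> f = Id C (Dom C f)"
    and ex_decomposition:
      "X \<in> Obj C \<Longrightarrow> \<exists>Xs. (\<forall>V \<in> set Xs. simple_obj C V) \<and> is_direct_sum C X Xs"

definition simple_reps :: "('o, 'm, 'x) lincat_scheme \<Rightarrow> 'o list \<Rightarrow> bool" where
  "simple_reps C Vs \<longleftrightarrow> (\<forall>V \<in> set Vs. simple_obj C V) \<and>
     (\<forall>V. simple_obj C V \<longrightarrow> (\<exists>!i. i < length Vs \<and> iso_obj C V (Vs ! i)))"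

text \<open>Trace of an endomorphism of a finite-dimensional vector space;
  \<open>A b b'\<close> is the coefficient of \<open>b'\<close> in \<open>T b\<close>.\<close>

definition lin_trace :: "(complex, 'm) module \<Rightarrow> ('m \<Rightarrow> 'm) \<Rightarrow> complex" where
  "lin_trace M T = (THE t. \<exists>B A. finite B \<and> vectorspace.basis class_ring M B \<and>
     (\<forall>b \<in> B. T b = module.lincomb M (A b) B) \<and> t = (\<Sum>b\<in>B. A b b))"


section \<open>Monoidal categories with strict unit\<close>

record ('o, 'm) moncat = "('o, 'm) lincat" +
  Unit :: "'o"
  TensO :: "'o \<Rightarrow> 'o \<Rightarrow> 'o" (infixl "\<boxtimes>\<index>" 75)
  TensA :: "'m \<Rightarrow> 'm \<Rightarrow> 'm" (infixl "\<star>\<index>" 75)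
  Assoc :: "'o \<Rightarrow> 'o \<Rightarrow> 'o \<Rightarrow> 'm" ("\<Phi>\<index>")

locale monoidal_category = category C
  for C :: "('o, 'm, 'x) moncat_scheme" (structure) +
  assumes Unit_Obj: "Unit C \<in> Obj C"
    and TensO_Obj: "\<lbrakk>X \<in> Obj C; Y \<in> Obj C\<rbrakk> \<Longrightarrow> X \<boxtimes> Y \<in> Obj C"
    and TensA_hom: "\<lbrakk>f \<in> Hom C X X'; g \<in> Hom C Y Y'\<rbrakk> \<Longrightarrow> f \<star> g \<in> Hom C (X \<boxtimes> Y) (X' \<boxtimes> Y')"
    and TensA_Id: "\<lbrakk>X \<in> Obj C; Y \<in> Obj C\<rbrakk> \<Longrightarrow> Id C X \<star> Id C Y = Id C (X \<boxtimes> Y)"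
    and TensA_Comp: "\<lbrakk>f \<in> Hom C X X'; f' \<in> Hom C X' X''; g \<in> Hom C Y Y'; g' \<in> Hom C Y' Y''\<rbrakk>
      \<Longrightarrow> (f' \<cdot> f) \<star> (g' \<cdot> g) = (f' \<star> g') \<cdot> (f \<star> g)"
    and Assoc_hom: "\<lbrakk>U \<in> Obj C; V \<in> Obj C; W \<in> Obj C\<rbrakk>
      \<Longrightarrow> \<Phi> U V W \<in> Hom C ((U \<boxtimes> V) \<boxtimes> W) (U \<boxtimes> (V \<boxtimes> W))"
    and Assoc_iso: "\<lbrakk>U \<in> Obj C; V \<in> Obj C; W \<in> Obj C\<rbrakk> \<Longrightarrow> iso_arr C (\<Phi> U V W)"
    and Assoc_natural: "\<lbrakk>f \<in> Hom C U U'; g \<in> Hom C V V'; h \<in> Hom C W W'\<rbrakk>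
      \<Longrightarrow> \<Phi> U' V' W' \<cdot> ((f \<star> g) \<star> h) = (f \<star> (g \<star> h)) \<cdot> \<Phi> U V W"
    and pentagon: "\<lbrakk>U \<in> Obj C; V \<in> Obj C; W \<in> Obj C; X \<in> Obj C\<rbrakk>
      \<Longrightarrow> \<Phi> U V (W \<boxtimes> X) \<cdot> \<Phi> (U \<boxtimes> V) W X
          = (Id C U \<star> \<Phi> V W X) \<cdot> \<Phi> U (V \<boxtimes> W) X \<cdot> (\<Phi> U V W \<star> Id C X)"
    and TensO_Unit: "X \<in> Obj C \<Longrightarrow> X \<boxtimes> Unit C = X"
    and Unit_TensO: "X \<in> Obj C \<Longrightarrow> Unit C \<boxtimes> X = X"
    and TensA_Unit: "f \<in> Arr C \<Longrightarrow> f \<star> Id C (Unit C) = f"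
    and Unit_TensA: "f \<in> Arr C \<Longrightarrow> Id C (Unit C) \<star> f = f"
    and triangle: "\<lbrakk>V \<in> Obj C; W \<in> Obj C\<rbrakk> \<Longrightarrow> \<Phi> V (Unit C) W = Id C (V \<boxtimes> W)"

text \<open>A monoidal functor carries the structure isomorphisms
  \<open>F V \<otimes> F W \<rightarrow> F (V \<otimes> W)\<close> (\<open>Ften\<close>) and \<open>I \<rightarrow> F I\<close> (\<open>Funit\<close>).\<close>

record ('o, 'm, 'p, 'n) mfun =
  Fobj :: "'o \<Rightarrow> 'p"
  Farr :: "'m \<Rightarrow> 'n"
  Ften :: "'o \<Rightarrow> 'o \<Rightarrow> 'n"
  Funit :: "'n"

locale monoidal_functor = C: monoidal_category C + D: monoidal_category D +
  F: cat_functor C D "Fobj F" "Farr F"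
  for C :: "('o, 'm, 'x) moncat_scheme" and D :: "('p, 'n, 'y) moncat_scheme"
    and F :: "('o, 'm, 'p, 'n) mfun" +
  assumes Ften_hom: "\<lbrakk>V \<in> Obj C; W \<in> Obj C\<rbrakk>
      \<Longrightarrow> Ften F V W \<in> Hom D (Fobj F V \<boxtimes>\<^bsub>D\<^esub> Fobj F W) (Fobj F (V \<boxtimes>\<^bsub>C\<^esub> W))"
    and Ften_iso: "\<lbrakk>V \<in> Obj C; W \<in> Obj C\<rbrakk> \<Longrightarrow> iso_arr D (Ften F V W)"
    and Ften_natural: "\<lbrakk>f \<in> Hom C V V'; g \<in> Hom C W W'\<rbrakk>
      \<Longrightarrow> Ften F V' W' \<cdot>\<^bsub>D\<^esub> (Farr F f \<star>\<^bsub>D\<^esub> Farr F g) = Farr F (f \<star>\<^bsub>C\<^esub> g) \<cdot>\<^bsub>D\<^esub> Ften F V W"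
    and Ften_assoc: "\<lbrakk>U \<in> Obj C; V \<in> Obj C; W \<in> Obj C\<rbrakk>
      \<Longrightarrow> Farr F (\<Phi>\<^bsub>C\<^esub> U V W) \<cdot>\<^bsub>D\<^esub> Ften F (U \<boxtimes>\<^bsub>C\<^esub> V) W \<cdot>\<^bsub>D\<^esub> (Ften F U V \<star>\<^bsub>D\<^esub> Id D (Fobj F W))
          = Ften F U (V \<boxtimes>\<^bsub>C\<^esub> W) \<cdot>\<^bsub>D\<^esub> (Id D (Fobj F U) \<star>\<^bsub>D\<^esub> Ften F V W)
              \<cdot>\<^bsub>D\<^esub> \<Phi>\<^bsub>D\<^esub> (Fobj F U) (Fobj F V) (Fobj F W)"
    and Funit_hom: "Funit F \<in> Hom D (Unit D) (Fobj F (Unit C))"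
    and Funit_iso: "iso_arr D (Funit F)"
    and Ften_Unit: "V \<in> Obj C
      \<Longrightarrow> Ften F V (Unit C) \<cdot>\<^bsub>D\<^esub> (Id D (Fobj F V) \<star>\<^bsub>D\<^esub> Funit F) = Id D (Fobj F V)"
    and Unit_Ften: "V \<in> Obj C
      \<Longrightarrow> Ften F (Unit C) V \<cdot>\<^bsub>D\<^esub> (Funit F \<star>\<^bsub>D\<^esub> Id D (Fobj F V)) = Id D (Fobj F V)"

definition id_mfun :: "('o, 'm, 'x) moncat_scheme \<Rightarrow> ('o, 'm, 'o, 'm) mfun" where
  "id_mfun C = \<lparr>Fobj = (\<lambda>X. X), Farr = (\<lambda>f. f),
     Ften = (\<lambda>V W. Id C (V \<boxtimes>\<^bsub>C\<^esub> W)), Funit = Id C (Unit C)\<rparr>"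

locale monoidal_nat_iso = F: monoidal_functor C D F + G: monoidal_functor C D G +
  nat_iso C D "Fobj F" "Farr F" "Fobj G" "Farr G" \<tau>
  for C :: "('o, 'm, 'x) moncat_scheme" and D :: "('p, 'n, 'y) moncat_scheme"
    and F :: "('o, 'm, 'p, 'n) mfun" and G :: "('o, 'm, 'p, 'n) mfun" and \<tau> :: "'o \<Rightarrow> 'n" +
  assumes component_Ften: "\<lbrakk>V \<in> Obj C; W \<in> Obj C\<rbrakk>
      \<Longrightarrow> \<tau> (V \<boxtimes>\<^bsub>C\<^esub> W) \<cdot>\<^bsub>D\<^esub> Ften F V W = Ften G V W \<cdot>\<^bsub>D\<^esub> (\<tau> V \<star>\<^bsub>D\<^esub> \<tau> W)"
    and component_Funit: "\<tau> (Unit C) \<cdot>\<^bsub>D\<^esub> Funit F = Funit G"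

text \<open>A monoidal quasi-inverse is not demanded: a quasi-inverse of a monoidal functor is
  automatically monoidal, and a quasi-inverse of a linear functor is linear.\<close>

locale linear_monoidal_equivalence = monoidal_functor C D F
  for C :: "('o, 'm, 'x) moncat_scheme" and D :: "('p, 'n, 'y) moncat_scheme"
    and F :: "('o, 'm, 'p, 'n) mfun" +
  assumes F_Add: "\<lbrakk>f \<in> Hom C X Y; g \<in> Hom C X Y\<rbrakk>
      \<Longrightarrow> Farr F (Add_arr C f g) = Add_arr D (Farr F f) (Farr F g)"
    and F_Scale: "f \<in> Hom C X Y \<Longrightarrow> Farr F (Scale_arr C c f) = Scale_arr D c (Farr F f)"
    and F_equivalence: "equivalence_functor C D (Fobj F) (Farr F)"


section \<open>Duals and pivotal structures\<close>

record ('o, 'm) rigcat = "('o, 'm) moncat" +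
  Dual :: "'o \<Rightarrow> 'o"
  Ev :: "'o \<Rightarrow> 'm"
  Db :: "'o \<Rightarrow> 'm"

locale rigid_category = monoidal_category C
  for C :: "('o, 'm, 'x) rigcat_scheme" (structure) +
  assumes Dual_Obj: "V \<in> Obj C \<Longrightarrow> Dual C V \<in> Obj C"
    and Ev_hom: "V \<in> Obj C \<Longrightarrow> Ev C V \<in> Hom C (Dual C V \<boxtimes> V) (Unit C)"
    and Db_hom: "V \<in> Obj C \<Longrightarrow> Db C V \<in> Hom C (Unit C) (V \<boxtimes> Dual C V)"
    and zigzag: "V \<in> Obj C
      \<Longrightarrow> (Id C V \<star> Ev C V) \<cdot> \<Phi> V (Dual C V) V \<cdot> (Db C V \<star> Id C V) = Id C V"
    and zigzag_Dual: "V \<in> Obj C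
      \<Longrightarrow> (Ev C V \<star> Id C (Dual C V)) \<cdot> inv_arr C (\<Phi> (Dual C V) V (Dual C V))
            \<cdot> (Id C (Dual C V) \<star> Db C V) = Id C (Dual C V)"
    and Dual_Unit: "Dual C (Unit C) = Unit C"

definition dual_arr :: "('o, 'm, 'x) rigcat_scheme \<Rightarrow> 'm \<Rightarrow> 'm" where
  "dual_arr C f = (THE g. g \<in> Hom C (Dual C (Cod C f)) (Dual C (Dom C f)) \<and>
     Ev C (Dom C f) \<cdot>\<^bsub>C\<^esub> (g \<star>\<^bsub>C\<^esub> Id C (Dom C f))
       = Ev C (Cod C f) \<cdot>\<^bsub>C\<^esub> (Id C (Dual C (Cod C f)) \<star>\<^bsub>C\<^esub> f))"

text \<open>The canonical isomorphism from \<open>W\<^sup>\<or> \<otimes> V\<^sup>\<or>\<close> to \<open>(V \<otimes> W)\<^sup>\<or>\<close>, determined by turning the evaluation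
  of \<open>V \<otimes> W\<close> into the composite of the evaluations of \<open>V\<close> and \<open>W\<close>.\<close>

definition dual_ten :: "('o, 'm, 'x) rigcat_scheme \<Rightarrow> 'o \<Rightarrow> 'o \<Rightarrow> 'm" where
  "dual_ten C V W =
     (THE g. g \<in> Hom C (Dual C W \<boxtimes>\<^bsub>C\<^esub> Dual C V) (Dual C (V \<boxtimes>\<^bsub>C\<^esub> W)) \<and>
        Ev C (V \<boxtimes>\<^bsub>C\<^esub> W) \<cdot>\<^bsub>C\<^esub> (g \<star>\<^bsub>C\<^esub> Id C (V \<boxtimes>\<^bsub>C\<^esub> W))
          = Ev C W
             \<cdot>\<^bsub>C\<^esub> (Id C (Dual C W)
                   \<star>\<^bsub>C\<^esub> ((Ev C V \<star>\<^bsub>C\<^esub> Id C W) \<cdot>\<^bsub>C\<^esub> inv_arr C (\<Phi>\<^bsub>C\<^esub> (Dual C V) V W)))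
             \<cdot>\<^bsub>C\<^esub> \<Phi>\<^bsub>C\<^esub> (Dual C W) (Dual C V) (V \<boxtimes>\<^bsub>C\<^esub> W))"

text \<open>The monoidal structure of the bidual is the composite
  \<open>V\<^sup>\<or>\<^sup>\<or> \<otimes> W\<^sup>\<or>\<^sup>\<or> \<rightarrow> (W\<^sup>\<or> \<otimes> V\<^sup>\<or>)\<^sup>\<or> \<rightarrow> (V \<otimes> W)\<^sup>\<or>\<^sup>\<or>\<close>. Its unit component is the identity for every choice
  of the evaluation \<open>I \<otimes> I \<rightarrow> I\<close>: if that is \<open>\<lambda> id\<close>, the isomorphism \<open>I \<rightarrow> I\<^sup>\<or>\<close> is \<open>\<lambda>\<^sup>-\<^sup>1 id\<close>,
  and the two scalars cancel.\<close>

definition bidual :: "('o, 'm, 'x) rigcat_scheme \<Rightarrow> ('o, 'm, 'o, 'm) mfun" where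
  "bidual C = \<lparr>Fobj = (\<lambda>V. Dual C (Dual C V)), Farr = (\<lambda>f. dual_arr C (dual_arr C f)),
     Ften = (\<lambda>V W. dual_arr C (inv_arr C (dual_ten C V W)) \<cdot>\<^bsub>C\<^esub> dual_ten C (Dual C W) (Dual C V)),
     Funit = Id C (Unit C)\<rparr>"

definition pivotal_structure :: "('o, 'm, 'x) rigcat_scheme \<Rightarrow> ('o \<Rightarrow> 'm) \<Rightarrow> bool" where
  "pivotal_structure C j \<longleftrightarrow> monoidal_nat_iso C C (id_mfun C) (bidual C) j"


section \<open>Fusion categories and their dimensions\<close>

locale fusion_category = semisimple_category C + rigid_category C
  for C :: "('o, 'm, 'x) rigcat_scheme" (structure) +
  assumes hom_fin_dim: "\<lbrakk>X \<in> Obj C; Y \<in> Obj C\<rbrakk>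
      \<Longrightarrow> vectorspace.fin_dim class_ring (hom_space C X Y)"
    and TensA_Add: "\<lbrakk>f \<in> Hom C X X'; g \<in> Hom C Y Y'; g' \<in> Hom C Y Y'\<rbrakk>
      \<Longrightarrow> f \<star> Add_arr C g g' = Add_arr C (f \<star> g) (f \<star> g')"
    and Add_TensA: "\<lbrakk>f \<in> Hom C X X'; f' \<in> Hom C X X'; g \<in> Hom C Y Y'\<rbrakk>
      \<Longrightarrow> Add_arr C f f' \<star> g = Add_arr C (f \<star> g) (f' \<star> g)"
    and TensA_Scale: "\<lbrakk>f \<in> Hom C X X'; g \<in> Hom C Y Y'\<rbrakk>
      \<Longrightarrow> f \<star> Scale_arr C c g = Scale_arr C c (f \<star> g)"
    and Scale_TensA: "\<lbrakk>f \<in> Hom C X X'; g \<in> Hom C Y Y'\<rbrakk>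
      \<Longrightarrow> Scale_arr C c f \<star> g = Scale_arr C c (f \<star> g)"
    and Unit_simple: "simple_obj C (Unit C)"
    and finitely_many_simples: "\<exists>Vs. simple_reps C Vs"

definition K0_relations :: "('o, 'm, 'x) lincat_scheme \<Rightarrow> ('o \<Rightarrow>\<^sub>0 int) set" where
  "K0_relations C = generate (free_Abelian_group (Obj C))
     {frag_of (Cod C i) - frag_of (Dom C i) - frag_of (Cod C p) | i p.
        is_kernel C i p \<and> is_cokernel C p i}"

text \<open>Elements of the Grothendieck group are cosets in the free abelian group on the objects;
  the ring structure is given by \<open>[V][W] = [V \<otimes> W]\<close>.\<close>

definition K0_class :: "('o, 'm, 'x) lincat_scheme \<Rightarrow> ('o \<Rightarrow>\<^sub>0 int) \<Rightarrow> ('o \<Rightarrow>\<^sub>0 int) set" where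
  "K0_class C x = K0_relations C #>\<^bsub>free_Abelian_group (Obj C)\<^esub> x"

definition reps :: "('o, 'm, 'x) lincat_scheme \<Rightarrow> 'o list" where
  "reps C = (SOME Vs. simple_reps C Vs)"

definition fusion_coeff :: "('o, 'm, 'x) moncat_scheme \<Rightarrow> 'o \<Rightarrow> nat \<Rightarrow> nat \<Rightarrow> int" where
  "fusion_coeff C V i = (THE N. (\<forall>j \<ge> length (reps C). N j = 0) \<and>
     K0_class C (frag_of (V \<boxtimes>\<^bsub>C\<^esub> reps C ! i))
       = K0_class C (\<Sum>j < length (reps C). frag_cmul (N j) (frag_of (reps C ! j))))"

definition FPdim :: "('o, 'm, 'x) moncat_scheme \<Rightarrow> 'o \<Rightarrow> real" where
  "FPdim C V = Max {x. 0 \<le> x \<and>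
     eigenvalue (mat (length (reps C)) (length (reps C)) (\<lambda>(i, j). of_int (fusion_coeff C V i j))) x}"

definition FPdim_cat :: "('o, 'm, 'x) moncat_scheme \<Rightarrow> real" where
  "FPdim_cat C = (\<Sum>i < length (reps C). (FPdim C (reps C ! i))\<^sup>2)"

text \<open>For \<open>a : V \<rightarrow> V\<^sup>\<or>\<^sup>\<or>\<close>, with \<open>End(I)\<close> identified with \<open>\<complex>\<close>.\<close>

definition ptrace :: "('o, 'm, 'x) rigcat_scheme \<Rightarrow> 'm \<Rightarrow> complex" where
  "ptrace C a = (THE c. Ev C (Dual C (Dom C a)) \<cdot>\<^bsub>C\<^esub> (a \<star>\<^bsub>C\<^esub> Id C (Dual C (Dom C a))) \<cdot>\<^bsub>C\<^esub> Db C (Dom C a)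
     = Scale_arr C c (Id C (Unit C)))"

definition squared_norm :: "('o, 'm, 'x) rigcat_scheme \<Rightarrow> 'o \<Rightarrow> complex" where
  "squared_norm C V = (THE z. \<exists>a \<in> Hom C V (Dual C (Dual C V)). iso_arr C a \<and>
     z = ptrace C a * ptrace C (dual_arr C (inv_arr C a)))"

definition global_dim :: "('o, 'm, 'x) rigcat_scheme \<Rightarrow> complex" where
  "global_dim C = (\<Sum>i < length (reps C). squared_norm C (reps C ! i))"

definition pseudo_unitary :: "('o, 'm, 'x) rigcat_scheme \<Rightarrow> bool" where
  "pseudo_unitary C \<longleftrightarrow> global_dim C = of_real (FPdim_cat C)"

definition canonical_pivotal :: "('o, 'm, 'x) rigcat_scheme \<Rightarrow> ('o \<Rightarrow> 'm) \<Rightarrow> bool" where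
  "canonical_pivotal C j \<longleftrightarrow> pivotal_structure C j \<and>
     (\<forall>V. simple_obj C V \<longrightarrow> ptrace C (j V) = of_real (FPdim C V))"


section \<open>Frobenius-Schur indicators\<close>

primrec ten_pow :: "('o, 'm, 'x) moncat_scheme \<Rightarrow> 'o \<Rightarrow> nat \<Rightarrow> 'o" where
  "ten_pow C V 0 = Unit C"
| "ten_pow C V (Suc n) = V \<boxtimes>\<^bsub>C\<^esub> ten_pow C V n"

text \<open>\<open>assoc_pow C V n : V\<^bsup>n\<^esup> \<otimes> V \<rightarrow> V\<^bsup>n+1\<^esup>\<close> is \<open>\<Phi>\<^bsup>(n+1)\<^esup>\<close>, so the index is shifted by one.\<close>

primrec assoc_pow :: "('o, 'm, 'x) moncat_scheme \<Rightarrow> 'o \<Rightarrow> nat \<Rightarrow> 'm" where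
  "assoc_pow C V 0 = Id C V"
| "assoc_pow C V (Suc n) = (Id C V \<star>\<^bsub>C\<^esub> assoc_pow C V n) \<cdot>\<^bsub>C\<^esub> \<Phi>\<^bsub>C\<^esub> V (ten_pow C V n) V"

definition A_map :: "('o, 'm, 'x) rigcat_scheme \<Rightarrow> 'o \<Rightarrow> 'o \<Rightarrow> 'm \<Rightarrow> 'm" where
  "A_map C V W f = (Ev C V \<star>\<^bsub>C\<^esub> Id C W) \<cdot>\<^bsub>C\<^esub> inv_arr C (\<Phi>\<^bsub>C\<^esub> (Dual C V) V W)
     \<cdot>\<^bsub>C\<^esub> (Id C (Dual C V) \<star>\<^bsub>C\<^esub> f)"

definition A_inv :: "('o, 'm, 'x) rigcat_scheme \<Rightarrow> 'o \<Rightarrow> 'm \<Rightarrow> 'm" where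
  "A_inv C V g = (Id C V \<star>\<^bsub>C\<^esub> g) \<cdot>\<^bsub>C\<^esub> Db C V"

definition T_map :: "('o, 'm, 'x) rigcat_scheme \<Rightarrow> ('o \<Rightarrow> 'm) \<Rightarrow> 'o \<Rightarrow> 'm \<Rightarrow> 'm" where
  "T_map C j V f = inv_arr C (j V) \<cdot>\<^bsub>C\<^esub> dual_arr C f"

definition E_map :: "('o, 'm, 'x) rigcat_scheme \<Rightarrow> ('o \<Rightarrow> 'm) \<Rightarrow> 'o \<Rightarrow> 'o \<Rightarrow> 'm \<Rightarrow> 'm" where
  "E_map C j V W f = A_inv C W (T_map C j V (A_map C V W f))"

definition E_pow :: "('o, 'm, 'x) rigcat_scheme \<Rightarrow> ('o \<Rightarrow> 'm) \<Rightarrow> nat \<Rightarrow> 'o \<Rightarrow> 'm \<Rightarrow> 'm" where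
  "E_pow C j n V f = assoc_pow C V (n - 1) \<cdot>\<^bsub>C\<^esub> E_map C j V (ten_pow C V (n - 1)) f"

definition FS_indicator ::
  "('o, 'm, 'x) rigcat_scheme \<Rightarrow> ('o \<Rightarrow> 'm) \<Rightarrow> nat \<Rightarrow> nat \<Rightarrow> 'o \<Rightarrow> complex" where
  "FS_indicator C j n r V =
     lin_trace (hom_space C (Unit C) (ten_pow C V n)) ((E_pow C j n V) ^^ r)"

end

theory Submission
  imports Defs
begin

text \<open>The operator whose powers have the indicators as traces is built from tensor products,
  associators, chosen duals and a pivotal isomorphism. A monoidal equivalence \<open>F\<close> respects all of
  these up to canonical isomorphism except for the pivotal isomorphism, so the content of the
  theorem is that \<open>F\<close> carries \<open>j V\<close> to \<open>j (F V)\<close> when \<open>V\<close> is simple.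

  The rotation \<open>E\<close> on \<open>C(I, V \<otimes> W)\<close> is defined by means of the dual of
  \<open>W\<close>, which for the indicators is a tensor power. Writing a morphism as \<open>(V \<otimes> g) db\<^sub>V\<close> with
  \<open>g : V\<^sup>\<or> \<rightarrow> W\<close>, dinaturality of the coevaluation shows that \<open>E\<close> sends it to \<open>(g \<otimes> V) db'\<close>, where
  \<open>db' = (V\<^sup>\<or> \<otimes> j\<^sup>-\<^sup>1) db\<close> for the coevaluation of \<open>V\<^sup>\<or>\<close> (\<open>E_map_eq\<close>). Only duals of \<open>V\<close> itself are
  left to compare.

  The morphism \<open>db'\<close> and the twisted evaluation
  \<open>ev' = ev (j \<otimes> V\<^sup>\<or>) : V \<otimes> V\<^sup>\<or> \<rightarrow> I\<close> satisfy the zigzag identities, so the image of \<open>db'\<close> under \<open>F\<close> is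
  determined by that of \<open>ev'\<close> (\<open>twisted_db_compatible\<close>). For simple \<open>V\<close> the space of morphisms
  \<open>V \<otimes> V\<^sup>\<or> \<rightarrow> I\<close> is one-dimensional, and composition with \<open>db\<^sub>V\<close> is injective on it because \<open>db\<^sub>V\<close> is a
  split monomorphism. The value of \<open>ev'\<close> on \<open>db\<^sub>V\<close> is the pivotal trace of \<open>j V\<close>, which is the
  Frobenius-Perron dimension for the canonical structures; hence \<open>ev'\<close> is preserved as soon as the
  Frobenius-Perron dimension is (\<open>twisted_ev_F\<close>).

  In the semisimple case the multiplicity of \<open>V\<^sub>j\<close> in the class of an
  object \<open>X\<close> is the dimension of \<open>C(V\<^sub>j, X)\<close> (\<open>fusion_coeff_eq\<close>). A fully faithful linear functor
  preserves these dimensions, and \<open>F\<close> permutes the classes of simple objects, so the two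
  multiplication matrices differ by a relabelling and have the same eigenvalues (\<open>FPdim_F\<close>).

  The functor and its structure isomorphisms give a linear isomorphism of
  \<open>C(I, V\<^sup>n)\<close> with \<open>D(I, (F V)\<^sup>n)\<close> that intertwines the two operators (\<open>E_pow_push\<close>), and conjugate
  endomorphisms have the same trace (\<open>lin_trace_conjugate\<close>).\<close>

section \<open>Arrows in categories and monoidal categories\<close>

context category
begin

lemma Hom_arr: "f \<in> Hom C X Y \<longleftrightarrow> f \<in> Arr C \<and> Dom C f = X \<and> Cod C f = Y"
  by (simp add: Hom_def)

lemma arr_Obj [simp]: "f \<in> Arr C \<Longrightarrow> Dom C f \<in> Obj C" "f \<in> Arr C \<Longrightarrow> Cod C f \<in> Obj C"
  by (simp_all add: Dom_Obj Cod_Obj)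

lemma Id_arr [simp]:
  "X \<in> Obj C \<Longrightarrow> Id C X \<in> Arr C" "X \<in> Obj C \<Longrightarrow> Dom C (Id C X) = X" "X \<in> Obj C \<Longrightarrow> Cod C (Id C X) = X"
  using Id_hom by (auto simp: Hom_arr)

lemma comp_arr [simp]:
  assumes "f \<in> Arr C" "g \<in> Arr C" "Dom C g = Cod C f"
  shows "g \<cdot> f \<in> Arr C" "Dom C (g \<cdot> f) = Dom C f" "Cod C (g \<cdot> f) = Cod C g"
  using Comp_hom[of f "Dom C f" "Cod C f" g "Cod C g"] assms by (auto simp: Hom_arr)

lemma comp_id [simp]:
  "f \<in> Arr C \<Longrightarrow> Dom C f = X \<Longrightarrow> f \<cdot> Id C X = f"
  "f \<in> Arr C \<Longrightarrow> Cod C f = X \<Longrightarrow> Id C X \<cdot> f = f"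
  using Comp_Id[of f "Dom C f" "Cod C f"] Id_Comp[of f "Dom C f" "Cod C f"] by (auto simp: Hom_arr)

lemma comp_assoc:
  assumes "f \<in> Arr C" "g \<in> Arr C" "h \<in> Arr C" "Dom C g = Cod C f" "Dom C h = Cod C g"
  shows "(h \<cdot> g) \<cdot> f = h \<cdot> (g \<cdot> f)"
  using Comp_assoc[of f "Dom C f" "Cod C f" g "Cod C g" h "Cod C h"] assms by (auto simp: Hom_arr)

text \<open>Composites are kept nested to the right, so an equation between neighbouring factors is applied
  through its consequence for an arbitrary tail \<open>x\<close>.\<close>

lemma comp_tail:
  assumes "a \<cdot> b = c" "a \<in> Arr C" "b \<in> Arr C" "x \<in> Arr C" "Dom C a = Cod C b" "Cod C x = Dom C b"
  shows "a \<cdot> (b \<cdot> x) = c \<cdot> x"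
  using comp_assoc[of x b a] assms by simp

lemma is_inverse_unique:
  assumes "is_inverse C f g" "is_inverse C f h"
  shows "g = h"
proof -
  have "g = g \<cdot> (f \<cdot> h)" using assms by (auto simp: is_inverse_def Hom_arr)
  also have "\<dots> = (g \<cdot> f) \<cdot> h" using assms by (subst comp_assoc) (auto simp: is_inverse_def Hom_arr)
  also have "\<dots> = h" using assms by (auto simp: is_inverse_def Hom_arr)
  finally show ?thesis .
qed

lemma inv_arr_eqI: "is_inverse C f g \<Longrightarrow> inv_arr C f = g"
  unfolding inv_arr_def by (rule the_equality) (auto intro: is_inverse_unique)

lemma iso_is_inverse: assumes "iso_arr C f" shows "is_inverse C f (inv_arr C f)"
proof -
  obtain g where g: "is_inverse C f g" using assms by (auto simp: iso_arr_def)
  show ?thesis unfolding inv_arr_eqI[OF g] by (rule g)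
qed

lemma iso_Arr: "iso_arr C f \<Longrightarrow> f \<in> Arr C"
  by (auto simp: iso_arr_def is_inverse_def)

lemma iso_inv [simp]:
  assumes "iso_arr C f"
  shows "inv_arr C f \<in> Arr C" "Dom C (inv_arr C f) = Cod C f" "Cod C (inv_arr C f) = Dom C f"
    "inv_arr C f \<cdot> f = Id C (Dom C f)" "f \<cdot> inv_arr C f = Id C (Cod C f)"
  using iso_is_inverse[OF assms] by (auto simp: is_inverse_def Hom_arr)

lemma iso_inv_tail [simp]:
  assumes "iso_arr C f" "x \<in> Arr C"
  shows "Cod C x = Dom C f \<Longrightarrow> inv_arr C f \<cdot> (f \<cdot> x) = x"
    "Cod C x = Cod C f \<Longrightarrow> f \<cdot> (inv_arr C f \<cdot> x) = x"
  by (subst comp_assoc[symmetric], simp_all add: assms iso_Arr)+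

lemma iso_inv_iso [simp]:
  assumes "iso_arr C f" shows "iso_arr C (inv_arr C f)" "inv_arr C (inv_arr C f) = f"
proof -
  have *: "is_inverse C (inv_arr C f) f"
    using assms iso_Arr[OF assms] by (auto simp: is_inverse_def Hom_arr)
  thus "iso_arr C (inv_arr C f)" by (auto simp: iso_arr_def)
  show "inv_arr C (inv_arr C f) = f" using * by (rule inv_arr_eqI)
qed

lemma Id_inverse: "X \<in> Obj C \<Longrightarrow> is_inverse C (Id C X) (Id C X)"
  by (auto simp: is_inverse_def Hom_arr)

lemma iso_Id [simp]: "X \<in> Obj C \<Longrightarrow> iso_arr C (Id C X)"
  using Id_inverse by (auto simp: iso_arr_def)

lemma inv_Id [simp]: "X \<in> Obj C \<Longrightarrow> inv_arr C (Id C X) = Id C X"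
  using Id_inverse by (rule inv_arr_eqI)

lemma comp_inverse:
  assumes "iso_arr C f" "iso_arr C g" "Dom C g = Cod C f"
  shows "is_inverse C (g \<cdot> f) (inv_arr C f \<cdot> inv_arr C g)"
  using assms assms(1,2)[THEN iso_Arr] by (auto simp: is_inverse_def Hom_arr comp_assoc)

lemma iso_comp [simp]:
  assumes "iso_arr C f" "iso_arr C g" "Dom C g = Cod C f"
  shows "iso_arr C (g \<cdot> f)"
  using comp_inverse[OF assms] by (auto simp: iso_arr_def)

lemma inv_comp [simp]:
  assumes "iso_arr C f" "iso_arr C g" "Dom C g = Cod C f"
  shows "inv_arr C (g \<cdot> f) = inv_arr C f \<cdot> inv_arr C g"
  using comp_inverse[OF assms] by (rule inv_arr_eqI)

lemma iso_obj_refl: "X \<in> Obj C \<Longrightarrow> iso_obj C X X"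
  unfolding iso_obj_def by (rule bexI[of _ "Id C X"]) (auto simp: Hom_arr)

lemma iso_obj_sym: assumes "iso_obj C X Y" shows "iso_obj C Y X"
proof -
  obtain f where "f \<in> Hom C X Y" "iso_arr C f" using assms by (auto simp: iso_obj_def)
  thus ?thesis unfolding iso_obj_def by (intro bexI[of _ "inv_arr C f"]) (auto simp: Hom_arr)
qed

lemma iso_obj_trans: assumes "iso_obj C X Y" "iso_obj C Y Z" shows "iso_obj C X Z"
proof -
  obtain f g where "f \<in> Hom C X Y" "iso_arr C f" "g \<in> Hom C Y Z" "iso_arr C g"
    using assms by (auto simp: iso_obj_def)
  thus ?thesis unfolding iso_obj_def by (intro bexI[of _ "g \<cdot> f"]) (auto simp: Hom_arr)
qed

end

context monoidal_category
begin

lemma Unit_Obj' [simp]: "Unit C \<in> Obj C" by (rule Unit_Obj)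

lemma TensO_Obj' [simp]: "X \<in> Obj C \<Longrightarrow> Y \<in> Obj C \<Longrightarrow> X \<boxtimes> Y \<in> Obj C" by (rule TensO_Obj)

lemma ten_arr [simp]:
  assumes "f \<in> Arr C" "g \<in> Arr C"
  shows "f \<star> g \<in> Arr C" "Dom C (f \<star> g) = Dom C f \<boxtimes> Dom C g" "Cod C (f \<star> g) = Cod C f \<boxtimes> Cod C g"
  using TensA_hom[of f "Dom C f" "Cod C f" g "Dom C g" "Cod C g"] assms by (auto simp: Hom_arr)

lemmas unit_simps [simp] = TensO_Unit Unit_TensO TensA_Unit Unit_TensA TensA_Id triangle

lemma interchange:
  assumes "f \<in> Arr C" "g \<in> Arr C" "f' \<in> Arr C" "g' \<in> Arr C" "Dom C f' = Cod C f" "Dom C g' = Cod C g"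
  shows "(f' \<star> g') \<cdot> (f \<star> g) = (f' \<cdot> f) \<star> (g' \<cdot> g)"
  using TensA_Comp[of f "Dom C f" "Cod C f" f' "Cod C f'" g "Dom C g" "Cod C g" g' "Cod C g'"] assms
  by (auto simp: Hom_arr)

lemma interchange_tail:
  assumes "f \<in> Arr C" "g \<in> Arr C" "f' \<in> Arr C" "g' \<in> Arr C" "Dom C f' = Cod C f" "Dom C g' = Cod C g"
    "x \<in> Arr C" "Cod C x = Dom C f \<boxtimes> Dom C g"
  shows "(f' \<star> g') \<cdot> ((f \<star> g) \<cdot> x) = ((f' \<cdot> f) \<star> (g' \<cdot> g)) \<cdot> x"
  using assms by (intro comp_tail[OF interchange]) auto

lemma assoc_arr [simp]:
  assumes "U \<in> Obj C" "V \<in> Obj C" "W \<in> Obj C"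
  shows "iso_arr C (\<Phi> U V W)" "Dom C (\<Phi> U V W) = (U \<boxtimes> V) \<boxtimes> W" "Cod C (\<Phi> U V W) = U \<boxtimes> (V \<boxtimes> W)"
    "\<Phi> U V W \<in> Arr C"
  using Assoc_hom[OF assms] Assoc_iso[OF assms] by (auto simp: Hom_arr)

lemma assoc_nat:
  assumes "f \<in> Arr C" "g \<in> Arr C" "h \<in> Arr C" "Cod C f = U" "Cod C g = V" "Cod C h = W"
  shows "\<Phi> U V W \<cdot> ((f \<star> g) \<star> h) = (f \<star> (g \<star> h)) \<cdot> \<Phi> (Dom C f) (Dom C g) (Dom C h)"
  using Assoc_natural[of f "Dom C f" "Cod C f" g "Dom C g" "Cod C g" h "Dom C h" "Cod C h"] assms
  by (auto simp: Hom_arr)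

lemma ten_inverse:
  assumes "iso_arr C f" "iso_arr C g"
  shows "is_inverse C (f \<star> g) (inv_arr C f \<star> inv_arr C g)"
  using assms assms[THEN iso_Arr] by (auto simp: is_inverse_def Hom_arr interchange)

lemma iso_ten [simp]: "iso_arr C f \<Longrightarrow> iso_arr C g \<Longrightarrow> iso_arr C (f \<star> g)"
  using ten_inverse by (auto simp: iso_arr_def)

lemma inv_ten [simp]: "iso_arr C f \<Longrightarrow> iso_arr C g \<Longrightarrow> inv_arr C (f \<star> g) = inv_arr C f \<star> inv_arr C g"
  by (rule inv_arr_eqI[OF ten_inverse])

lemma assoc_inv_nat:
  assumes "f \<in> Arr C" "g \<in> Arr C" "h \<in> Arr C" "Cod C f = U" "Cod C g = V" "Cod C h = W"
  shows "inv_arr C (\<Phi> U V W) \<cdot> (f \<star> (g \<star> h)) = ((f \<star> g) \<star> h) \<cdot> inv_arr C (\<Phi> (Dom C f) (Dom C g) (Dom C h))"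
proof -
  let ?p = "\<Phi> U V W" and ?q = "\<Phi> (Dom C f) (Dom C g) (Dom C h)"
  have "inv_arr C ?p \<cdot> (f \<star> (g \<star> h)) = inv_arr C ?p \<cdot> (((f \<star> (g \<star> h)) \<cdot> ?q) \<cdot> inv_arr C ?q)"
    using assms by (auto simp: comp_assoc)
  also have "\<dots> = inv_arr C ?p \<cdot> ((?p \<cdot> ((f \<star> g) \<star> h)) \<cdot> inv_arr C ?q)"
    by (simp add: assoc_nat[OF assms])
  also have "\<dots> = ((f \<star> g) \<star> h) \<cdot> inv_arr C ?q"
    using assms by (auto simp: comp_assoc)
  finally show ?thesis .
qed

text \<open>The pentagon with two unit objects makes the associator idempotent, and an invertible idempotent
  is an identity. The same argument gives the unit on the left.\<close>

lemma assoc_Unit_right [simp]: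
  assumes "U \<in> Obj C" "V \<in> Obj C"
  shows "\<Phi> U V (Unit C) = Id C (U \<boxtimes> V)"
proof -
  let ?p = "\<Phi> U V (Unit C)"
  have "?p = ?p \<cdot> ?p"
    using pentagon[OF assms, of "Unit C" "Unit C"] assms by (simp add: comp_assoc)
  hence "inv_arr C ?p \<cdot> ?p = inv_arr C ?p \<cdot> (?p \<cdot> ?p)" by simp
  thus ?thesis using assms by simp
qed

lemma assoc_Unit_left [simp]:
  assumes "U \<in> Obj C" "V \<in> Obj C"
  shows "\<Phi> (Unit C) U V = Id C (U \<boxtimes> V)"
proof -
  let ?p = "\<Phi> (Unit C) U V"
  have "?p = ?p \<cdot> ?p"
    using pentagon[of "Unit C" "Unit C" U V] assms by (simp add: comp_assoc)
  hence "inv_arr C ?p \<cdot> ?p = inv_arr C ?p \<cdot> (?p \<cdot> ?p)" by simp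
  thus ?thesis using assms by simp
qed

text \<open>A morphism out of the unit object can be created before or after another morphism happens beside
  it; with a strict unit this is the interchange law.\<close>

lemma ten_unit_slide:
  assumes "d \<in> Arr C" "f \<in> Arr C" "Dom C d = Unit C"
  shows "(d \<star> Id C (Cod C f)) \<cdot> f = d \<star> f"
  using interchange[of "Id C (Unit C)" f d "Id C (Cod C f)"] assms by simp

lemma ten_unit_slide':
  assumes "d \<in> Arr C" "f \<in> Arr C" "Dom C d = Unit C"
  shows "(Id C (Cod C f) \<star> d) \<cdot> f = f \<star> d"
  using interchange[of f "Id C (Unit C)" "Id C (Cod C f)" d] assms by simp

lemma ten_counit_slide:
  assumes "e \<in> Arr C" "k \<in> Arr C" "Cod C e = Unit C"
  shows "k \<cdot> (Id C (Dom C k) \<star> e) = k \<star> e" "k \<cdot> (e \<star> Id C (Dom C k)) = e \<star> k"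
  using interchange[of "Id C (Dom C k)" e k "Id C (Unit C)"]
    interchange[of e "Id C (Dom C k)" "Id C (Unit C)" k] assms by simp_all

end

section \<open>Duality calculus\<close>

text \<open>The zigzag calculus is needed for three kinds of pairs: an object with its chosen dual, a dual with
  the bidual, and a dual with the original object after twisting by a pivotal isomorphism. The
  locale therefore leaves unit and counit arbitrary.\<close>

locale dual_pair = monoidal_category C
  for C :: "('o, 'm, 'x) moncat_scheme" (structure) +
  fixes X Y :: 'o and d e :: 'm
  assumes X_Obj [simp]: "X \<in> Obj C" and Y_Obj [simp]: "Y \<in> Obj C"
    and d_Hom: "d \<in> Hom C (Unit C) (X \<boxtimes> Y)" and e_Hom: "e \<in> Hom C (Y \<boxtimes> X) (Unit C)"
    and zigzag_X: "(Id C X \<star> e) \<cdot> \<Phi> X Y X \<cdot> (d \<star> Id C X) = Id C X"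
    and zigzag_Y: "(e \<star> Id C Y) \<cdot> inv_arr C (\<Phi> Y X Y) \<cdot> (Id C Y \<star> d) = Id C Y"
begin

lemma unit_counit_arr [simp]: "d \<in> Arr C" "Dom C d = Unit C" "Cod C d = X \<boxtimes> Y"
    "e \<in> Arr C" "Dom C e = Y \<boxtimes> X" "Cod C e = Unit C"
  using d_Hom e_Hom by (auto simp: Hom_arr)

lemma zigzag_X': "(Id C X \<star> e) \<cdot> (\<Phi> X Y X \<cdot> (d \<star> Id C X)) = Id C X"
  using zigzag_X by (simp add: comp_assoc)

lemma zigzag_Y': "(e \<star> Id C Y) \<cdot> (inv_arr C (\<Phi> Y X Y) \<cdot> (Id C Y \<star> d)) = Id C Y"
  using zigzag_Y by (simp add: comp_assoc)

text \<open>Bending the strand \<open>X\<close> of \<open>f\<close> down with \<open>e\<close> and up again with \<open>d\<close> straightens out: \<open>d\<close> slides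
  past \<open>f\<close>, and the pentagon regroups the associators so that \<open>zigzag_X\<close> appears on that strand.\<close>

lemma bend_right_left:
  assumes "f \<in> Arr C" "Dom C f = Unit C" "Cod C f = X \<boxtimes> W" "W \<in> Obj C"
  shows "(Id C X \<star> ((e \<star> Id C W) \<cdot> (inv_arr C (\<Phi> Y X W) \<cdot> (Id C Y \<star> f)))) \<cdot> d = f"
proof -
  note [simp] = assms
  let ?IX = "Id C X" and ?IW = "Id C W" and ?IY = "Id C Y"
  have s1: "?IX \<star> ((e \<star> ?IW) \<cdot> (inv_arr C (\<Phi> Y X W) \<cdot> (?IY \<star> f))) =
      (?IX \<star> (e \<star> ?IW)) \<cdot> ((?IX \<star> inv_arr C (\<Phi> Y X W)) \<cdot> (?IX \<star> (?IY \<star> f)))"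
    by (simp add: interchange)
  have "(?IX \<star> (?IY \<star> f)) \<cdot> d = \<Phi> X Y (X \<boxtimes> W) \<cdot> ((Id C (X \<boxtimes> Y) \<star> f) \<cdot> d)"
    using assoc_nat[of ?IX ?IY f X Y "X \<boxtimes> W"] by (simp add: comp_tail)
  \<comment> \<open>The unit \<open>d\<close> may be created after \<open>f\<close> instead of before it.\<close>
  also have "(Id C (X \<boxtimes> Y) \<star> f) \<cdot> d = (d \<star> Id C (X \<boxtimes> W)) \<cdot> f"
    using ten_unit_slide[of d f] ten_unit_slide'[of f d] by simp
  also have "d \<star> Id C (X \<boxtimes> W) = \<Phi> (X \<boxtimes> Y) X W \<cdot> ((d \<star> ?IX) \<star> ?IW)"
    using assoc_nat[of d ?IX ?IW "X \<boxtimes> Y" X W] by simp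
  finally have s2: "(?IX \<star> (?IY \<star> f)) \<cdot> d =
      (\<Phi> X Y (X \<boxtimes> W) \<cdot> \<Phi> (X \<boxtimes> Y) X W) \<cdot> (((d \<star> ?IX) \<star> ?IW) \<cdot> f)"
    by (simp add: comp_assoc)
  have s3: "(?IX \<star> inv_arr C (\<Phi> Y X W)) \<cdot> (\<Phi> X Y (X \<boxtimes> W) \<cdot> \<Phi> (X \<boxtimes> Y) X W)
      = \<Phi> X (Y \<boxtimes> X) W \<cdot> (\<Phi> X Y X \<star> ?IW)"
    unfolding pentagon[OF X_Obj Y_Obj X_Obj assms(4)]
    by (simp add: comp_assoc interchange_tail)
  have s4: "(?IX \<star> (e \<star> ?IW)) \<cdot> \<Phi> X (Y \<boxtimes> X) W = (?IX \<star> e) \<star> ?IW"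
    using assoc_nat[of ?IX e ?IW X "Unit C" W] by simp
  have "(?IX \<star> ((e \<star> ?IW) \<cdot> (inv_arr C (\<Phi> Y X W) \<cdot> (?IY \<star> f)))) \<cdot> d
      = (?IX \<star> (e \<star> ?IW)) \<cdot> (((?IX \<star> inv_arr C (\<Phi> Y X W)) \<cdot> (\<Phi> X Y (X \<boxtimes> W) \<cdot> \<Phi> (X \<boxtimes> Y) X W))
          \<cdot> (((d \<star> ?IX) \<star> ?IW) \<cdot> f))"
    unfolding s1 by (simp add: comp_assoc s2)
  also have "\<dots> = ((?IX \<star> (e \<star> ?IW)) \<cdot> \<Phi> X (Y \<boxtimes> X) W) \<cdot> ((\<Phi> X Y X \<star> ?IW) \<cdot> (((d \<star> ?IX) \<star> ?IW) \<cdot> f))"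
    unfolding s3 by (simp add: comp_assoc)
  also have "\<dots> = (((?IX \<star> e) \<cdot> (\<Phi> X Y X \<cdot> (d \<star> ?IX))) \<star> ?IW) \<cdot> f"
    unfolding s4 by (simp add: interchange interchange_tail)
  also have "\<dots> = f" by (simp add: zigzag_X')
  finally show ?thesis .
qed

text \<open>Here no regrouping occurs: naturality moves \<open>g\<close> to the outside and leaves \<open>zigzag_Y\<close>. Together
  with \<open>bend_right_left\<close> this is the bijection between \<open>C(I, X \<otimes> W)\<close> and \<open>C(Y, W)\<close>.\<close>

lemma bend_left_right:
  assumes "g \<in> Arr C" "Dom C g = Y" "Cod C g = W"
  shows "(e \<star> Id C W) \<cdot> (inv_arr C (\<Phi> Y X W) \<cdot> (Id C Y \<star> ((Id C X \<star> g) \<cdot> d))) = g"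
proof -
  note [simp] = assms
  have [simp]: "W \<in> Obj C" using assms arr_Obj by blast
  have s1: "Id C Y \<star> ((Id C X \<star> g) \<cdot> d) = (Id C Y \<star> (Id C X \<star> g)) \<cdot> (Id C Y \<star> d)"
    by (simp add: interchange)
  have s2: "inv_arr C (\<Phi> Y X W) \<cdot> ((Id C Y \<star> (Id C X \<star> g)) \<cdot> (Id C Y \<star> d))
      = (Id C (Y \<boxtimes> X) \<star> g) \<cdot> (inv_arr C (\<Phi> Y X Y) \<cdot> (Id C Y \<star> d))"
    using comp_tail[OF assoc_inv_nat[of "Id C Y" "Id C X" g Y X W], of "Id C Y \<star> d"] by (simp add: comp_assoc)
  have s3: "(e \<star> Id C W) \<cdot> ((Id C (Y \<boxtimes> X) \<star> g) \<cdot> x) = g \<cdot> ((e \<star> Id C Y) \<cdot> x)"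
    if "x \<in> Arr C" "Cod C x = (Y \<boxtimes> X) \<boxtimes> Y" for x
    using interchange_tail[of "Id C (Y \<boxtimes> X)" g e "Id C W" x]
      interchange_tail[of e "Id C Y" "Id C (Unit C)" g x] that by simp
  show ?thesis by (simp add: s1 s2 s3 zigzag_Y')
qed

text \<open>The mirror image of \<open>bend_right_left\<close>: the strand that is straightened now stands on the right.\<close>

lemma mirror_bend:
  assumes "f \<in> Arr C" "Dom C f = Unit C" "Cod C f = W \<boxtimes> Y" "W \<in> Obj C"
  shows "(((Id C W \<star> e) \<cdot> (\<Phi> W Y X \<cdot> (f \<star> Id C X))) \<star> Id C Y) \<cdot> d = f"
proof -
  note [simp] = assms
  let ?IX = "Id C X" and ?IW = "Id C W" and ?IY = "Id C Y"
  let ?i = "inv_arr C"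
  have s1: "((?IW \<star> e) \<cdot> (\<Phi> W Y X \<cdot> (f \<star> ?IX))) \<star> ?IY =
      ((?IW \<star> e) \<star> ?IY) \<cdot> ((\<Phi> W Y X \<star> ?IY) \<cdot> ((f \<star> ?IX) \<star> ?IY))"
    by (simp add: interchange)
  have "((f \<star> ?IX) \<star> ?IY) \<cdot> d = ?i (\<Phi> (W \<boxtimes> Y) X Y) \<cdot> ((f \<star> Id C (X \<boxtimes> Y)) \<cdot> d)"
    using assoc_inv_nat[of f ?IX ?IY "W \<boxtimes> Y" X Y] by (simp add: comp_tail)
  also have "(f \<star> Id C (X \<boxtimes> Y)) \<cdot> d = (Id C (W \<boxtimes> Y) \<star> d) \<cdot> f"
    using ten_unit_slide[of f d] ten_unit_slide'[of d f] by simp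
  also have "Id C (W \<boxtimes> Y) \<star> d = ?i (\<Phi> W Y (X \<boxtimes> Y)) \<cdot> (?IW \<star> (?IY \<star> d))"
    using assoc_inv_nat[of ?IW ?IY d W Y "X \<boxtimes> Y"] by simp
  finally have s2: "((f \<star> ?IX) \<star> ?IY) \<cdot> d =
      ?i (\<Phi> W Y (X \<boxtimes> Y) \<cdot> \<Phi> (W \<boxtimes> Y) X Y) \<cdot> ((?IW \<star> (?IY \<star> d)) \<cdot> f)"
    by (simp add: comp_assoc)
  have "\<Phi> W Y (X \<boxtimes> Y) \<cdot> \<Phi> (W \<boxtimes> Y) X Y = (?IW \<star> \<Phi> Y X Y) \<cdot> (\<Phi> W (Y \<boxtimes> X) Y \<cdot> (\<Phi> W Y X \<star> ?IY))"
    using pentagon[OF assms(4) Y_Obj X_Obj Y_Obj] by (simp add: comp_assoc)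
  hence "?i (\<Phi> W Y (X \<boxtimes> Y) \<cdot> \<Phi> (W \<boxtimes> Y) X Y)
      = (?i (\<Phi> W Y X) \<star> ?IY) \<cdot> (?i (\<Phi> W (Y \<boxtimes> X) Y) \<cdot> (?IW \<star> ?i (\<Phi> Y X Y)))"
    by (simp add: comp_assoc)
  hence s3: "(\<Phi> W Y X \<star> ?IY) \<cdot> ?i (\<Phi> W Y (X \<boxtimes> Y) \<cdot> \<Phi> (W \<boxtimes> Y) X Y)
      = ?i (\<Phi> W (Y \<boxtimes> X) Y) \<cdot> (?IW \<star> ?i (\<Phi> Y X Y))"
    by (simp add: interchange_tail)
  have s4: "((?IW \<star> e) \<star> ?IY) \<cdot> ?i (\<Phi> W (Y \<boxtimes> X) Y) = ?IW \<star> (e \<star> ?IY)"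
    using assoc_inv_nat[of ?IW e ?IY W "Unit C" Y] by simp
  have "(((?IW \<star> e) \<cdot> (\<Phi> W Y X \<cdot> (f \<star> ?IX))) \<star> ?IY) \<cdot> d
      = ((?IW \<star> e) \<star> ?IY) \<cdot> (((\<Phi> W Y X \<star> ?IY) \<cdot> ?i (\<Phi> W Y (X \<boxtimes> Y) \<cdot> \<Phi> (W \<boxtimes> Y) X Y))
          \<cdot> ((?IW \<star> (?IY \<star> d)) \<cdot> f))"
    unfolding s1 by (simp add: comp_assoc s2)
  also have "\<dots> = (((?IW \<star> e) \<star> ?IY) \<cdot> ?i (\<Phi> W (Y \<boxtimes> X) Y)) \<cdot> ((?IW \<star> ?i (\<Phi> Y X Y)) \<cdot> ((?IW \<star> (?IY \<star> d)) \<cdot> f))"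
    unfolding s3 by (simp add: comp_assoc)
  also have "\<dots> = (?IW \<star> ((e \<star> ?IY) \<cdot> (?i (\<Phi> Y X Y) \<cdot> (?IY \<star> d)))) \<cdot> f"
    unfolding s4 by (simp add: interchange interchange_tail)
  also have "\<dots> = f" by (simp add: zigzag_Y')
  finally show ?thesis .
qed

text \<open>Every \<open>k : Z \<otimes> X \<rightarrow> I\<close> factors through \<open>e\<close>, again by regrouping to \<open>zigzag_X\<close>; \<open>curry_unique\<close>
  says that the factor is unique.\<close>

lemma curry_ev:
  assumes "k \<in> Arr C" "Dom C k = Z \<boxtimes> X" "Cod C k = Unit C" "Z \<in> Obj C"
  shows "e \<cdot> (((k \<star> Id C Y) \<cdot> (inv_arr C (\<Phi> Z X Y) \<cdot> (Id C Z \<star> d))) \<star> Id C X) = k"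
proof -
  note [simp] = assms
  let ?IX = "Id C X" and ?IZ = "Id C Z" and ?IY = "Id C Y"
  let ?i = "inv_arr C"
  have s1: "((k \<star> ?IY) \<cdot> (?i (\<Phi> Z X Y) \<cdot> (?IZ \<star> d))) \<star> ?IX =
      ((k \<star> ?IY) \<star> ?IX) \<cdot> ((?i (\<Phi> Z X Y) \<star> ?IX) \<cdot> ((?IZ \<star> d) \<star> ?IX))"
    by (simp add: interchange)
  have "e \<cdot> ((k \<star> ?IY) \<star> ?IX) = e \<cdot> ((k \<star> Id C (Y \<boxtimes> X)) \<cdot> \<Phi> (Z \<boxtimes> X) Y X)"
    using assoc_nat[of k ?IY ?IX "Unit C" Y X] by simp
  also have "\<dots> = (k \<star> e) \<cdot> \<Phi> (Z \<boxtimes> X) Y X"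
    using ten_counit_slide(2)[of k e] by (simp add: comp_tail)
  also have "k \<star> e = k \<cdot> (Id C (Z \<boxtimes> X) \<star> e)"
    using ten_counit_slide(1)[of e k] by simp
  also have "Id C (Z \<boxtimes> X) \<star> e = (?IZ \<star> (?IX \<star> e)) \<cdot> \<Phi> Z X (Y \<boxtimes> X)"
    using assoc_nat[of ?IZ ?IX e Z X "Unit C"] by simp
  finally have s2: "e \<cdot> ((k \<star> ?IY) \<star> ?IX) =
      k \<cdot> ((?IZ \<star> (?IX \<star> e)) \<cdot> (\<Phi> Z X (Y \<boxtimes> X) \<cdot> \<Phi> (Z \<boxtimes> X) Y X))"
    by (simp add: comp_assoc)
  have s3: "\<Phi> Z X (Y \<boxtimes> X) \<cdot> \<Phi> (Z \<boxtimes> X) Y X \<cdot> (?i (\<Phi> Z X Y) \<star> ?IX)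
      = (?IZ \<star> \<Phi> X Y X) \<cdot> \<Phi> Z (X \<boxtimes> Y) X"
    unfolding pentagon[OF assms(4) X_Obj Y_Obj X_Obj] by (simp add: comp_assoc interchange)
  have s4: "\<Phi> Z (X \<boxtimes> Y) X \<cdot> ((?IZ \<star> d) \<star> ?IX) = ?IZ \<star> (d \<star> ?IX)"
    using assoc_nat[of ?IZ d ?IX Z "X \<boxtimes> Y" X] by simp
  have "e \<cdot> (((k \<star> ?IY) \<cdot> (?i (\<Phi> Z X Y) \<cdot> (?IZ \<star> d))) \<star> ?IX)
      = (e \<cdot> ((k \<star> ?IY) \<star> ?IX)) \<cdot> ((?i (\<Phi> Z X Y) \<star> ?IX) \<cdot> ((?IZ \<star> d) \<star> ?IX))"
    unfolding s1 by (simp add: comp_assoc)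
  also have "\<dots> = k \<cdot> ((?IZ \<star> (?IX \<star> e)) \<cdot> ((\<Phi> Z X (Y \<boxtimes> X) \<cdot> \<Phi> (Z \<boxtimes> X) Y X \<cdot> (?i (\<Phi> Z X Y) \<star> ?IX))
      \<cdot> ((?IZ \<star> d) \<star> ?IX)))"
    unfolding s2 by (simp add: comp_assoc)
  also have "\<dots> = k \<cdot> ((?IZ \<star> (?IX \<star> e)) \<cdot> ((?IZ \<star> \<Phi> X Y X) \<cdot> (\<Phi> Z (X \<boxtimes> Y) X \<cdot> ((?IZ \<star> d) \<star> ?IX))))"
    unfolding s3 by (simp add: comp_assoc)
  also have "\<dots> = k"
    unfolding s4 by (simp add: interchange zigzag_X')
  finally show ?thesis .
qed

lemma curry_unique:
  assumes "h \<in> Arr C" "Dom C h = Z" "Cod C h = Y"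
  shows "h = ((e \<cdot> (h \<star> Id C X)) \<star> Id C Y) \<cdot> (inv_arr C (\<Phi> Z X Y) \<cdot> (Id C Z \<star> d))"
proof -
  note [simp] = assms
  have [simp]: "Z \<in> Obj C" using assms arr_Obj by blast
  have s1: "(e \<cdot> (h \<star> Id C X)) \<star> Id C Y = (e \<star> Id C Y) \<cdot> ((h \<star> Id C X) \<star> Id C Y)"
    by (simp add: interchange)
  have s2: "((h \<star> Id C X) \<star> Id C Y) \<cdot> (inv_arr C (\<Phi> Z X Y) \<cdot> x) = inv_arr C (\<Phi> Y X Y) \<cdot> ((h \<star> Id C (X \<boxtimes> Y)) \<cdot> x)"
    if "x \<in> Arr C" "Cod C x = Z \<boxtimes> (X \<boxtimes> Y)" for x
    using comp_tail[OF assoc_inv_nat[of h "Id C X" "Id C Y" Y X Y], of x] that by (simp add: comp_assoc)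
  have s3: "(h \<star> Id C (X \<boxtimes> Y)) \<cdot> (Id C Z \<star> d) = (Id C Y \<star> d) \<cdot> h"
    using ten_unit_slide'[of d h] by (simp add: interchange)
  have "((e \<cdot> (h \<star> Id C X)) \<star> Id C Y) \<cdot> (inv_arr C (\<Phi> Z X Y) \<cdot> (Id C Z \<star> d))
     = ((e \<star> Id C Y) \<cdot> (inv_arr C (\<Phi> Y X Y) \<cdot> (Id C Y \<star> d))) \<cdot> h"
    unfolding s1 by (simp add: comp_assoc s2 s3)
  thus ?thesis by (simp add: zigzag_Y')
qed

end

lemma (in rigid_category) dual_pair_Dual: "V \<in> Obj C \<Longrightarrow> dual_pair C V (Dual C V) (Db C V) (Ev C V)"
  by unfold_locales (simp_all add: Dual_Obj Db_hom Ev_hom zigzag zigzag_Dual)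

context rigid_category
begin

lemma Dual_Obj' [simp]: "V \<in> Obj C \<Longrightarrow> Dual C V \<in> Obj C" by (rule Dual_Obj)

lemma ev_arr [simp]: assumes "V \<in> Obj C"
  shows "Ev C V \<in> Arr C" "Dom C (Ev C V) = Dual C V \<boxtimes> V" "Cod C (Ev C V) = Unit C"
  using Ev_hom[OF assms] by (auto simp: Hom_arr)

lemma db_arr [simp]: assumes "V \<in> Obj C"
  shows "Db C V \<in> Arr C" "Dom C (Db C V) = Unit C" "Cod C (Db C V) = V \<boxtimes> Dual C V"
  using Db_hom[OF assms] by (auto simp: Hom_arr)

text \<open>The defining equation of the dual morphism is solved by \<open>curry_ev\<close>, and \<open>curry_unique\<close> makes the
  solution unique.\<close>

lemma dual_arr_formula:
  assumes "g \<in> Arr C" "Dom C g = V" "Cod C g = W"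
  shows "dual_arr C g = ((Ev C W \<cdot> (Id C (Dual C W) \<star> g)) \<star> Id C (Dual C V))
    \<cdot> (inv_arr C (\<Phi> (Dual C W) V (Dual C V)) \<cdot> (Id C (Dual C W) \<star> Db C V))" (is "_ = ?h")
proof -
  note [simp] = assms
  have [simp]: "V \<in> Obj C" "W \<in> Obj C" using assms arr_Obj by blast+
  interpret V: dual_pair C V "Dual C V" "Db C V" "Ev C V" by (simp add: dual_pair_Dual)
  let ?k = "Ev C W \<cdot> (Id C (Dual C W) \<star> g)"
  show ?thesis unfolding dual_arr_def
  proof (rule the_equality)
    show "?h \<in> Hom C (Dual C (Cod C g)) (Dual C (Dom C g)) \<and>
      Ev C (Dom C g) \<cdot> (?h \<star> Id C (Dom C g)) = Ev C (Cod C g) \<cdot> (Id C (Dual C (Cod C g)) \<star> g)"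
      using V.curry_ev[of ?k "Dual C W"] by (simp add: Hom_arr)
  next
    fix h assume h: "h \<in> Hom C (Dual C (Cod C g)) (Dual C (Dom C g)) \<and>
      Ev C (Dom C g) \<cdot> (h \<star> Id C (Dom C g)) = Ev C (Cod C g) \<cdot> (Id C (Dual C (Cod C g)) \<star> g)"
    show "h = ?h" using V.curry_unique[of h "Dual C W"] h by (simp add: Hom_arr)
  qed
qed

lemma dual_arr_arr [simp]:
  assumes "g \<in> Arr C"
  shows "dual_arr C g \<in> Arr C" "Dom C (dual_arr C g) = Dual C (Cod C g)" "Cod C (dual_arr C g) = Dual C (Dom C g)"
  using dual_arr_formula[OF assms refl refl] assms by simp_all

text \<open>Bending the right hand side over to a morphism \<open>W\<^sup>\<or> \<rightarrow> V\<^sup>\<or>\<close> gives exactly the explicit formula for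
  \<open>g\<^sup>\<or>\<close>. This is the step that removes the dual of \<open>W\<close> from the rotation.\<close>

lemma db_dinatural:
  assumes "g \<in> Arr C" "Dom C g = V" "Cod C g = W"
  shows "(Id C W \<star> dual_arr C g) \<cdot> Db C W = (g \<star> Id C (Dual C V)) \<cdot> Db C V"
proof -
  note [simp] = assms
  have [simp]: "V \<in> Obj C" "W \<in> Obj C" using assms arr_Obj by blast+
  interpret W: dual_pair C W "Dual C W" "Db C W" "Ev C W" by (simp add: dual_pair_Dual)
  let ?f = "(g \<star> Id C (Dual C V)) \<cdot> Db C V"
  have s: "inv_arr C (\<Phi> (Dual C W) W (Dual C V)) \<cdot> ((Id C (Dual C W) \<star> (g \<star> Id C (Dual C V))) \<cdot> x)
     = ((Id C (Dual C W) \<star> g) \<star> Id C (Dual C V)) \<cdot> (inv_arr C (\<Phi> (Dual C W) V (Dual C V)) \<cdot> x)"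
    if "x \<in> Arr C" "Cod C x = Dual C W \<boxtimes> (V \<boxtimes> Dual C V)" for x
    using comp_tail[OF assoc_inv_nat[of "Id C (Dual C W)" g "Id C (Dual C V)" "Dual C W" W "Dual C V"], of x] that
    by (simp add: comp_assoc)
  have t: "Id C (Dual C W) \<star> ?f = (Id C (Dual C W) \<star> (g \<star> Id C (Dual C V))) \<cdot> (Id C (Dual C W) \<star> Db C V)"
    by (simp add: interchange)
  have "(Ev C W \<star> Id C (Dual C V)) \<cdot> (inv_arr C (\<Phi> (Dual C W) W (Dual C V)) \<cdot> (Id C (Dual C W) \<star> ?f)) = dual_arr C g"
    unfolding t dual_arr_formula[OF assms] by (simp add: s interchange_tail)
  thus ?thesis using W.bend_right_left[of ?f "Dual C V"] by simp
qed

end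

section \<open>The rotation in terms of a twisted duality\<close>

text \<open>An isomorphism \<open>a : V \<rightarrow> V\<^sup>\<or>\<^sup>\<or>\<close> turns the left dual \<open>V\<^sup>\<or>\<close> into a right dual of \<open>V\<close>; the following
  two morphisms are its evaluation \<open>V \<otimes> V\<^sup>\<or> \<rightarrow> I\<close> and its coevaluation \<open>I \<rightarrow> V\<^sup>\<or> \<otimes> V\<close>.\<close>

definition twisted_ev :: "('o, 'm, 'x) rigcat_scheme \<Rightarrow> 'm \<Rightarrow> 'm" where
  "twisted_ev C a = Ev C (Dual C (Dom C a)) \<cdot>\<^bsub>C\<^esub> (a \<star>\<^bsub>C\<^esub> Id C (Dual C (Dom C a)))"

definition twisted_db :: "('o, 'm, 'x) rigcat_scheme \<Rightarrow> 'm \<Rightarrow> 'm" where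
  "twisted_db C a = (Id C (Dual C (Dom C a)) \<star>\<^bsub>C\<^esub> inv_arr C a) \<cdot>\<^bsub>C\<^esub> Db C (Dual C (Dom C a))"

context rigid_category
begin

lemma A_map_eq:
  assumes "f \<in> Arr C" "V \<in> Obj C" "W \<in> Obj C" "Cod C f = V \<boxtimes> W" "Dom C f = Unit C"
  shows "A_map C V W f = (Ev C V \<star> Id C W) \<cdot> (inv_arr C (\<Phi> (Dual C V) V W) \<cdot> (Id C (Dual C V) \<star> f))"
    "A_map C V W f \<in> Arr C" "Dom C (A_map C V W f) = Dual C V" "Cod C (A_map C V W f) = W"
  using assms unfolding A_map_def by (simp_all add: comp_assoc)

lemma A_inv_A_map:
  assumes "f \<in> Arr C" "V \<in> Obj C" "W \<in> Obj C" "Cod C f = V \<boxtimes> W" "Dom C f = Unit C"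
  shows "(Id C V \<star> A_map C V W f) \<cdot> Db C V = f"
proof -
  interpret V: dual_pair C V "Dual C V" "Db C V" "Ev C V" using assms by (simp add: dual_pair_Dual)
  show ?thesis using V.bend_right_left[of f W] assms by (simp add: A_map_eq)
qed

lemma A_map_A_inv:
  assumes "g \<in> Arr C" "V \<in> Obj C" "Dom C g = Dual C V" "Cod C g = W"
  shows "A_map C V W ((Id C V \<star> g) \<cdot> Db C V) = g"
proof -
  interpret V: dual_pair C V "Dual C V" "Db C V" "Ev C V" using assms by (simp add: dual_pair_Dual)
  have [simp]: "W \<in> Obj C" using assms arr_Obj by blast
  show ?thesis using V.bend_left_right[of g W] assms by (simp add: A_map_eq)
qed

text \<open>Since \<open>A\<close> is inverse to \<open>g \<mapsto> (V \<otimes> g) db\<^sub>V\<close>, naturality is inherited from the latter map, where it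
  is the interchange law.\<close>

lemma A_map_natural:
  assumes "f \<in> Arr C" "V \<in> Obj C" "Cod C f = V \<boxtimes> W" "Dom C f = Unit C"
    "h \<in> Arr C" "Dom C h = W" "Cod C h = W'"
  shows "A_map C V W' ((Id C V \<star> h) \<cdot> f) = h \<cdot> A_map C V W f"
proof -
  have W: "W \<in> Obj C" "W' \<in> Obj C" using assms arr_Obj by blast+
  let ?g = "A_map C V W f"
  have "(Id C V \<star> h) \<cdot> f = (Id C V \<star> h) \<cdot> ((Id C V \<star> ?g) \<cdot> Db C V)"
    using assms W by (simp add: A_inv_A_map)
  also have "\<dots> = (Id C V \<star> (h \<cdot> ?g)) \<cdot> Db C V"
    using assms W by (simp add: interchange_tail A_map_eq(2-4))
  finally show ?thesis using assms W by (simp add: A_map_A_inv A_map_eq(2-4))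
qed

context
  fixes V a
  assumes V: "V \<in> Obj C" and a: "a \<in> Hom C V (Dual C (Dual C V))" "iso_arr C a"
begin

lemma twist_arr:
  "a \<in> Arr C" "Dom C a = V" "Cod C a = Dual C (Dual C V)" "iso_arr C a" "V \<in> Obj C"
  using V a by (auto simp: Hom_arr)

lemma twisted_arr:
  "twisted_ev C a \<in> Arr C" "Dom C (twisted_ev C a) = V \<boxtimes> Dual C V" "Cod C (twisted_ev C a) = Unit C"
  "twisted_db C a \<in> Arr C" "Dom C (twisted_db C a) = Unit C" "Cod C (twisted_db C a) = Dual C V \<boxtimes> V"
  by (simp_all add: twisted_ev_def twisted_db_def twist_arr)

text \<open>The zigzag identities are those of \<open>V\<^sup>\<or>\<close> and \<open>V\<^sup>\<or>\<^sup>\<or>\<close>, conjugated by \<open>a\<close>.\<close>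

lemma twisted_dual_pair: "dual_pair C (Dual C V) V (twisted_db C a) (twisted_ev C a)"
proof -
  note [simp] = twist_arr twisted_arr
  let ?V' = "Dual C V" and ?i = "inv_arr C a"
  interpret V': dual_pair C ?V' "Dual C ?V'" "Db C ?V'" "Ev C ?V'" by (simp add: dual_pair_Dual)
  have 1: "(Id C ?V' \<star> twisted_ev C a) = (Id C ?V' \<star> Ev C ?V') \<cdot> (Id C ?V' \<star> (a \<star> Id C ?V'))"
    by (simp add: twisted_ev_def interchange)
  have 2: "(twisted_db C a \<star> Id C ?V') = ((Id C ?V' \<star> ?i) \<star> Id C ?V') \<cdot> (Db C ?V' \<star> Id C ?V')"
    by (simp add: twisted_db_def interchange)
  have 3: "\<Phi> ?V' V ?V' \<cdot> (((Id C ?V' \<star> ?i) \<star> Id C ?V') \<cdot> (Db C ?V' \<star> Id C ?V')) =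
     (Id C ?V' \<star> (?i \<star> Id C ?V')) \<cdot> (\<Phi> ?V' (Dual C ?V') ?V' \<cdot> (Db C ?V' \<star> Id C ?V'))"
    using comp_tail[OF assoc_nat[of "Id C ?V'" ?i "Id C ?V'" ?V' V ?V'], of "Db C ?V' \<star> Id C ?V'"]
    by (simp add: comp_assoc)
  have zX: "(Id C ?V' \<star> twisted_ev C a) \<cdot> \<Phi> ?V' V ?V' \<cdot> (twisted_db C a \<star> Id C ?V') = Id C ?V'"
    unfolding 1 2 by (simp add: comp_assoc 3) (simp add: interchange interchange_tail V'.zigzag_X')
  \<comment> \<open>The identity of \<open>V\<close> is split as \<open>a\<^sup>-\<^sup>1 a\<close>, so that \<open>a\<close> acts on both copies of \<open>V\<close>.\<close>
  have 4: "(twisted_ev C a \<star> Id C V) = (Id C (Unit C) \<star> ?i) \<cdot> ((Ev C ?V' \<star> Id C (Dual C ?V')) \<cdot> ((a \<star> Id C ?V') \<star> a))"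
    by (simp add: twisted_ev_def interchange del: unit_simps(4))
  have 5: "Id C V \<star> twisted_db C a = (Id C V \<star> (Id C ?V' \<star> ?i)) \<cdot> (Id C V \<star> Db C ?V')"
    by (simp add: twisted_db_def interchange)
  have 6: "((a \<star> Id C ?V') \<star> a) \<cdot> (inv_arr C (\<Phi> V ?V' V) \<cdot> x) =
      inv_arr C (\<Phi> (Dual C ?V') ?V' (Dual C ?V')) \<cdot> ((a \<star> (Id C ?V' \<star> a)) \<cdot> x)"
    if "x \<in> Arr C" "Cod C x = V \<boxtimes> (?V' \<boxtimes> V)" for x
    using comp_tail[OF assoc_inv_nat[of a "Id C ?V'" a "Dual C ?V'" ?V' "Dual C ?V'"], of x] that
    by (simp add: comp_assoc)
  have 7: "(a \<star> (Id C ?V' \<star> a)) \<cdot> ((Id C V \<star> (Id C ?V' \<star> ?i)) \<cdot> (Id C V \<star> Db C ?V')) = (Id C (Dual C ?V') \<star> Db C ?V') \<cdot> a"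
    using ten_unit_slide'[of "Db C ?V'" a] by (simp add: interchange interchange_tail)
  have 8: "(Ev C ?V' \<star> Id C (Dual C ?V')) \<cdot> (inv_arr C (\<Phi> (Dual C ?V') ?V' (Dual C ?V')) \<cdot> ((Id C (Dual C ?V') \<star> Db C ?V') \<cdot> a)) = a"
    using comp_tail[of "Ev C ?V' \<star> Id C (Dual C ?V')"
      "inv_arr C (\<Phi> (Dual C ?V') ?V' (Dual C ?V')) \<cdot> (Id C (Dual C ?V') \<star> Db C ?V')" "Id C (Dual C ?V')" a]
    by (simp add: V'.zigzag_Y' comp_assoc)
  have zY: "(twisted_ev C a \<star> Id C V) \<cdot> inv_arr C (\<Phi> V ?V' V) \<cdot> (Id C V \<star> twisted_db C a) = Id C V"
    unfolding 4 5 by (simp add: comp_assoc 6 7 8)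
  show ?thesis by unfold_locales (use zX zY in \<open>auto simp: Hom_arr\<close>)
qed

text \<open>The rotation composes the bijection \<open>A\<close> with \<open>g \<mapsto> (W \<otimes> a\<^sup>-\<^sup>1 g\<^sup>\<or>) db\<^sub>W\<close>. Dinaturality moves \<open>g\<^sup>\<or>\<close> to the
  other side as \<open>g\<close> and replaces the coevaluation of \<open>W\<close> by that of \<open>V\<^sup>\<or>\<close>.\<close>

lemma E_map_eq:
  assumes "j V = a" "f \<in> Arr C" "Dom C f = Unit C" "Cod C f = V \<boxtimes> W" "W \<in> Obj C"
  shows "E_map C j V W f = (A_map C V W f \<star> Id C V) \<cdot> twisted_db C a"
proof -
  let ?g = "A_map C V W f"
  note [simp] = assms A_map_eq(2-4) twist_arr twisted_arr
  have "E_map C j V W f = (Id C W \<star> inv_arr C a) \<cdot> ((Id C W \<star> dual_arr C ?g) \<cdot> Db C W)"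
    by (simp add: E_map_def A_inv_def T_map_def interchange_tail)
  also have "(Id C W \<star> dual_arr C ?g) \<cdot> Db C W = (?g \<star> Id C (Dual C (Dual C V))) \<cdot> Db C (Dual C V)"
    by (rule db_dinatural) simp_all
  finally show ?thesis by (simp add: twisted_db_def interchange_tail)
qed

lemma E_map_arr:
  assumes "j V = a" "f \<in> Arr C" "Dom C f = Unit C" "Cod C f = V \<boxtimes> W" "W \<in> Obj C"
  shows "E_map C j V W f \<in> Hom C (Unit C) (W \<boxtimes> V)"
  using assms E_map_eq[where j = j, OF assms] twisted_arr twist_arr by (simp add: Hom_arr A_map_eq(2-4))

lemma E_map_natural:
  assumes "j V = a" "f \<in> Arr C" "Dom C f = Unit C" "Cod C f = V \<boxtimes> W"
    "h \<in> Arr C" "Dom C h = W" "Cod C h = W'"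
  shows "E_map C j V W' ((Id C V \<star> h) \<cdot> f) = (h \<star> Id C V) \<cdot> E_map C j V W f"
proof -
  have [simp]: "W \<in> Obj C" "W' \<in> Obj C" using assms arr_Obj by blast+
  show ?thesis
    using assms A_map_natural[of f V W h W'] twisted_arr twist_arr
    by (simp add: E_map_eq A_map_eq(2-4) interchange_tail)
qed

end

end

section \<open>Transport along a monoidal functor\<close>

context cat_functor
begin

lemma F_Obj' [simp]: "X \<in> Obj C \<Longrightarrow> Fo X \<in> Obj D" by (rule F_Obj)

lemma F_arr [simp]:
  assumes "f \<in> Arr C"
  shows "Fa f \<in> Arr D" "Dom D (Fa f) = Fo (Dom C f)" "Cod D (Fa f) = Fo (Cod C f)"
  using F_hom[of f "Dom C f" "Cod C f"] assms by (auto simp: C.Hom_arr D.Hom_arr)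

lemma F_Id' [simp]: "X \<in> Obj C \<Longrightarrow> Fa (Id C X) = Id D (Fo X)" by (rule F_Id)

lemma F_comp [simp]:
  assumes "f \<in> Arr C" "g \<in> Arr C" "Dom C g = Cod C f"
  shows "Fa (g \<cdot>\<^bsub>C\<^esub> f) = Fa g \<cdot>\<^bsub>D\<^esub> Fa f"
  using F_Comp[of f "Dom C f" "Cod C f" g "Cod C g"] assms by (auto simp: C.Hom_arr)

lemma F_inverse:
  assumes "iso_arr C f"
  shows "is_inverse D (Fa f) (Fa (inv_arr C f))"
proof -
  note [simp] = assms C.iso_Arr[OF assms]
  have "Fa (inv_arr C f) \<cdot>\<^bsub>D\<^esub> Fa f = Fa (inv_arr C f \<cdot>\<^bsub>C\<^esub> f)" "Fa f \<cdot>\<^bsub>D\<^esub> Fa (inv_arr C f) = Fa (f \<cdot>\<^bsub>C\<^esub> inv_arr C f)"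
    by (simp_all del: C.iso_inv(4,5))
  thus ?thesis by (simp add: is_inverse_def D.Hom_arr)
qed

lemma F_iso: "iso_arr C f \<Longrightarrow> iso_arr D (Fa f)"
  using F_inverse by (auto simp: iso_arr_def)

end

context monoidal_functor
begin

abbreviation "FO \<equiv> Fobj F"
abbreviation "FA \<equiv> Farr F"
abbreviation "t \<equiv> Ften F"
abbreviation "u \<equiv> Funit F"

lemma structure_arr [simp]:
  "V \<in> Obj C \<Longrightarrow> W \<in> Obj C \<Longrightarrow> t V W \<in> Arr D"
  "V \<in> Obj C \<Longrightarrow> W \<in> Obj C \<Longrightarrow> Dom D (t V W) = FO V \<boxtimes>\<^bsub>D\<^esub> FO W"
  "V \<in> Obj C \<Longrightarrow> W \<in> Obj C \<Longrightarrow> Cod D (t V W) = FO (V \<boxtimes>\<^bsub>C\<^esub> W)"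
  "V \<in> Obj C \<Longrightarrow> W \<in> Obj C \<Longrightarrow> iso_arr D (t V W)"
  "u \<in> Arr D" "Dom D u = Unit D" "Cod D u = FO (Unit C)" "iso_arr D u"
  using Ften_hom Ften_iso Funit_hom Funit_iso by (auto simp: D.Hom_arr)

lemma ten_nat:
  assumes "f \<in> Arr C" "g \<in> Arr C" "Cod C f = V" "Cod C g = W"
  shows "t V W \<cdot>\<^bsub>D\<^esub> (FA f \<star>\<^bsub>D\<^esub> FA g) = FA (f \<star>\<^bsub>C\<^esub> g) \<cdot>\<^bsub>D\<^esub> t (Dom C f) (Dom C g)"
  using Ften_natural[of f "Dom C f" V g "Dom C g" W] assms by (auto simp: C.Hom_arr)

lemma ten_inv_nat:
  assumes "f \<in> Arr C" "g \<in> Arr C" "Cod C f = V" "Cod C g = W"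
  shows "inv_arr D (t V W) \<cdot>\<^bsub>D\<^esub> FA (f \<star>\<^bsub>C\<^esub> g) = (FA f \<star>\<^bsub>D\<^esub> FA g) \<cdot>\<^bsub>D\<^esub> inv_arr D (t (Dom C f) (Dom C g))"
proof -
  let ?t = "t V W" and ?s = "t (Dom C f) (Dom C g)"
  have VW[simp]: "V \<in> Obj C" "W \<in> Obj C" using assms C.arr_Obj by blast+
  have "inv_arr D ?t \<cdot>\<^bsub>D\<^esub> FA (f \<star>\<^bsub>C\<^esub> g) = inv_arr D ?t \<cdot>\<^bsub>D\<^esub> ((FA (f \<star>\<^bsub>C\<^esub> g) \<cdot>\<^bsub>D\<^esub> ?s) \<cdot>\<^bsub>D\<^esub> inv_arr D ?s)"
    using assms by (simp add: D.comp_assoc)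
  also have "\<dots> = inv_arr D ?t \<cdot>\<^bsub>D\<^esub> ((?t \<cdot>\<^bsub>D\<^esub> (FA f \<star>\<^bsub>D\<^esub> FA g)) \<cdot>\<^bsub>D\<^esub> inv_arr D ?s)"
    using ten_nat[OF assms] by simp
  also have "\<dots> = (FA f \<star>\<^bsub>D\<^esub> FA g) \<cdot>\<^bsub>D\<^esub> inv_arr D ?s"
    using assms by (simp add: D.comp_assoc)
  finally show ?thesis .
qed

lemma unit_right: "V \<in> Obj C \<Longrightarrow> (Id D (FO V) \<star>\<^bsub>D\<^esub> inv_arr D u) \<cdot>\<^bsub>D\<^esub> inv_arr D (t V (Unit C)) = Id D (FO V)"
  using arg_cong[OF Ften_Unit[of V], of "inv_arr D"] by simp

lemma unit_left: "V \<in> Obj C \<Longrightarrow> (inv_arr D u \<star>\<^bsub>D\<^esub> Id D (FO V)) \<cdot>\<^bsub>D\<^esub> inv_arr D (t (Unit C) V) = Id D (FO V)"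
  using arg_cong[OF Unit_Ften[of V], of "inv_arr D"] by simp

text \<open>The coherence axiom of a monoidal functor, solved for the inverse structure isomorphisms, which
  are the ones occurring in \<open>push\<close>.\<close>

lemma ten_inv_assoc:
  assumes [simp]: "U \<in> Obj C" "V \<in> Obj C" "W \<in> Obj C"
  shows "\<Phi>\<^bsub>D\<^esub> (FO U) (FO V) (FO W) \<cdot>\<^bsub>D\<^esub> ((inv_arr D (t U V) \<star>\<^bsub>D\<^esub> Id D (FO W)) \<cdot>\<^bsub>D\<^esub> inv_arr D (t (U \<boxtimes>\<^bsub>C\<^esub> V) W))
    = (Id D (FO U) \<star>\<^bsub>D\<^esub> inv_arr D (t V W)) \<cdot>\<^bsub>D\<^esub> (inv_arr D (t U (V \<boxtimes>\<^bsub>C\<^esub> W)) \<cdot>\<^bsub>D\<^esub> FA (\<Phi>\<^bsub>C\<^esub> U V W))"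
    (is "?p \<cdot>\<^bsub>D\<^esub> ?r = ?l \<cdot>\<^bsub>D\<^esub> (?m \<cdot>\<^bsub>D\<^esub> ?q)")
proof -
  let ?r' = "t (U \<boxtimes>\<^bsub>C\<^esub> V) W \<cdot>\<^bsub>D\<^esub> (t U V \<star>\<^bsub>D\<^esub> Id D (FO W))"
  have e: "?q \<cdot>\<^bsub>D\<^esub> ?r' = t U (V \<boxtimes>\<^bsub>C\<^esub> W) \<cdot>\<^bsub>D\<^esub> ((Id D (FO U) \<star>\<^bsub>D\<^esub> t V W) \<cdot>\<^bsub>D\<^esub> ?p)"
    using Ften_assoc[OF assms] by (simp add: D.comp_assoc)
  have "?l \<cdot>\<^bsub>D\<^esub> (?m \<cdot>\<^bsub>D\<^esub> ?q) = ?l \<cdot>\<^bsub>D\<^esub> (?m \<cdot>\<^bsub>D\<^esub> ((?q \<cdot>\<^bsub>D\<^esub> ?r') \<cdot>\<^bsub>D\<^esub> ?r))"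
    by (simp add: D.comp_assoc D.interchange_tail)
  also have "\<dots> = ?p \<cdot>\<^bsub>D\<^esub> ?r"
    unfolding e by (simp add: D.comp_assoc D.interchange_tail)
  finally show ?thesis by simp
qed

text \<open>Morphisms out of, and into, the unit object are carried along \<open>F\<close> by conjugating with the structure
  isomorphisms.\<close>

definition push :: "'o \<Rightarrow> 'o \<Rightarrow> 'm \<Rightarrow> 'n" where
  "push X Y f = inv_arr D (t X Y) \<cdot>\<^bsub>D\<^esub> (FA f \<cdot>\<^bsub>D\<^esub> u)"

definition copush :: "'o \<Rightarrow> 'o \<Rightarrow> 'm \<Rightarrow> 'n" where
  "copush X Y e = inv_arr D u \<cdot>\<^bsub>D\<^esub> (FA e \<cdot>\<^bsub>D\<^esub> t X Y)"

lemma push_arr [simp]: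
  assumes "f \<in> Arr C" "Dom C f = Unit C" "Cod C f = X \<boxtimes>\<^bsub>C\<^esub> Y" "X \<in> Obj C" "Y \<in> Obj C"
  shows "push X Y f \<in> Arr D" "Dom D (push X Y f) = Unit D" "Cod D (push X Y f) = FO X \<boxtimes>\<^bsub>D\<^esub> FO Y"
  using assms by (simp_all add: push_def)

lemma copush_arr [simp]:
  assumes "e \<in> Arr C" "Cod C e = Unit C" "Dom C e = X \<boxtimes>\<^bsub>C\<^esub> Y" "X \<in> Obj C" "Y \<in> Obj C"
  shows "copush X Y e \<in> Arr D" "Cod D (copush X Y e) = Unit D" "Dom D (copush X Y e) = FO X \<boxtimes>\<^bsub>D\<^esub> FO Y"
  using assms by (simp_all add: copush_def)

lemma push_natural:
  assumes "a \<in> Arr C" "b \<in> Arr C" "Dom C a = X" "Cod C a = X'" "Dom C b = Y" "Cod C b = Y'"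
    "f \<in> Arr C" "Dom C f = Unit C" "Cod C f = X \<boxtimes>\<^bsub>C\<^esub> Y"
  shows "push X' Y' ((a \<star>\<^bsub>C\<^esub> b) \<cdot>\<^bsub>C\<^esub> f) = (FA a \<star>\<^bsub>D\<^esub> FA b) \<cdot>\<^bsub>D\<^esub> push X Y f"
proof -
  have [simp]: "X \<in> Obj C" "Y \<in> Obj C" "X' \<in> Obj C" "Y' \<in> Obj C" using assms C.arr_Obj by blast+
  show ?thesis
    using D.comp_tail[OF ten_inv_nat[of a b X' Y'], of "FA f \<cdot>\<^bsub>D\<^esub> u"] assms
    by (simp add: push_def D.comp_assoc)
qed

lemma copush_push:
  assumes "f \<in> Arr C" "Dom C f = Unit C" "Cod C f = X \<boxtimes>\<^bsub>C\<^esub> Y" "X \<in> Obj C" "Y \<in> Obj C"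
    "e \<in> Arr C" "Cod C e = Unit C" "Dom C e = X \<boxtimes>\<^bsub>C\<^esub> Y"
  shows "copush X Y e \<cdot>\<^bsub>D\<^esub> push X Y f = inv_arr D u \<cdot>\<^bsub>D\<^esub> (FA (e \<cdot>\<^bsub>C\<^esub> f) \<cdot>\<^bsub>D\<^esub> u)"
  using assms by (simp add: copush_def push_def D.comp_assoc)

text \<open>Coherence and naturality push all structure isomorphisms
  to the outside, where the unit axioms cancel them, and what remains is the image of \<open>zigzag_X\<close>.\<close>

lemma push_zigzag:
  assumes "dual_pair C X Y d e"
  shows "(Id D (FO X) \<star>\<^bsub>D\<^esub> copush Y X e) \<cdot>\<^bsub>D\<^esub>
    (\<Phi>\<^bsub>D\<^esub> (FO X) (FO Y) (FO X) \<cdot>\<^bsub>D\<^esub> (push X Y d \<star>\<^bsub>D\<^esub> Id D (FO X))) = Id D (FO X)"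
proof -
  interpret P: dual_pair C X Y d e by fact
  let ?I = "Id D (FO X)" and ?i = "inv_arr D"
  have 1: "?I \<star>\<^bsub>D\<^esub> copush Y X e = (?I \<star>\<^bsub>D\<^esub> ?i u) \<cdot>\<^bsub>D\<^esub> ((?I \<star>\<^bsub>D\<^esub> FA e) \<cdot>\<^bsub>D\<^esub> (?I \<star>\<^bsub>D\<^esub> t Y X))"
    by (simp add: copush_def D.interchange)
  have b: "FA d \<star>\<^bsub>D\<^esub> ?I = ?i (t (X \<boxtimes>\<^bsub>C\<^esub> Y) X) \<cdot>\<^bsub>D\<^esub> (FA (d \<star>\<^bsub>C\<^esub> Id C X) \<cdot>\<^bsub>D\<^esub> t (Unit C) X)"
    using D.comp_tail[OF ten_inv_nat[of d "Id C X" "X \<boxtimes>\<^bsub>C\<^esub> Y" X], of "t (Unit C) X"] by (simp add: D.comp_assoc)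
  have "push X Y d \<star>\<^bsub>D\<^esub> ?I = (?i (t X Y) \<star>\<^bsub>D\<^esub> ?I) \<cdot>\<^bsub>D\<^esub> ((FA d \<star>\<^bsub>D\<^esub> ?I) \<cdot>\<^bsub>D\<^esub> (u \<star>\<^bsub>D\<^esub> ?I))"
    by (simp add: push_def D.interchange)
  also have "(FA d \<star>\<^bsub>D\<^esub> ?I) \<cdot>\<^bsub>D\<^esub> (u \<star>\<^bsub>D\<^esub> ?I) = ?i (t (X \<boxtimes>\<^bsub>C\<^esub> Y) X) \<cdot>\<^bsub>D\<^esub> FA (d \<star>\<^bsub>C\<^esub> Id C X)"
    unfolding b using Unit_Ften[of X] by (simp add: D.comp_assoc)
  finally have 2: "push X Y d \<star>\<^bsub>D\<^esub> ?I
      = (?i (t X Y) \<star>\<^bsub>D\<^esub> ?I) \<cdot>\<^bsub>D\<^esub> (?i (t (X \<boxtimes>\<^bsub>C\<^esub> Y) X) \<cdot>\<^bsub>D\<^esub> FA (d \<star>\<^bsub>C\<^esub> Id C X))" .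
  have 3: "\<Phi>\<^bsub>D\<^esub> (FO X) (FO Y) (FO X) \<cdot>\<^bsub>D\<^esub> (push X Y d \<star>\<^bsub>D\<^esub> ?I)
     = (?I \<star>\<^bsub>D\<^esub> ?i (t Y X)) \<cdot>\<^bsub>D\<^esub> (?i (t X (Y \<boxtimes>\<^bsub>C\<^esub> X)) \<cdot>\<^bsub>D\<^esub> (FA (\<Phi>\<^bsub>C\<^esub> X Y X) \<cdot>\<^bsub>D\<^esub> FA (d \<star>\<^bsub>C\<^esub> Id C X)))"
    unfolding 2 using D.comp_tail[OF ten_inv_assoc[of X Y X], of "FA (d \<star>\<^bsub>C\<^esub> Id C X)"] by (simp add: D.comp_assoc)
  have 4: "(?I \<star>\<^bsub>D\<^esub> FA e) \<cdot>\<^bsub>D\<^esub> (?i (t X (Y \<boxtimes>\<^bsub>C\<^esub> X)) \<cdot>\<^bsub>D\<^esub> x) = ?i (t X (Unit C)) \<cdot>\<^bsub>D\<^esub> (FA (Id C X \<star>\<^bsub>C\<^esub> e) \<cdot>\<^bsub>D\<^esub> x)"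
    if "x \<in> Arr D" "Cod D x = FO (X \<boxtimes>\<^bsub>C\<^esub> (Y \<boxtimes>\<^bsub>C\<^esub> X))" for x
    using D.comp_tail[OF ten_inv_nat[of "Id C X" e X "Unit C"], of x] that by (simp add: D.comp_assoc)
  have 5: "(?I \<star>\<^bsub>D\<^esub> ?i u) \<cdot>\<^bsub>D\<^esub> (?i (t X (Unit C)) \<cdot>\<^bsub>D\<^esub> x) = x"
    if "x \<in> Arr D" "Cod D x = FO X" for x
    using D.comp_tail[OF unit_right[of X], of x] that by simp
  have 6: "(?I \<star>\<^bsub>D\<^esub> t Y X) \<cdot>\<^bsub>D\<^esub> ((?I \<star>\<^bsub>D\<^esub> ?i (t Y X)) \<cdot>\<^bsub>D\<^esub> x) = x"
    if "x \<in> Arr D" "Cod D x = FO X \<boxtimes>\<^bsub>D\<^esub> FO (Y \<boxtimes>\<^bsub>C\<^esub> X)" for x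
    using that by (simp add: D.interchange_tail)
  have "(?I \<star>\<^bsub>D\<^esub> copush Y X e) \<cdot>\<^bsub>D\<^esub> (\<Phi>\<^bsub>D\<^esub> (FO X) (FO Y) (FO X) \<cdot>\<^bsub>D\<^esub> (push X Y d \<star>\<^bsub>D\<^esub> ?I))
     = FA (Id C X \<star>\<^bsub>C\<^esub> e) \<cdot>\<^bsub>D\<^esub> (FA (\<Phi>\<^bsub>C\<^esub> X Y X) \<cdot>\<^bsub>D\<^esub> FA (d \<star>\<^bsub>C\<^esub> Id C X))"
    unfolding 1 3 by (simp add: D.comp_assoc 4 5 6)
  also have "\<dots> = FA ((Id C X \<star>\<^bsub>C\<^esub> e) \<cdot>\<^bsub>C\<^esub> (\<Phi>\<^bsub>C\<^esub> X Y X \<cdot>\<^bsub>C\<^esub> (d \<star>\<^bsub>C\<^esub> Id C X)))" by simp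
  also have "\<dots> = ?I" unfolding P.zigzag_X' by simp
  finally show ?thesis .
qed

end

section \<open>The rotation is transported\<close>

context monoidal_category
begin

lemma ten_pow_Obj [simp]: "V \<in> Obj C \<Longrightarrow> ten_pow C V n \<in> Obj C"
  by (induction n) simp_all

lemma assoc_pow_arr [simp]:
  assumes "V \<in> Obj C"
  shows "assoc_pow C V n \<in> Arr C" "Dom C (assoc_pow C V n) = ten_pow C V n \<boxtimes> V"
    "Cod C (assoc_pow C V n) = V \<boxtimes> ten_pow C V n"
  using assms by (induction n) simp_all

end

lemma (in rigid_category) E_pow_arr:
  assumes V: "V \<in> Obj C" and j: "j V \<in> Hom C V (Dual C (Dual C V))" "iso_arr C (j V)"
    and f: "f \<in> Hom C (Unit C) (ten_pow C V n)" and n: "n \<ge> 1"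
  shows "E_pow C j n V f \<in> Hom C (Unit C) (ten_pow C V n)"
proof -
  obtain m where m: "n = Suc m" using n by (cases n) auto
  show ?thesis
    using V f E_map_arr[where j = j, OF V j refl, of f "ten_pow C V m"]
    unfolding m E_pow_def by (simp add: Hom_arr)
qed

locale rigid_functor = C: rigid_category C + D: rigid_category D + monoidal_functor C D F
  for C :: "('o, 'm, 'x) rigcat_scheme" and D :: "('p, 'n, 'y) rigcat_scheme"
    and F :: "('o, 'm, 'p, 'n) mfun"
begin

text \<open>The canonical morphism \<open>(F V)\<^sup>\<or> \<rightarrow> F (V\<^sup>\<or>)\<close>, obtained by bending the image of the coevaluation of \<open>V\<close>
  with the evaluation of \<open>F V\<close>.\<close>

definition dual_comparison :: "'o \<Rightarrow> 'n" where
  "dual_comparison V = A_map D (FO V) (FO (Dual C V)) (push V (Dual C V) (Db C V))"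

lemma dual_comparison_arr [simp]:
  assumes "V \<in> Obj C"
  shows "dual_comparison V \<in> Arr D" "Dom D (dual_comparison V) = Dual D (FO V)"
    "Cod D (dual_comparison V) = FO (Dual C V)"
  using assms by (simp_all add: dual_comparison_def D.A_map_eq(2-4))

lemma dual_comparison_db:
  assumes "V \<in> Obj C"
  shows "(Id D (FO V) \<star>\<^bsub>D\<^esub> dual_comparison V) \<cdot>\<^bsub>D\<^esub> Db D (FO V) = push V (Dual C V) (Db C V)"
  unfolding dual_comparison_def using assms by (simp add: D.A_inv_A_map)

primrec pow_iso :: "'o \<Rightarrow> nat \<Rightarrow> 'n" where
  "pow_iso V 0 = inv_arr D u"
| "pow_iso V (Suc n) = (Id D (FO V) \<star>\<^bsub>D\<^esub> pow_iso V n) \<cdot>\<^bsub>D\<^esub> inv_arr D (t V (ten_pow C V n))"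

lemma pow_iso_arr [simp]:
  assumes "V \<in> Obj C"
  shows "pow_iso V n \<in> Arr D" "Dom D (pow_iso V n) = FO (ten_pow C V n)"
    "Cod D (pow_iso V n) = ten_pow D (FO V) n" "iso_arr D (pow_iso V n)"
proof -
  have "pow_iso V n \<in> Arr D \<and> Dom D (pow_iso V n) = FO (ten_pow C V n) \<and>
    Cod D (pow_iso V n) = ten_pow D (FO V) n \<and> iso_arr D (pow_iso V n)"
    using assms by (induction n) simp_all
  thus "pow_iso V n \<in> Arr D" "Dom D (pow_iso V n) = FO (ten_pow C V n)"
    "Cod D (pow_iso V n) = ten_pow D (FO V) n" "iso_arr D (pow_iso V n)" by blast+
qed

text \<open>The power isomorphisms are compatible with the reassociation of \<open>V\<^sup>n \<otimes> V\<close> into the next power.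
  In the induction step the first factor \<open>F V\<close> is split off by coherence of \<open>F\<close>, and the induction
  hypothesis acts on the remaining tensor factor.\<close>

lemma pow_iso_assoc:
  assumes V [simp]: "V \<in> Obj C"
  shows "assoc_pow D (FO V) n \<cdot>\<^bsub>D\<^esub> ((pow_iso V n \<star>\<^bsub>D\<^esub> Id D (FO V)) \<cdot>\<^bsub>D\<^esub> inv_arr D (t (ten_pow C V n) V))
    = pow_iso V (Suc n) \<cdot>\<^bsub>D\<^esub> FA (assoc_pow C V n)"
proof (induction n)
  case 0
  show ?case using unit_left[OF V] unit_right[OF V] by simp
next
  case (Suc n)
  let ?W = "ten_pow C V n" and ?I = "Id D (FO V)" and ?i = "inv_arr D"
  have 1: "pow_iso V (Suc n) \<star>\<^bsub>D\<^esub> ?I = ((?I \<star>\<^bsub>D\<^esub> pow_iso V n) \<star>\<^bsub>D\<^esub> ?I) \<cdot>\<^bsub>D\<^esub> (?i (t V ?W) \<star>\<^bsub>D\<^esub> ?I)"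
    by (simp add: D.interchange)
  have 2: "\<Phi>\<^bsub>D\<^esub> (FO V) (ten_pow D (FO V) n) (FO V) \<cdot>\<^bsub>D\<^esub> (((?I \<star>\<^bsub>D\<^esub> pow_iso V n) \<star>\<^bsub>D\<^esub> ?I) \<cdot>\<^bsub>D\<^esub> x)
      = (?I \<star>\<^bsub>D\<^esub> (pow_iso V n \<star>\<^bsub>D\<^esub> ?I)) \<cdot>\<^bsub>D\<^esub> (\<Phi>\<^bsub>D\<^esub> (FO V) (FO ?W) (FO V) \<cdot>\<^bsub>D\<^esub> x)"
    if "x \<in> Arr D" "Cod D x = (FO V \<boxtimes>\<^bsub>D\<^esub> FO ?W) \<boxtimes>\<^bsub>D\<^esub> FO V" for x
    using D.comp_tail[OF D.assoc_nat[of ?I "pow_iso V n" ?I "FO V" "ten_pow D (FO V) n" "FO V"], of x] that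
    by (simp add: D.comp_assoc)
  have 3: "(?I \<star>\<^bsub>D\<^esub> FA (assoc_pow C V n)) \<cdot>\<^bsub>D\<^esub> (?i (t V (?W \<boxtimes>\<^bsub>C\<^esub> V)) \<cdot>\<^bsub>D\<^esub> x) =
      ?i (t V (V \<boxtimes>\<^bsub>C\<^esub> ?W)) \<cdot>\<^bsub>D\<^esub> (FA (Id C V \<star>\<^bsub>C\<^esub> assoc_pow C V n) \<cdot>\<^bsub>D\<^esub> x)"
    if "x \<in> Arr D" "Cod D x = FO (V \<boxtimes>\<^bsub>C\<^esub> (?W \<boxtimes>\<^bsub>C\<^esub> V))" for x
    using D.comp_tail[OF ten_inv_nat[of "Id C V" "assoc_pow C V n" V "V \<boxtimes>\<^bsub>C\<^esub> ?W"], of x] that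
    by (simp add: D.comp_assoc)
  let ?a = "FA (\<Phi>\<^bsub>C\<^esub> V ?W V)"
  have "assoc_pow D (FO V) (Suc n) \<cdot>\<^bsub>D\<^esub> ((pow_iso V (Suc n) \<star>\<^bsub>D\<^esub> ?I) \<cdot>\<^bsub>D\<^esub> ?i (t (ten_pow C V (Suc n)) V))
    = (?I \<star>\<^bsub>D\<^esub> assoc_pow D (FO V) n) \<cdot>\<^bsub>D\<^esub> ((?I \<star>\<^bsub>D\<^esub> (pow_iso V n \<star>\<^bsub>D\<^esub> ?I)) \<cdot>\<^bsub>D\<^esub>
       (\<Phi>\<^bsub>D\<^esub> (FO V) (FO ?W) (FO V) \<cdot>\<^bsub>D\<^esub> ((?i (t V ?W) \<star>\<^bsub>D\<^esub> ?I) \<cdot>\<^bsub>D\<^esub> ?i (t (V \<boxtimes>\<^bsub>C\<^esub> ?W) V))))"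
    unfolding 1 by (simp add: D.comp_assoc 2 del: pow_iso.simps)
  also have "\<dots> = (?I \<star>\<^bsub>D\<^esub> (assoc_pow D (FO V) n \<cdot>\<^bsub>D\<^esub> ((pow_iso V n \<star>\<^bsub>D\<^esub> ?I) \<cdot>\<^bsub>D\<^esub> ?i (t ?W V)))) \<cdot>\<^bsub>D\<^esub>
       (?i (t V (?W \<boxtimes>\<^bsub>C\<^esub> V)) \<cdot>\<^bsub>D\<^esub> ?a)"
    by (simp add: ten_inv_assoc D.interchange D.interchange_tail)
  also have "\<dots> = (?I \<star>\<^bsub>D\<^esub> pow_iso V (Suc n)) \<cdot>\<^bsub>D\<^esub> ((?I \<star>\<^bsub>D\<^esub> FA (assoc_pow C V n)) \<cdot>\<^bsub>D\<^esub>
       (?i (t V (?W \<boxtimes>\<^bsub>C\<^esub> V)) \<cdot>\<^bsub>D\<^esub> ?a))"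
    unfolding Suc.IH by (simp add: D.interchange_tail del: pow_iso.simps)
  also have "\<dots> = pow_iso V (Suc (Suc n)) \<cdot>\<^bsub>D\<^esub> FA (assoc_pow C V (Suc n))"
    unfolding pow_iso.simps(2)[of V "Suc n"] by (simp add: 3 D.comp_assoc del: pow_iso.simps)
  finally show ?case .
qed

definition pow_push :: "'o \<Rightarrow> nat \<Rightarrow> 'm \<Rightarrow> 'n" where
  "pow_push V n f = pow_iso V n \<cdot>\<^bsub>D\<^esub> (FA f \<cdot>\<^bsub>D\<^esub> u)"

text \<open>The two pivotal isomorphisms are linked through their twisted evaluations: that of \<open>F V\<close> is the
  image of that of \<open>V\<close>, composed with \<open>dual_comparison\<close>. For simple objects this link is deduced below from equality of the traces.\<close>

context
  fixes V and jC and jD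
  assumes V [simp]: "V \<in> Obj C"
    and jC: "jC V \<in> Hom C V (Dual C (Dual C V))" "iso_arr C (jC V)"
    and jD: "jD (FO V) \<in> Hom D (FO V) (Dual D (Dual D (FO V)))" "iso_arr D (jD (FO V))"
    and twisted_ev_compatible:
      "twisted_ev D (jD (FO V)) = copush V (Dual C V) (twisted_ev C (jC V)) \<cdot>\<^bsub>D\<^esub> (Id D (FO V) \<star>\<^bsub>D\<^esub> dual_comparison V)"
begin

lemmas twisted = C.twisted_arr[OF V jC] D.twisted_arr[OF F.F_Obj'[OF V] jD]

text \<open>A coevaluation is determined by its evaluation. Bending the image of \<open>db'\<close> with the twisted
  evaluation of \<open>F V\<close> yields, after replacing that evaluation by the image of \<open>ev'\<close> composed with
  \<open>dual_comparison\<close>, the transported zigzag identity followed by \<open>dual_comparison\<close>;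
  \<open>mirror_bend\<close> bends back.\<close>

lemma twisted_db_compatible:
  "(dual_comparison V \<star>\<^bsub>D\<^esub> Id D (FO V)) \<cdot>\<^bsub>D\<^esub> twisted_db D (jD (FO V)) = push (Dual C V) V (twisted_db C (jC V))"
proof -
  let ?W = "FO (Dual C V)" and ?V = "FO V" and ?V' = "Dual D (FO V)" and ?h = "dual_comparison V"
  let ?f = "push (Dual C V) V (twisted_db C (jC V))" and ?e = "copush V (Dual C V) (twisted_ev C (jC V))"
  note [simp] = twisted
  interpret P: dual_pair D ?V' ?V "twisted_db D (jD ?V)" "twisted_ev D (jD ?V)"
    using jD by (intro D.twisted_dual_pair) simp_all
  interpret Q: dual_pair C "Dual C V" V "twisted_db C (jC V)" "twisted_ev C (jC V)"
    using jC by (intro C.twisted_dual_pair) simp_all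
  have 1: "Id D ?W \<star>\<^bsub>D\<^esub> twisted_ev D (jD ?V) = (Id D ?W \<star>\<^bsub>D\<^esub> ?e) \<cdot>\<^bsub>D\<^esub> (Id D ?W \<star>\<^bsub>D\<^esub> (Id D ?V \<star>\<^bsub>D\<^esub> ?h))"
    unfolding twisted_ev_compatible by (simp add: D.interchange)
  have 2: "(Id D ?W \<star>\<^bsub>D\<^esub> (Id D ?V \<star>\<^bsub>D\<^esub> ?h)) \<cdot>\<^bsub>D\<^esub> (\<Phi>\<^bsub>D\<^esub> ?W ?V ?V' \<cdot>\<^bsub>D\<^esub> (?f \<star>\<^bsub>D\<^esub> Id D ?V'))
      = \<Phi>\<^bsub>D\<^esub> ?W ?V ?W \<cdot>\<^bsub>D\<^esub> ((?f \<star>\<^bsub>D\<^esub> Id D ?W) \<cdot>\<^bsub>D\<^esub> ?h)"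
    using D.comp_tail[OF D.assoc_nat[of "Id D ?W" "Id D ?V" ?h ?W ?V ?W, symmetric], of "?f \<star>\<^bsub>D\<^esub> Id D ?V'"]
      D.ten_unit_slide[of ?f ?h]
    by (simp add: D.comp_assoc D.interchange)
  have "(Id D ?W \<star>\<^bsub>D\<^esub> twisted_ev D (jD ?V)) \<cdot>\<^bsub>D\<^esub> (\<Phi>\<^bsub>D\<^esub> ?W ?V ?V' \<cdot>\<^bsub>D\<^esub> (?f \<star>\<^bsub>D\<^esub> Id D ?V'))
      = ((Id D ?W \<star>\<^bsub>D\<^esub> ?e) \<cdot>\<^bsub>D\<^esub> (\<Phi>\<^bsub>D\<^esub> ?W ?V ?W \<cdot>\<^bsub>D\<^esub> (?f \<star>\<^bsub>D\<^esub> Id D ?W))) \<cdot>\<^bsub>D\<^esub> ?h"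
    unfolding 1 by (simp add: D.comp_assoc 2)
  also have "\<dots> = ?h"
    unfolding push_zigzag[OF Q.dual_pair_axioms] by simp
  finally show ?thesis using P.mirror_bend[of ?f ?W] by simp
qed

text \<open>Both sides are evaluated by \<open>E_map_eq\<close>. The bent form of \<open>push f\<close> is the image of the bent form of
  \<open>f\<close> composed with \<open>dual_comparison\<close>, and this extra factor is absorbed by
  \<open>twisted_db_compatible\<close>.\<close>

lemma E_map_push:
  assumes "f \<in> Arr C" "Dom C f = Unit C" "Cod C f = V \<boxtimes>\<^bsub>C\<^esub> W" "W \<in> Obj C"
  shows "E_map D jD (FO V) (FO W) (push V W f) = push W V (E_map C jC V W f)"
proof -
  note [simp] = assms twisted
  let ?g = "A_map C V W f" and ?h = "dual_comparison V"
  note [simp] = C.A_map_eq(2-4)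
  have f: "(Id C V \<star>\<^bsub>C\<^esub> ?g) \<cdot>\<^bsub>C\<^esub> Db C V = f" by (simp add: C.A_inv_A_map)
  have "push V W f = (Id D (FO V) \<star>\<^bsub>D\<^esub> FA ?g) \<cdot>\<^bsub>D\<^esub> push V (Dual C V) (Db C V)"
    by (subst f[symmetric], subst push_natural[where X = V and Y = "Dual C V"]) simp_all
  also have "\<dots> = (Id D (FO V) \<star>\<^bsub>D\<^esub> (FA ?g \<cdot>\<^bsub>D\<^esub> ?h)) \<cdot>\<^bsub>D\<^esub> Db D (FO V)"
    unfolding dual_comparison_db[OF V, symmetric] by (simp add: D.interchange_tail)
  finally have A: "A_map D (FO V) (FO W) (push V W f) = FA ?g \<cdot>\<^bsub>D\<^esub> ?h"
    by (simp add: D.A_map_A_inv)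
  have "E_map D jD (FO V) (FO W) (push V W f)
      = (A_map D (FO V) (FO W) (push V W f) \<star>\<^bsub>D\<^esub> Id D (FO V)) \<cdot>\<^bsub>D\<^esub> twisted_db D (jD (FO V))"
    using jD by (intro D.E_map_eq) simp_all
  also have "\<dots> = (FA ?g \<star>\<^bsub>D\<^esub> Id D (FO V)) \<cdot>\<^bsub>D\<^esub> ((?h \<star>\<^bsub>D\<^esub> Id D (FO V)) \<cdot>\<^bsub>D\<^esub> twisted_db D (jD (FO V)))"
    unfolding A by (simp add: D.interchange_tail)
  also have "\<dots> = push W V ((?g \<star>\<^bsub>C\<^esub> Id C V) \<cdot>\<^bsub>C\<^esub> twisted_db C (jC V))"
    unfolding twisted_db_compatible by (subst push_natural[where X = "Dual C V" and Y = V]) simp_all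
  also have "(?g \<star>\<^bsub>C\<^esub> Id C V) \<cdot>\<^bsub>C\<^esub> twisted_db C (jC V) = E_map C jC V W f"
    using jC by (intro C.E_map_eq[symmetric]) simp_all
  finally show ?thesis .
qed

text \<open>The structure isomorphism of \<open>V \<otimes> V\<^sup>m\<close> and the isomorphism on \<open>V\<^sup>m\<close> pass through the rotation by
  \<open>E_map_push\<close> and \<open>E_map_natural\<close>; \<open>pow_iso_assoc\<close> takes care of the final associator.\<close>

lemma E_pow_push:
  assumes "f \<in> Hom C (Unit C) (ten_pow C V n)" "n \<ge> 1"
  shows "E_pow D jD n (FO V) (pow_push V n f) = pow_push V n (E_pow C jC n V f)"
proof -
  obtain m where n: "n = Suc m" using assms by (cases n) auto
  let ?W = "ten_pow C V m" and ?z = "pow_iso V m" and ?I = "Id D (FO V)"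
  let ?E = "E_map C jC V ?W f"
  have f [simp]: "f \<in> Arr C" "Dom C f = Unit C" "Cod C f = V \<boxtimes>\<^bsub>C\<^esub> ?W"
    using assms by (auto simp: C.Hom_arr n)
  have E [simp]: "?E \<in> Arr C" "Dom C ?E = Unit C" "Cod C ?E = ?W \<boxtimes>\<^bsub>C\<^esub> V"
    using C.E_map_arr[where j = jC, OF V jC refl, of f ?W] by (auto simp: C.Hom_arr)
  have 1: "pow_push V (Suc m) f = (?I \<star>\<^bsub>D\<^esub> ?z) \<cdot>\<^bsub>D\<^esub> push V ?W f"
    by (simp add: pow_push_def push_def D.comp_assoc)
  have "E_pow D jD n (FO V) (pow_push V n f)
      = assoc_pow D (FO V) m \<cdot>\<^bsub>D\<^esub> E_map D jD (FO V) (ten_pow D (FO V) m) ((?I \<star>\<^bsub>D\<^esub> ?z) \<cdot>\<^bsub>D\<^esub> push V ?W f)"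
    unfolding n 1 E_pow_def by simp
  also have "\<dots> = assoc_pow D (FO V) m \<cdot>\<^bsub>D\<^esub> ((?z \<star>\<^bsub>D\<^esub> ?I) \<cdot>\<^bsub>D\<^esub> E_map D jD (FO V) (FO ?W) (push V ?W f))"
    by (subst D.E_map_natural[where j = jD and W = "FO ?W", OF F.F_Obj'[OF V] jD]) simp_all
  also have "\<dots> = assoc_pow D (FO V) m \<cdot>\<^bsub>D\<^esub> ((?z \<star>\<^bsub>D\<^esub> ?I) \<cdot>\<^bsub>D\<^esub> push ?W V ?E)"
    by (simp add: E_map_push)
  also have "\<dots> = (assoc_pow D (FO V) m \<cdot>\<^bsub>D\<^esub> ((?z \<star>\<^bsub>D\<^esub> ?I) \<cdot>\<^bsub>D\<^esub> inv_arr D (t ?W V))) \<cdot>\<^bsub>D\<^esub> (FA ?E \<cdot>\<^bsub>D\<^esub> u)"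
    by (simp add: push_def D.comp_assoc)
  also have "\<dots> = pow_push V n (E_pow C jC n V f)"
    unfolding pow_iso_assoc[OF V] n by (simp add: pow_push_def E_pow_def D.comp_assoc del: pow_iso.simps)
  finally show ?thesis .
qed

end

end

section \<open>Linear isomorphisms, dimensions and traces\<close>

lemma linear_mapI:
  assumes "vectorspace K V" "vectorspace K W"
    and "\<And>v. v \<in> carrier V \<Longrightarrow> T v \<in> carrier W"
    and "\<And>v w. v \<in> carrier V \<Longrightarrow> w \<in> carrier V \<Longrightarrow> T (v \<oplus>\<^bsub>V\<^esub> w) = T v \<oplus>\<^bsub>W\<^esub> T w"
    and "\<And>c v. c \<in> carrier K \<Longrightarrow> v \<in> carrier V \<Longrightarrow> T (c \<odot>\<^bsub>V\<^esub> v) = c \<odot>\<^bsub>W\<^esub> T v"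
  shows "linear_map K V W T"
proof -
  interpret V: vectorspace K V by fact
  interpret W: vectorspace K W by fact
  show ?thesis by unfold_locales (use assms in \<open>auto simp: LinearCombinations.module_hom_def\<close>)
qed

locale linear_iso = linear_map K V W T for K V W T +
  assumes bij: "bij_betw T (carrier V) (carrier W)"
begin

definition "inverse_map = inv_into (carrier V) T"

lemma inverse_map_T: "v \<in> carrier V \<Longrightarrow> inverse_map (T v) = v"
  unfolding inverse_map_def using bij by (auto simp: bij_betw_def)

lemma T_inverse_map: "w \<in> carrier W \<Longrightarrow> T (inverse_map w) = w"
  unfolding inverse_map_def using bij by (auto simp: bij_betw_def f_inv_into_f)

lemma inverse_map_closed: "w \<in> carrier W \<Longrightarrow> inverse_map w \<in> carrier V"
  unfolding inverse_map_def using bij by (metis bij_betw_def inv_into_into)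

lemma inverse_iso: "linear_iso K W V inverse_map"
proof -
  have "linear_map K W V inverse_map"
  proof (rule linear_mapI)
    show "vectorspace K W" "vectorspace K V" by unfold_locales
    show "inverse_map w \<in> carrier V" if "w \<in> carrier W" for w using that by (rule inverse_map_closed)
    show "inverse_map (w \<oplus>\<^bsub>W\<^esub> w') = inverse_map w \<oplus>\<^bsub>V\<^esub> inverse_map w'" if "w \<in> carrier W" "w' \<in> carrier W" for w w'
    proof -
      have "T (inverse_map w \<oplus>\<^bsub>V\<^esub> inverse_map w') = w \<oplus>\<^bsub>W\<^esub> w'" using that by (simp add: inverse_map_closed T_inverse_map)
      moreover have "inverse_map w \<oplus>\<^bsub>V\<^esub> inverse_map w' \<in> carrier V" using that by (simp add: inverse_map_closed)
      ultimately show ?thesis using inverse_map_T by metis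
    qed
    show "inverse_map (c \<odot>\<^bsub>W\<^esub> w) = c \<odot>\<^bsub>V\<^esub> inverse_map w" if "c \<in> carrier K" "w \<in> carrier W" for c w
    proof -
      have "T (c \<odot>\<^bsub>V\<^esub> inverse_map w) = c \<odot>\<^bsub>W\<^esub> w" using that by (simp add: inverse_map_closed T_inverse_map)
      moreover have "c \<odot>\<^bsub>V\<^esub> inverse_map w \<in> carrier V" using that by (simp add: inverse_map_closed)
      ultimately show ?thesis using inverse_map_T by metis
    qed
  qed
  moreover have "bij_betw inverse_map (carrier W) (carrier V)"
    by (rule bij_betw_byWitness[where f' = T]) (auto simp: inverse_map_T T_inverse_map inverse_map_closed)
  ultimately show ?thesis by (simp add: linear_iso_def linear_iso_axioms_def)
qed

lemma lincomb_image:
  assumes "finite B" "B \<subseteq> carrier V" "a \<in> T ` B \<rightarrow> carrier K"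
  shows "T (V.module.lincomb (a \<circ> T) B) = W.module.lincomb a (T ` B)"
proof -
  have inj: "inj_on T B" using bij assms by (meson bij_betw_def inj_on_subset)
  have aT: "\<And>i. i \<in> B \<Longrightarrow> a (T i) \<in> carrier K" and BV: "\<And>i. i \<in> B \<Longrightarrow> i \<in> carrier V"
    using assms by blast+
  have "T (V.module.lincomb (a \<circ> T) B) = (\<Oplus>\<^bsub>W\<^esub>v\<in>B. T ((a \<circ> T) v \<odot>\<^bsub>V\<^esub> v))"
    unfolding V.module.lincomb_def using aT BV by (intro hom_sum) (auto simp: Pi_def)
  also have "\<dots> = (\<Oplus>\<^bsub>W\<^esub>v\<in>B. a (T v) \<odot>\<^bsub>W\<^esub> T v)"
    using aT BV by (intro W.module.M.finsum_cong') (simp_all add: Pi_def)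
  also have "\<dots> = W.module.lincomb a (T ` B)"
    unfolding W.module.lincomb_def using aT BV inj by (subst W.module.M.finsum_reindex) (auto simp: Pi_def)
  finally show ?thesis .
qed

lemma basis_image:
  assumes "finite B" "V.basis B"
  shows "W.basis (T ` B)"
proof -
  have B: "B \<subseteq> carrier V" "V.module.lin_indpt B" "V.module.gen_set B" using assms by (auto simp: V.basis_def)
  have TB: "T ` B \<subseteq> carrier W" using B by auto
  have "W.module.lin_indpt (T ` B)"
  proof (rule W.module.finite_lin_indpt2)
    fix a assume a: "a \<in> T ` B \<rightarrow> carrier K" and 0: "W.module.lincomb a (T ` B) = \<zero>\<^bsub>W\<^esub>"
    have aT: "a \<circ> T \<in> B \<rightarrow> carrier K" using a by auto
    have "T (V.module.lincomb (a \<circ> T) B) = T \<zero>\<^bsub>V\<^esub>" using lincomb_image[OF assms(1) B(1) a] 0 by simp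
    hence "V.module.lincomb (a \<circ> T) B = \<zero>\<^bsub>V\<^esub>"
      using inverse_map_T[of "V.module.lincomb (a \<circ> T) B"] inverse_map_T[of "\<zero>\<^bsub>V\<^esub>"] B aT assms(1) by simp
    hence "\<forall>v\<in>B. (a \<circ> T) v = \<zero>\<^bsub>K\<^esub>" using B(2) assms(1) aT unfolding V.module.lin_dep_def by blast
    thus "\<forall>v\<in>T ` B. a v = \<zero>\<^bsub>K\<^esub>" by auto
  qed (use assms TB in auto)
  moreover have "W.module.gen_set (T ` B)"
  proof
    show "W.module.span (T ` B) \<subseteq> carrier W" using TB by (rule W.module.span_is_subset2)
    show "carrier W \<subseteq> W.module.span (T ` B)"
    proof
      fix w assume w: "w \<in> carrier W"
      have "inverse_map w \<in> V.module.span B" using B(3) inverse_map_closed[OF w] by simp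
      then obtain a where a: "a \<in> B \<rightarrow> carrier K" "V.module.lincomb a B = inverse_map w"
        using V.module.finite_in_span[OF assms(1) B(1)] by blast
      have aK: "\<And>i. i \<in> B \<Longrightarrow> a i \<in> carrier K" and aST: "\<And>i. i \<in> B \<Longrightarrow> a (inverse_map (T i)) = a i"
        using a B inverse_map_T by (blast, metis subsetD)
      have aS: "a \<circ> inverse_map \<in> T ` B \<rightarrow> carrier K" using aK aST by auto
      have "V.module.lincomb ((a \<circ> inverse_map) \<circ> T) B = V.module.lincomb a B"
        using aK aST B by (intro V.module.lincomb_cong) (simp_all add: Pi_def)
      hence "W.module.lincomb (a \<circ> inverse_map) (T ` B) = w"
        using lincomb_image[OF assms(1) B(1) aS] a T_inverse_map[OF w] by simp
      thus "w \<in> W.module.span (T ` B)" using aS assms(1) unfolding W.module.span_def by blast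
    qed
  qed
  ultimately show ?thesis using TB by (simp add: W.basis_def)
qed

lemma dim_eq:
  assumes "V.fin_dim" shows "W.dim = V.dim"
proof -
  obtain B where B: "finite B" "V.basis B" using V.finite_basis_exists[OF assms] by blast
  have "inj_on T B" using bij B by (meson bij_betw_def inj_on_subset V.basis_def)
  thus ?thesis
    using V.dim_basis[OF B] W.dim_basis[OF finite_imageI[OF B(1)] basis_image[OF B]]
    by (simp add: card_image)
qed

end

lemma (in linear_iso) trace_datum_image:
  assumes K: "carrier K = UNIV"
    and B: "finite B" "V.basis B" and A: "\<forall>b\<in>B. E b = V.module.lincomb (A b) B"
    and int: "\<And>v. v \<in> carrier V \<Longrightarrow> E' (T v) = T (E v)"
  shows "W.basis (T ` B)" "\<forall>b\<in>T ` B. E' b = W.module.lincomb (A (inverse_map b) \<circ> inverse_map) (T ` B)"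
proof -
  show "W.basis (T ` B)" using B by (rule basis_image)
  have sub: "B \<subseteq> carrier V" using B by (simp add: V.basis_def)
  have inj: "inj_on T B" using bij sub by (meson bij_betw_def inj_on_subset)
  show "\<forall>b\<in>T ` B. E' b = W.module.lincomb (A (inverse_map b) \<circ> inverse_map) (T ` B)"
  proof
    fix b' assume "b' \<in> T ` B"
    then obtain b where b: "b \<in> B" "b' = T b" by blast
    have bV: "b \<in> carrier V" using b sub by blast
    have "V.module.lincomb ((A b \<circ> inverse_map) \<circ> T) B = V.module.lincomb (A b) B"
      using sub inverse_map_T K by (intro V.module.lincomb_cong) auto
    hence "E' b' = W.module.lincomb (A b \<circ> inverse_map) (T ` B)"
      using lincomb_image[OF B(1) sub, of "A b \<circ> inverse_map"] K A b int[OF bV] by simp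
    thus "E' b' = W.module.lincomb (A (inverse_map b') \<circ> inverse_map) (T ` B)" using b inverse_map_T[OF bV] by simp
  qed
qed

lemma (in linear_iso) sum_image:
  fixes G :: "_ \<Rightarrow> 'z :: comm_monoid_add"
  assumes "B \<subseteq> carrier V"
  shows "(\<Sum>b\<in>T ` B. G (inverse_map b)) = (\<Sum>b\<in>B. G b)"
proof -
  have "inj_on T B" using bij assms by (meson bij_betw_def inj_on_subset)
  thus ?thesis using assms by (subst sum.reindex) (auto simp: inverse_map_T subset_iff intro!: sum.cong)
qed

text \<open>The defining predicate of the trace only speaks of bases and matrix entries, and both are carried
  over by the isomorphism in either direction. So the two definite descriptions describe the same number.\<close>

lemma lin_trace_conjugate:
  fixes M :: "(complex, 'm) module" and N :: "(complex, 'n) module"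
  assumes iso: "linear_iso class_ring M N T"
    and closed: "\<And>v. v \<in> carrier M \<Longrightarrow> E v \<in> carrier M"
    and int: "\<And>v. v \<in> carrier M \<Longrightarrow> E' (T v) = T (E v)"
  shows "lin_trace M E = lin_trace N E'"
proof -
  interpret linear_iso class_ring M N T by fact
  interpret I: linear_iso class_ring N M inverse_map by (rule inverse_iso)
  have int': "E (inverse_map w) = inverse_map (E' w)" if "w \<in> carrier N" for w
    using int[OF inverse_map_closed[OF that]] inverse_map_T[OF closed[OF inverse_map_closed[OF that]]] T_inverse_map[OF that] by simp
  have "(\<exists>B A. finite B \<and> vectorspace.basis class_ring M B \<and>
       (\<forall>b\<in>B. E b = LinearCombinations.module.lincomb M (A b) B) \<and> t = (\<Sum>b\<in>B. A b b)) \<longleftrightarrow>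
     (\<exists>B A. finite B \<and> vectorspace.basis class_ring N B \<and>
       (\<forall>b\<in>B. E' b = LinearCombinations.module.lincomb N (A b) B) \<and> t = (\<Sum>b\<in>B. A b b))" (is "?l \<longleftrightarrow> ?r") for t
  proof
    assume ?l
    then obtain B A where *: "finite B" "V.basis B" "\<forall>b\<in>B. E b = V.module.lincomb (A b) B" "t = (\<Sum>b\<in>B. A b b)"
      by blast
    have K: "carrier (class_ring :: complex ring) = UNIV" by simp
    note r = trace_datum_image[OF K *(1-3), of E', OF int]
    show ?r
      by (rule exI[of _ "T ` B"], rule exI[of _ "\<lambda>b. A (inverse_map b) \<circ> inverse_map"]) (use r * sum_image[of B "\<lambda>b. A b b"] in \<open>auto simp: V.basis_def\<close>)
  next
    assume ?r
    then obtain B A where *: "finite B" "W.basis B" "\<forall>b\<in>B. E' b = W.module.lincomb (A b) B" "t = (\<Sum>b\<in>B. A b b)"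
      by blast
    have K: "carrier (class_ring :: complex ring) = UNIV" by simp
    note r = I.trace_datum_image[OF K *(1-3), of E, OF int']
    show ?l
      by (rule exI[of _ "inverse_map ` B"], rule exI[of _ "\<lambda>b. A (I.inverse_map b) \<circ> I.inverse_map"]) (use r * I.sum_image[of B "\<lambda>b. A b b"] in \<open>auto simp: W.basis_def\<close>)
  qed
  thus ?thesis unfolding lin_trace_def by simp
qed

lemma (in vectorspace) dim_trivial:
  assumes "carrier V = {\<zero>\<^bsub>V\<^esub>}" shows "dim = 0"
proof -
  have "span {} = carrier V"
    using assms by (auto simp: span_def lincomb_def)
  thus ?thesis using gen_ge_dim[of "{}"] by simp
qed

section \<open>Linear categories\<close>

context linear_category
begin

lemma Hom_Obj: "f \<in> Hom C X Y \<Longrightarrow> X \<in> Obj C \<and> Y \<in> Obj C"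
  by (auto simp: Hom_arr)

lemma hom_space_simps [simp]:
  "carrier (hom_space C X Y) = Hom C X Y" "ring.zero (hom_space C X Y) = Zero_arr C X Y"
  "add (hom_space C X Y) = Add_arr C" "module.smult (hom_space C X Y) = Scale_arr C"
  by (simp_all add: hom_space_def)

lemma hom_module:
  assumes "X \<in> Obj C" "Y \<in> Obj C"
  shows "Module.module class_ring (hom_space C X Y)" "abelian_group (hom_space C X Y)"
  using hom_vectorspace[OF assms] by (simp_all add: vectorspace_def Module.module_def)

lemma Zero_hom: "X \<in> Obj C \<Longrightarrow> Y \<in> Obj C \<Longrightarrow> Zero_arr C X Y \<in> Hom C X Y"
  using abelian_monoid.zero_closed[of "hom_space C X Y"] hom_module(2)[of X Y]
  by (simp add: abelian_group_def)

lemma Add_hom: "f \<in> Hom C X Y \<Longrightarrow> g \<in> Hom C X Y \<Longrightarrow> Add_arr C f g \<in> Hom C X Y"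
  using abelian_monoid.a_closed[of "hom_space C X Y" f g] hom_module(2)[of X Y] Hom_Obj[of f X Y]
  by (simp add: abelian_group_def)

lemma Scale_hom: "f \<in> Hom C X Y \<Longrightarrow> Scale_arr C c f \<in> Hom C X Y"
  using module.smult_closed[OF hom_module(1), of X Y c f] Hom_Obj[of f X Y] by simp

lemma Scale_0: "f \<in> Hom C X Y \<Longrightarrow> Scale_arr C 0 f = Zero_arr C X Y"
  using module.smult_l_null[OF hom_module(1), of X Y f] Hom_Obj[of f X Y] by simp

lemma Scale_1: "f \<in> Hom C X Y \<Longrightarrow> Scale_arr C 1 f = f"
  using module.smult_one[OF hom_module(1), of X Y f] Hom_Obj[of f X Y] by simp

lemma Scale_Scale: "f \<in> Hom C X Y \<Longrightarrow> Scale_arr C c (Scale_arr C d f) = Scale_arr C (c * d) f"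
  using module.smult_assoc1[OF hom_module(1), of X Y c d f] Hom_Obj[of f X Y] by simp

lemma Scale_distrib: "f \<in> Hom C X Y \<Longrightarrow> Add_arr C (Scale_arr C c f) (Scale_arr C d f) = Scale_arr C (c + d) f"
  using module.smult_l_distr[OF hom_module(1), of X Y c d f] Hom_Obj[of f X Y] by simp

lemma Add_Zero:
  assumes "f \<in> Hom C X Y"
  shows "Add_arr C f (Zero_arr C X Y) = f" "Add_arr C (Zero_arr C X Y) f = f"
  using abelian_monoid.r_zero[of "hom_space C X Y" f] abelian_monoid.l_zero[of "hom_space C X Y" f]
    hom_module(2)[of X Y] Hom_Obj[OF assms] assms
  by (simp_all add: abelian_group_def)

lemma Add_assoc:
  assumes "f \<in> Hom C X Y" "g \<in> Hom C X Y" "h \<in> Hom C X Y"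
  shows "Add_arr C (Add_arr C f g) h = Add_arr C f (Add_arr C g h)"
  using abelian_monoid.a_assoc[of "hom_space C X Y" f g h]
    hom_module(2)[of X Y] Hom_Obj[OF assms(1)] assms
  by (simp add: abelian_group_def)

definition sub_arr :: "'m \<Rightarrow> 'm \<Rightarrow> 'm" where
  "sub_arr f g = Add_arr C f (Scale_arr C (-1) g)"

lemma sub_arr_hom: "f \<in> Hom C X Y \<Longrightarrow> g \<in> Hom C X Y \<Longrightarrow> sub_arr f g \<in> Hom C X Y"
  by (simp add: sub_arr_def Add_hom Scale_hom)

lemma sub_arr_self: assumes "f \<in> Hom C X Y" shows "sub_arr f f = Zero_arr C X Y"
  using Scale_distrib[OF assms, of 1 "-1"] Scale_1[OF assms] Scale_0[OF assms] by (simp add: sub_arr_def)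

lemma sub_arr_zero_iff:
  assumes "f \<in> Hom C X Y" "g \<in> Hom C X Y"
  shows "sub_arr f g = Zero_arr C X Y \<longleftrightarrow> f = g"
proof
  assume 0: "sub_arr f g = Zero_arr C X Y"
  have "Add_arr C (Scale_arr C (-1) g) g = Zero_arr C X Y"
    using Scale_distrib[OF assms(2), of "-1" 1] Scale_1[OF assms(2)] Scale_0[OF assms(2)] by simp
  hence "f = Add_arr C (sub_arr f g) g"
    using assms Add_assoc[of f X Y "Scale_arr C (-1) g" g] by (simp add: sub_arr_def Scale_hom Add_Zero)
  thus "f = g" using 0 assms by (simp add: Add_Zero)
qed (use assms sub_arr_self in simp)

lemma comp_sub_arr:
  assumes "f \<in> Hom C X Y" "f' \<in> Hom C X Y" "g \<in> Hom C Y Z"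
  shows "g \<cdot> sub_arr f f' = sub_arr (g \<cdot> f) (g \<cdot> f')"
  using assms Comp_Add[of f X Y "Scale_arr C (-1) f'" g Z] Comp_Scale[of f' X Y g Z "-1"]
  by (simp add: sub_arr_def Scale_hom)

lemma sub_arr_comp:
  assumes "f \<in> Hom C X Y" "g \<in> Hom C Y Z" "g' \<in> Hom C Y Z"
  shows "sub_arr g g' \<cdot> f = sub_arr (g \<cdot> f) (g' \<cdot> f)"
  using assms Add_Comp[of f X Y g Z "Scale_arr C (-1) g'"] Scale_Comp[of f X Y g' Z "-1"]
  by (simp add: sub_arr_def Scale_hom)

lemma comp_Zero:
  assumes "g \<in> Hom C Y Z" "X \<in> Obj C"
  shows "g \<cdot> Zero_arr C X Y = Zero_arr C X Z"
proof -
  have z: "Zero_arr C X Y \<in> Hom C X Y" using assms Hom_Obj Zero_hom by blast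
  show ?thesis using comp_sub_arr[OF z z assms(1)] sub_arr_self[OF z] sub_arr_self[OF Comp_hom[OF z assms(1)]] by simp
qed

lemma Zero_comp:
  assumes "f \<in> Hom C X Y" "Z \<in> Obj C"
  shows "Zero_arr C Y Z \<cdot> f = Zero_arr C X Z"
proof -
  have z: "Zero_arr C Y Z \<in> Hom C Y Z" using assms Hom_Obj Zero_hom by blast
  show ?thesis using sub_arr_comp[OF assms(1) z z] sub_arr_self[OF z] sub_arr_self[OF Comp_hom[OF assms(1) z]] by simp
qed

lemma linear_map_post:
  assumes "p \<in> Hom C X Y" "V \<in> Obj C"
  shows "linear_map class_ring (hom_space C V X) (hom_space C V Y) (\<lambda>f. p \<cdot> f)"
  using assms Hom_Obj[OF assms(1)]
  by (intro linear_mapI) (auto simp: hom_vectorspace Comp_Add Comp_Scale intro: Comp_hom)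

lemma linear_map_pre:
  assumes "p \<in> Hom C X Y" "V \<in> Obj C"
  shows "linear_map class_ring (hom_space C Y V) (hom_space C X V) (\<lambda>f. f \<cdot> p)"
  using assms Hom_Obj[OF assms(1)]
  by (intro linear_mapI) (auto simp: hom_vectorspace Add_Comp Scale_Comp intro: Comp_hom)

lemma linear_iso_post:
  assumes p: "p \<in> Hom C X Y" "iso_arr C p" and V: "V \<in> Obj C"
  shows "linear_iso class_ring (hom_space C V X) (hom_space C V Y) (\<lambda>f. p \<cdot> f)"
  unfolding linear_iso_def linear_iso_axioms_def
  using linear_map_post[OF p(1) V] p
  by (auto intro!: bij_betw_byWitness[where f' = "\<lambda>f. inv_arr C p \<cdot> f"] simp: Hom_arr)

lemma linear_iso_pre:
  assumes p: "p \<in> Hom C X Y" "iso_arr C p" and V: "V \<in> Obj C"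
  shows "linear_iso class_ring (hom_space C Y V) (hom_space C X V) (\<lambda>f. f \<cdot> p)"
  unfolding linear_iso_def linear_iso_axioms_def
  using linear_map_pre[OF p(1) V] p
  by (auto intro!: bij_betw_byWitness[where f' = "\<lambda>f. f \<cdot> inv_arr C p"] simp: Hom_arr comp_assoc)

definition hdim :: "'o \<Rightarrow> 'o \<Rightarrow> nat" where
  "hdim X Y = vectorspace.dim class_ring (hom_space C X Y)"

end

section \<open>Schur's lemma\<close>

context linear_category
begin

lemma kernel_Hom:
  assumes "is_kernel C k f"
  shows "k \<in> Hom C (Dom C k) (Dom C f)" "f \<in> Hom C (Dom C f) (Cod C f)"
    "f \<cdot> k = Zero_arr C (Dom C k) (Cod C f)"
  using assms by (auto simp: is_kernel_def Hom_arr)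

lemma kernel_factor:
  assumes "is_kernel C k f" "g \<in> Hom C X (Dom C f)" "f \<cdot> g = Zero_arr C X (Cod C f)"
  obtains h where "h \<in> Hom C X (Dom C k)" "k \<cdot> h = g"
  using assms unfolding is_kernel_def by blast

lemma kernel_cancel:
  assumes "is_kernel C k f" "h \<in> Hom C X (Dom C k)" "h' \<in> Hom C X (Dom C k)" "k \<cdot> h = k \<cdot> h'"
  shows "h = h'"
proof -
  note k = kernel_Hom[OF assms(1)]
  have g: "k \<cdot> h \<in> Hom C X (Dom C f)" using Comp_hom[OF assms(2) k(1)] .
  have "f \<cdot> (k \<cdot> h) = (f \<cdot> k) \<cdot> h" using Comp_assoc[OF assms(2) k(1,2)] by simp
  also have "\<dots> = Zero_arr C X (Cod C f)"
    unfolding k(3) using k(2) Hom_Obj Zero_comp[OF assms(2)] by blast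
  finally have "f \<cdot> (k \<cdot> h) = Zero_arr C X (Cod C f)" .
  hence "\<exists>!l. l \<in> Hom C X (Dom C k) \<and> k \<cdot> l = k \<cdot> h"
    using assms(1) g unfolding is_kernel_def by blast
  thus ?thesis using assms(2-4) by metis
qed

lemma kernel_mono: "is_kernel C k f \<Longrightarrow> mono_arr C k"
  using kernel_cancel[of k f] kernel_Hom(1)[of k f] unfolding mono_arr_def Hom_arr[of k] by metis

lemma cokernel_Hom:
  assumes "is_cokernel C q f"
  shows "q \<in> Hom C (Cod C f) (Cod C q)" "f \<in> Hom C (Dom C f) (Cod C f)"
    "q \<cdot> f = Zero_arr C (Dom C f) (Cod C q)"
  using assms by (auto simp: is_cokernel_def Hom_arr)

lemma cokernel_factor:
  assumes "is_cokernel C q f" "g \<in> Hom C (Cod C f) Y" "g \<cdot> f = Zero_arr C (Dom C f) Y"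
  obtains h where "h \<in> Hom C (Cod C q) Y" "h \<cdot> q = g"
  using assms unfolding is_cokernel_def by blast

lemma cokernel_cancel:
  assumes "is_cokernel C q f" "h \<in> Hom C (Cod C q) Y" "h' \<in> Hom C (Cod C q) Y" "h \<cdot> q = h' \<cdot> q"
  shows "h = h'"
proof -
  note q = cokernel_Hom[OF assms(1)]
  have g: "h \<cdot> q \<in> Hom C (Cod C f) Y" using Comp_hom[OF q(1) assms(2)] .
  have "(h \<cdot> q) \<cdot> f = h \<cdot> (q \<cdot> f)" using Comp_assoc[OF q(2,1) assms(2)] .
  also have "\<dots> = Zero_arr C (Dom C f) Y"
    unfolding q(3) using q(2) Hom_Obj comp_Zero[OF assms(2)] by blast
  finally have "(h \<cdot> q) \<cdot> f = Zero_arr C (Dom C f) Y" .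
  hence "\<exists>!l. l \<in> Hom C (Cod C q) Y \<and> l \<cdot> q = h \<cdot> q"
    using assms(1) g unfolding is_cokernel_def by blast
  thus ?thesis using assms(2-4) by metis
qed

lemma simple_Obj: "simple_obj C S \<Longrightarrow> S \<in> Obj C"
  by (simp add: simple_obj_def)

lemma simple_End:
  assumes "simple_obj C S" "f \<in> Hom C S S"
  obtains c where "f = Scale_arr C c (Id C S)"
  using assms unfolding simple_obj_def bij_betw_def by blast

lemma simple_Scale_eq:
  assumes "simple_obj C S" "Scale_arr C c (Id C S) = Scale_arr C d (Id C S)"
  shows "c = d"
  using assms unfolding simple_obj_def bij_betw_def inj_on_def by blast

lemma simple_nonzero:
  assumes "simple_obj C S" shows "Id C S \<noteq> Zero_arr C S S"
proof
  note I = Id_hom[OF simple_Obj[OF assms]]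
  assume "Id C S = Zero_arr C S S"
  hence "Scale_arr C 1 (Id C S) = Scale_arr C 0 (Id C S)" using Scale_0[OF I] Scale_1[OF I] by simp
  thus False using simple_Scale_eq[OF assms] by fastforce
qed

lemma Scale_Id_comp:
  assumes "f \<in> Hom C X Y"
  shows "Scale_arr C c (Id C Y) \<cdot> f = Scale_arr C c f" "f \<cdot> Scale_arr C c (Id C X) = Scale_arr C c f"
proof -
  have XY: "X \<in> Obj C" "Y \<in> Obj C" using Hom_Obj[OF assms] by auto
  show "Scale_arr C c (Id C Y) \<cdot> f = Scale_arr C c f"
    using Scale_Comp[OF assms Id_hom[OF XY(2)], of c] Id_Comp[OF assms] by simp
  show "f \<cdot> Scale_arr C c (Id C X) = Scale_arr C c f"
    using Comp_Scale[OF Id_hom[OF XY(1)] assms, of c] Comp_Id[OF assms] by simp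
qed

lemma simple_iso:
  assumes "iso_obj C X Y" "simple_obj C Y"
  shows "simple_obj C X"
proof -
  obtain p where p: "p \<in> Hom C X Y" "iso_arr C p" using assms(1) by (auto simp: iso_obj_def)
  have X: "X \<in> Obj C" and Y: "Y \<in> Obj C" using Hom_Obj[OF p(1)] by auto
  let ?T = "\<lambda>f. inv_arr C p \<cdot> (f \<cdot> p)"
  have q: "inv_arr C p \<in> Hom C Y X" using p by (auto simp: Hom_arr)
  have "bij_betw ?T (Hom C Y Y) (Hom C X X)"
    using bij_betw_trans[OF linear_iso.bij[OF linear_iso_pre[OF p Y]] linear_iso.bij[OF linear_iso_post[OF q _ X]]] p
    by (simp add: comp_def)
  hence "bij_betw (?T \<circ> (\<lambda>c. Scale_arr C c (Id C Y))) UNIV (Hom C X X)"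
    using assms(2) bij_betw_trans unfolding simple_obj_def by blast
  moreover have "?T (Scale_arr C c (Id C Y)) = Scale_arr C c (Id C X)" for c
    using Scale_Id_comp(1)[OF p(1)] Comp_Scale[OF p(1) q, of c] p by (simp add: Hom_arr)
  ultimately show ?thesis using X by (simp add: simple_obj_def comp_def)
qed

lemma simple_idempotent:
  assumes S: "simple_obj C S" and e: "e \<in> Hom C S S" "e \<cdot> e = e"
  shows "e = Zero_arr C S S \<or> e = Id C S"
proof -
  note I = Id_hom[OF simple_Obj[OF S]]
  obtain c where c: "e = Scale_arr C c (Id C S)" using simple_End[OF S e(1)] .
  have "e \<cdot> e = Scale_arr C (c * c) (Id C S)"
    using Scale_Id_comp(1)[OF e(1), of c] Scale_Scale[OF I] c by simp
  hence "c * c = c" using e(2) c simple_Scale_eq[OF S] by metis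
  hence "c = 0 \<or> c = 1" by simp
  thus ?thesis using c Scale_0[OF I] Scale_1[OF I] by auto
qed

end

context semisimple_category
begin

text \<open>The kernel of \<open>f\<close> is a direct summand of \<open>S\<close>, hence corresponds to an idempotent of
  \<open>End(S) = \<complex>\<close>. The idempotent \<open>1\<close> would make \<open>f\<close> zero, so the kernel vanishes and \<open>f\<close> is a
  monomorphism, which splits by semisimplicity.\<close>

lemma simple_mono_split:
  assumes S: "simple_obj C S" and f: "f \<in> Hom C S X" "f \<noteq> Zero_arr C S X"
  obtains r where "r \<in> Hom C X S" "r \<cdot> f = Id C S"
proof -
  have X: "X \<in> Obj C" "S \<in> Obj C" using Hom_Obj[OF f(1)] by auto
  have df: "Dom C f = S" "Cod C f = X" "f \<in> Arr C" using f by (auto simp: Hom_arr)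
  obtain k where k: "is_kernel C k f" using ex_kernel[OF df(3)] by blast
  let ?K = "Dom C k"
  have kH: "k \<in> Hom C ?K S" "f \<cdot> k = Zero_arr C ?K X" using kernel_Hom[OF k] df by auto
  have K: "?K \<in> Obj C" using Hom_Obj[OF kH(1)] by auto
  obtain s where s: "s \<in> Hom C S ?K" "s \<cdot> k = Id C ?K"
    using mono_splits[OF kernel_mono[OF k]] kH by (auto simp: Hom_arr)
  have e: "k \<cdot> s \<in> Hom C S S" using Comp_hom[OF s(1) kH(1)] .
  have "(k \<cdot> s) \<cdot> (k \<cdot> s) = k \<cdot> s"
    using comp_tail[OF s(2), of s] s(1) kH(1) by (simp add: Hom_arr comp_assoc)
  hence "k \<cdot> s = Zero_arr C S S \<or> k \<cdot> s = Id C S" using simple_idempotent[OF S e] by blast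
  moreover have "k \<cdot> s \<noteq> Id C S"
  proof
    assume 1: "k \<cdot> s = Id C S"
    have "f = f \<cdot> (k \<cdot> s)" unfolding 1 using f by (simp add: Hom_arr)
    also have "\<dots> = (f \<cdot> k) \<cdot> s" using Comp_assoc[OF s(1) kH(1) f(1)] by simp
    also have "\<dots> = Zero_arr C S X" unfolding kH(2) using Zero_comp[OF s(1) X(1)] .
    finally show False using f by simp
  qed
  ultimately have ks: "k \<cdot> s = Zero_arr C S S" by blast
  have "k = (k \<cdot> s) \<cdot> k" using s kH by (simp add: Hom_arr comp_assoc)
  hence k0: "k = Zero_arr C ?K S" unfolding ks using Zero_comp[OF kH(1) X(2)] by simp
  have "mono_arr C f"
    unfolding mono_arr_def df
  proof (intro conjI allI ballI impI df(3))
    fix Y g h assume gh: "g \<in> Hom C Y S" "h \<in> Hom C Y S" and eq: "f \<cdot> g = f \<cdot> h"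
    have "f \<cdot> sub_arr g h = Zero_arr C Y X"
      unfolding comp_sub_arr[OF gh f(1)] eq using sub_arr_self[OF Comp_hom[OF gh(2) f(1)]] .
    then obtain l where l: "l \<in> Hom C Y ?K" "k \<cdot> l = sub_arr g h"
      using kernel_factor[OF k, of "sub_arr g h" Y] sub_arr_hom[OF gh] df by auto
    have "sub_arr g h = Zero_arr C Y S"
      using l Zero_comp[OF l(1) X(2)] k0 by metis
    thus "g = h" using sub_arr_zero_iff[OF gh] by simp
  qed
  from mono_splits[OF this] show ?thesis using that df by auto
qed

text \<open>A left inverse \<open>r\<close> exists, and \<open>f r\<close> is a nonzero idempotent of \<open>End(T) = \<complex>\<close>.\<close>

lemma simple_nonzero_iso:
  assumes S: "simple_obj C S" and T: "simple_obj C T" and f: "f \<in> Hom C S T" "f \<noteq> Zero_arr C S T"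
  shows "iso_arr C f"
proof -
  obtain r where r: "r \<in> Hom C T S" "r \<cdot> f = Id C S" using simple_mono_split[OF S f] .
  have e: "f \<cdot> r \<in> Hom C T T" using Comp_hom[OF r(1) f(1)] .
  have "(f \<cdot> r) \<cdot> (f \<cdot> r) = f \<cdot> r"
    using comp_tail[OF r(2), of r] r(1) f(1) by (simp add: Hom_arr comp_assoc)
  hence "f \<cdot> r = Zero_arr C T T \<or> f \<cdot> r = Id C T" using simple_idempotent[OF T e] by blast
  moreover have "f \<cdot> r \<noteq> Zero_arr C T T"
  proof
    assume 0: "f \<cdot> r = Zero_arr C T T"
    have "f = (f \<cdot> r) \<cdot> f" using r f by (simp add: Hom_arr comp_assoc)
    thus False unfolding 0 using Zero_comp[OF f(1) simple_Obj[OF T]] f(2) by simp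
  qed
  ultimately have "is_inverse C f r" using r f by (auto simp: is_inverse_def Hom_arr)
  thus ?thesis by (auto simp: iso_arr_def)
qed

lemma Hom_simple_zero:
  assumes S: "simple_obj C S" and T: "simple_obj C T" and n: "\<not> iso_obj C S T"
  shows "Hom C S T = {Zero_arr C S T}"
proof -
  have "f = Zero_arr C S T" if "f \<in> Hom C S T" for f
    using simple_nonzero_iso[OF S T that] n that by (auto simp: iso_obj_def)
  thus ?thesis using Zero_hom[OF simple_Obj[OF S] simple_Obj[OF T]] by blast
qed

end

section \<open>Dimensions of morphism spaces\<close>

context fusion_category
begin

lemma hdim_iso_right:
  assumes "iso_obj C X Y" "V \<in> Obj C" shows "hdim V X = hdim V Y"
proof -
  obtain p where p: "p \<in> Hom C X Y" "iso_arr C p" using assms by (auto simp: iso_obj_def)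
  show ?thesis
    using linear_iso.dim_eq[OF linear_iso_post[OF p assms(2)]] hom_fin_dim Hom_Obj[OF p(1)] assms(2)
    by (simp add: hdim_def)
qed

lemma hdim_iso_left:
  assumes "iso_obj C X Y" "V \<in> Obj C" shows "hdim X V = hdim Y V"
proof -
  obtain p where p: "p \<in> Hom C X Y" "iso_arr C p" using assms by (auto simp: iso_obj_def)
  show ?thesis
    using linear_iso.dim_eq[OF linear_iso_pre[OF p assms(2)]] hom_fin_dim Hom_Obj[OF p(1)] assms(2)
    by (simp add: hdim_def)
qed

lemma hdim_simple_self:
  assumes S: "simple_obj C S" shows "hdim S S = 1"
proof -
  have SO: "S \<in> Obj C" using simple_Obj[OF S] .
  note I = Id_hom[OF SO]
  interpret V: vectorspace class_ring "hom_space C S S" using hom_vectorspace[OF SO SO] .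
  have lc: "V.module.lincomb a {Id C S} = Scale_arr C (a (Id C S)) (Id C S)" for a
  proof -
    have "V.module.lincomb a {Id C S} = finsum (hom_space C S S) (\<lambda>v. Scale_arr C (a v) v) (insert (Id C S) {})"
      by (simp add: V.module.lincomb_def)
    also have "\<dots> = Add_arr C (Scale_arr C (a (Id C S)) (Id C S)) (Zero_arr C S S)"
      using I Scale_hom[OF I] by (subst V.module.M.finsum_insert) (auto simp: Pi_def)
    finally show ?thesis using Add_Zero(1)[OF Scale_hom[OF I]] by simp
  qed
  have li: "V.module.lin_indpt {Id C S}"
  proof (rule V.module.finite_lin_indpt2)
    fix a :: "_ \<Rightarrow> complex" assume "V.module.lincomb a {Id C S} = \<zero>\<^bsub>hom_space C S S\<^esub>"
    hence "Scale_arr C (a (Id C S)) (Id C S) = Scale_arr C 0 (Id C S)" using lc Scale_0[OF I] by simp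
    thus "\<forall>v\<in>{Id C S}. a v = \<zero>\<^bsub>class_ring\<^esub>" using simple_Scale_eq[OF S] by simp
  qed (use I in auto)
  have gen: "V.module.gen_set {Id C S}"
  proof
    show "V.module.span {Id C S} \<subseteq> carrier (hom_space C S S)"
      using I by (intro V.module.span_is_subset2) simp
    show "carrier (hom_space C S S) \<subseteq> V.module.span {Id C S}"
    proof
      fix f assume "f \<in> carrier (hom_space C S S)"
      then obtain c where c: "f = Scale_arr C c (Id C S)" using simple_End[OF S] by auto
      have "f = V.module.lincomb (\<lambda>_. c) {Id C S}" using lc c by simp
      thus "f \<in> V.module.span {Id C S}" unfolding V.module.span_def
        by (intro CollectI exI[of _ "\<lambda>_. c"] exI[of _ "{Id C S}"]) simp
    qed
  qed
  have "V.basis {Id C S}" using li gen I by (simp add: V.basis_def)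
  thus ?thesis using V.dim_basis[of "{Id C S}"] by (simp add: hdim_def)
qed

lemma hdim_zero: 
  assumes "X \<in> Obj C" "Y \<in> Obj C" "Hom C X Y = {Zero_arr C X Y}" shows "hdim X Y = 0"
  using vectorspace.dim_trivial[OF hom_vectorspace[OF assms(1,2)]] assms(3) by (simp add: hdim_def)

lemma hdim_simple:
  assumes "simple_obj C S" "simple_obj C T"
  shows "hdim S T = (if iso_obj C S T then 1 else 0)"
  using hdim_iso_right[of S T S] hdim_simple_self[OF assms(1)] hdim_zero[of S T] Hom_simple_zero[OF assms]
    simple_Obj[OF assms(1)] simple_Obj[OF assms(2)] by auto

text \<open>Short exact sequences split: the monomorphism has a retraction \<open>r\<close>, and \<open>1 - i r\<close> factors through
  \<open>p\<close> as a section \<open>s\<close>. Hence composition with \<open>p\<close> is onto, its kernel consists of the morphisms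
  factoring through \<open>i\<close>, and rank-nullity applies.\<close>

lemma hdim_additive:
  assumes k: "is_kernel C i p" and q: "is_cokernel C p i" and V: "V \<in> Obj C"
  shows "hdim V (Cod C i) = hdim V (Dom C i) + hdim V (Cod C p)"
proof -
  let ?X = "Cod C i" and ?Y = "Dom C i" and ?Z = "Cod C p"
  have dp: "Dom C p = ?X" using q by (simp add: is_cokernel_def)
  have i: "i \<in> Hom C ?Y ?X" and p: "p \<in> Hom C ?X ?Z" and pi: "p \<cdot> i = Zero_arr C ?Y ?Z"
    using kernel_Hom[OF k] cokernel_Hom[OF q] by simp_all
  have O: "?X \<in> Obj C" "?Y \<in> Obj C" "?Z \<in> Obj C" using i p Hom_Obj by blast+
  note I = Id_hom[OF O(1)]
  obtain r where r: "r \<in> Hom C ?X ?Y" "r \<cdot> i = Id C ?Y" using mono_splits[OF kernel_mono[OF k]] by blast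
  have ir: "i \<cdot> r \<in> Hom C ?X ?X" using Comp_hom[OF r(1) i] .
  have "sub_arr (Id C ?X) (i \<cdot> r) \<cdot> i = sub_arr (Id C ?X \<cdot> i) ((i \<cdot> r) \<cdot> i)" using sub_arr_comp[OF i I ir] .
  also have "(i \<cdot> r) \<cdot> i = i" using r i by (simp add: Hom_arr comp_assoc)
  also have "Id C ?X \<cdot> i = i" using Id_Comp[OF i] .
  finally have "sub_arr (Id C ?X) (i \<cdot> r) \<cdot> i = Zero_arr C ?Y ?X" using sub_arr_self[OF i] by simp
  then obtain s where s: "s \<in> Hom C ?Z ?X" "s \<cdot> p = sub_arr (Id C ?X) (i \<cdot> r)"
    using cokernel_factor[OF q sub_arr_hom[OF I ir]] by blast
  have "(p \<cdot> s) \<cdot> p = p \<cdot> sub_arr (Id C ?X) (i \<cdot> r)" using Comp_assoc[OF p s(1) p] s(2) by simp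
  also have "\<dots> = sub_arr (p \<cdot> Id C ?X) (p \<cdot> (i \<cdot> r))" using comp_sub_arr[OF I ir p] .
  also have "p \<cdot> (i \<cdot> r) = (p \<cdot> i) \<cdot> r" using Comp_assoc[OF r(1) i p] by simp
  also have "\<dots> = p \<cdot> Zero_arr C ?X ?X" unfolding pi using Zero_comp[OF r(1) O(3)] comp_Zero[OF p O(1)] by simp
  also have "sub_arr (p \<cdot> Id C ?X) (p \<cdot> Zero_arr C ?X ?X) = p \<cdot> sub_arr (Id C ?X) (Zero_arr C ?X ?X)"
    using comp_sub_arr[OF I Zero_hom[OF O(1) O(1)] p] by simp
  also have "sub_arr (Id C ?X) (Zero_arr C ?X ?X) = Id C ?X"
  proof -
    have z: "Zero_arr C ?X ?X \<in> Hom C ?X ?X" using Zero_hom O by simp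
    have "Scale_arr C (-1) (Zero_arr C ?X ?X) = Zero_arr C ?X ?X"
      using Scale_Scale[OF z, of "-1" 0] Scale_0[OF z] by simp
    thus ?thesis using Add_Zero[OF I] by (simp add: sub_arr_def)
  qed
  also have "p \<cdot> Id C ?X = Id C ?Z \<cdot> p" using p by (simp add: Hom_arr)
  finally have ps: "p \<cdot> s = Id C ?Z"
    using cokernel_cancel[OF q Comp_hom[OF s(1) p] Id_hom[OF O(3)]] by simp
  interpret L: linear_map class_ring "hom_space C V ?X" "hom_space C V ?Z" "\<lambda>f. p \<cdot> f"
    using linear_map_post[OF p V] .
  let ?N = "{f \<in> Hom C V ?X. p \<cdot> f = Zero_arr C V ?Z}"
  have ker: "L.ker = ?N" unfolding L.ker_def by simp
  have im: "L.im = Hom C V ?Z"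
  proof
    show "L.im \<subseteq> Hom C V ?Z" unfolding L.im_def using Comp_hom[OF _ p] by auto
    show "Hom C V ?Z \<subseteq> L.im"
    proof
      fix g assume g: "g \<in> Hom C V ?Z"
      have "p \<cdot> (s \<cdot> g) = (p \<cdot> s) \<cdot> g" using Comp_assoc[OF g s(1) p] by simp
      hence "p \<cdot> (s \<cdot> g) = g" unfolding ps using Id_Comp[OF g] by simp
      thus "g \<in> L.im" unfolding L.im_def using Comp_hom[OF g s(1)] by force
    qed
  qed
  let ?NS = "hom_space C V ?X\<lparr>carrier := ?N\<rparr>"
  have sub: "vectorspace class_ring ?NS"
    using L.V.subspace_is_vs[OF L.kerT_is_subspace] unfolding ker .
  have "linear_iso class_ring (hom_space C V ?Y) ?NS (\<lambda>f. i \<cdot> f)"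
    unfolding linear_iso_def linear_iso_axioms_def
  proof
    interpret M: linear_map class_ring "hom_space C V ?Y" "hom_space C V ?X" "\<lambda>f. i \<cdot> f"
      using linear_map_post[OF i V] .
    have iN: "i \<cdot> f \<in> ?N" if "f \<in> Hom C V ?Y" for f
    proof -
      have "p \<cdot> (i \<cdot> f) = (p \<cdot> i) \<cdot> f" using Comp_assoc[OF that i p] by simp
      thus ?thesis using Comp_hom[OF that i] Zero_comp[OF that O(3)] pi by simp
    qed
    show "linear_map class_ring (hom_space C V ?Y) ?NS (\<lambda>f. i \<cdot> f)"
      using hom_vectorspace[OF V O(2)] sub iN M.f_add M.f_smult
      by (intro linear_mapI) simp_all
    have "inj_on (\<lambda>f. i \<cdot> f) (Hom C V ?Y)"
      using kernel_cancel[OF k] by (auto simp: inj_on_def)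
    moreover have "?N \<subseteq> (\<lambda>f. i \<cdot> f) ` Hom C V ?Y"
    proof
      fix g assume g: "g \<in> ?N"
      then obtain h where "h \<in> Hom C V ?Y" "i \<cdot> h = g"
        using kernel_factor[OF k, of g V] dp by auto
      thus "g \<in> (\<lambda>f. i \<cdot> f) ` Hom C V ?Y" by blast
    qed
    ultimately show "bij_betw (\<lambda>f. i \<cdot> f) (carrier (hom_space C V ?Y)) (carrier ?NS)"
      using iN by (auto simp: bij_betw_def)
  qed
  from linear_iso.dim_eq[OF this hom_fin_dim[OF V O(2)]]
  have d1: "vectorspace.dim class_ring ?NS = hdim V ?Y" by (simp add: hdim_def)
  have d2: "hom_space C V ?Z\<lparr>carrier := Hom C V ?Z\<rparr> = hom_space C V ?Z" by (simp add: hom_space_def)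
  show ?thesis
    using L.rank_nullity[OF hom_fin_dim[OF V O(1)]] unfolding ker im d1 d2 by (simp add: hdim_def)
qed

end

section \<open>Fusion coefficients\<close>

context fusion_category
begin

lemma K0_relation_subset:
  "{frag_of (Cod C i) - frag_of (Dom C i) - frag_of (Cod C p) | i p. is_kernel C i p \<and> is_cokernel C p i}
    \<subseteq> carrier (free_Abelian_group (Obj C))"
proof clarify
  fix i p assume "is_kernel C i p"
  hence "i \<in> Arr C" "p \<in> Arr C" by (auto simp: is_kernel_def)
  hence "Cod C i \<in> Obj C" "Dom C i \<in> Obj C" "Cod C p \<in> Obj C" by simp_all
  thus "frag_of (Cod C i) - frag_of (Dom C i) - frag_of (Cod C p) \<in> carrier (free_Abelian_group (Obj C))"
    using keys_diff[of "frag_of (Cod C i) - frag_of (Dom C i)" "frag_of (Cod C p)"]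
      keys_diff[of "frag_of (Cod C i)" "frag_of (Dom C i)"]
    by auto
qed

lemma K0_subgroup: "subgroup (K0_relations C) (free_Abelian_group (Obj C))"
  unfolding K0_relations_def
  by (rule group.generate_is_subgroup[OF group_free_Abelian_group K0_relation_subset])

lemma K0_add: "x \<in> K0_relations C \<Longrightarrow> y \<in> K0_relations C \<Longrightarrow> x + y \<in> K0_relations C"
  using subgroup.m_closed[OF K0_subgroup] by simp

lemma K0_exact:
  "is_kernel C i p \<Longrightarrow> is_cokernel C p i \<Longrightarrow>
    frag_of (Cod C i) - frag_of (Dom C i) - frag_of (Cod C p) \<in> K0_relations C"
  unfolding K0_relations_def by (rule generate.incl) blast

lemma K0_class_eq_iff:
  assumes "x \<in> carrier (free_Abelian_group (Obj C))" "y \<in> carrier (free_Abelian_group (Obj C))"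
  shows "K0_class C x = K0_class C y \<longleftrightarrow> x - y \<in> K0_relations C"
proof -
  let ?G = "free_Abelian_group (Obj C)" and ?R = "K0_relations C"
  interpret G: group ?G by simp
  interpret R: subgroup ?R ?G by (rule K0_subgroup)
  have "x \<otimes>\<^bsub>?G\<^esub> inv\<^bsub>?G\<^esub> y = x - y" using assms by simp
  hence "x \<in> ?R #>\<^bsub>?G\<^esub> y \<longleftrightarrow> x - y \<in> ?R"
    using R.rcos_module[OF G.is_group assms(2,1)] by simp
  moreover have "K0_class C x = K0_class C y \<longleftrightarrow> x \<in> ?R #>\<^bsub>?G\<^esub> y"
    unfolding K0_class_def
    using G.repr_independence[OF _ assms(2) K0_subgroup] G.rcos_self[OF assms(1) K0_subgroup] by metis
  ultimately show ?thesis by simp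
qed

text \<open>The additive extension of \<open>X \<mapsto> dim C(V, X)\<close> to the free abelian group. Coefficients are read off a
  free abelian group on one generator, which makes additivity an instance of that of
  \<open>frag_extend\<close>.\<close>

definition hom_rank :: "'o \<Rightarrow> ('o \<Rightarrow>\<^sub>0 int) \<Rightarrow> int" where
  "hom_rank V x = Poly_Mapping.lookup (frag_extend (\<lambda>X. frag_cmul (int (hdim V X)) (frag_of ())) x) ()"

lemma hom_rank_simps [simp]:
  "hom_rank V (frag_of X) = int (hdim V X)" "hom_rank V 0 = 0"
  "hom_rank V (x + y) = hom_rank V x + hom_rank V y" "hom_rank V (x - y) = hom_rank V x - hom_rank V y"
  "hom_rank V (- x) = - hom_rank V x" "hom_rank V (frag_cmul c x) = c * hom_rank V x"
  by (simp_all add: hom_rank_def frag_extend_add frag_extend_diff frag_extend_minus frag_extend_cmul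
      lookup_add lookup_minus lookup_frag_of)

lemma hom_rank_sum: "hom_rank V (sum f A) = (\<Sum>a\<in>A. hom_rank V (f a))"
  by (induction A rule: infinite_finite_induct) simp_all

lemma hom_rank_relation:
  assumes V: "V \<in> Obj C" and x: "x \<in> K0_relations C"
  shows "hom_rank V x = 0"
  using x unfolding K0_relations_def
proof (induction rule: generate.induct)
  case (incl h)
  thus ?case using hdim_additive[OF _ _ V] by auto
next
  case (inv h)
  hence "h \<in> carrier (free_Abelian_group (Obj C))" using K0_relation_subset by blast
  moreover have "hom_rank V h = 0" using inv hdim_additive[OF _ _ V] by auto
  ultimately show ?case by simp
qed simp_all

text \<open>The endomorphism \<open>1 - s p\<close> factors through the kernel, so any \<open>g\<close> that kills the kernel equals
  \<open>g s p\<close>.\<close>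

lemma split_epi_exact:
  assumes p: "p \<in> Hom C X S" and s: "s \<in> Hom C S X" and ps: "p \<cdot> s = Id C S"
    and k: "is_kernel C k p"
  shows "is_cokernel C p k"
proof -
  have O: "X \<in> Obj C" "S \<in> Obj C" using Hom_Obj[OF p] by auto
  note I = Id_hom[OF O(1)]
  let ?K = "Dom C k"
  have dp: "Dom C p = X" "Cod C p = S" "p \<in> Arr C" using p by (auto simp: Hom_arr)
  have kH: "k \<in> Hom C ?K X" and pk: "p \<cdot> k = Zero_arr C ?K S" using kernel_Hom[OF k] dp by auto
  have sp: "s \<cdot> p \<in> Hom C X X" using Comp_hom[OF p s] .
  have "p \<cdot> sub_arr (Id C X) (s \<cdot> p) = sub_arr (p \<cdot> Id C X) (p \<cdot> (s \<cdot> p))" using comp_sub_arr[OF I sp p] .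
  also have "p \<cdot> (s \<cdot> p) = (p \<cdot> s) \<cdot> p" using Comp_assoc[OF p s p] by simp
  also have "\<dots> = p" unfolding ps using Id_Comp[OF p] .
  also have "p \<cdot> Id C X = p" using Comp_Id[OF p] .
  finally have "p \<cdot> sub_arr (Id C X) (s \<cdot> p) = Zero_arr C X S" using sub_arr_self[OF p] by simp
  then obtain q where q: "q \<in> Hom C X ?K" "k \<cdot> q = sub_arr (Id C X) (s \<cdot> p)"
    using kernel_factor[OF k, of "sub_arr (Id C X) (s \<cdot> p)" X] sub_arr_hom[OF I sp] dp by auto
  have "\<exists>!h. h \<in> Hom C S Y \<and> h \<cdot> p = g" if g: "g \<in> Hom C X Y" and gk: "g \<cdot> k = Zero_arr C ?K Y" for Y g
  proof (rule ex1I[of _ "g \<cdot> s"])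
    have Y: "Y \<in> Obj C" using Hom_Obj[OF g] by auto
    have gsp: "g \<cdot> (s \<cdot> p) \<in> Hom C X Y" using Comp_hom[OF sp g] .
    have "sub_arr g (g \<cdot> (s \<cdot> p)) = sub_arr (g \<cdot> Id C X) (g \<cdot> (s \<cdot> p))" using Comp_Id[OF g] by simp
    also have "\<dots> = g \<cdot> sub_arr (Id C X) (s \<cdot> p)" using comp_sub_arr[OF I sp g] by simp
    also have "\<dots> = (g \<cdot> k) \<cdot> q" using Comp_assoc[OF q(1) kH g] q(2) by simp
    also have "\<dots> = Zero_arr C X Y" unfolding gk using Zero_comp[OF q(1) Y] .
    finally have "g = g \<cdot> (s \<cdot> p)" using sub_arr_zero_iff[OF g gsp] by simp
    thus "g \<cdot> s \<in> Hom C S Y \<and> (g \<cdot> s) \<cdot> p = g"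
      using Comp_hom[OF s g] Comp_assoc[OF p s g] by simp
    fix h assume h: "h \<in> Hom C S Y \<and> h \<cdot> p = g"
    have "(h \<cdot> p) \<cdot> s = h \<cdot> (p \<cdot> s)" using Comp_assoc[OF s p] h by blast
    thus "h = g \<cdot> s" using h ps Comp_Id[of h S Y] by simp
  qed
  moreover have "Cod C k = X" "k \<in> Arr C" using kH by (simp_all add: Hom_arr)
  ultimately show ?thesis unfolding is_cokernel_def using dp pk by simp
qed

lemma simple_reps_iso:
  assumes "simple_reps C Vs" "i < length Vs" "j < length Vs"
  shows "iso_obj C (Vs ! i) (Vs ! j) \<longleftrightarrow> i = j"
proof -
  have s: "simple_obj C (Vs ! i)" using assms by (simp add: simple_reps_def)
  have r: "iso_obj C (Vs ! i) (Vs ! i)" using simple_Obj[OF s] iso_obj_refl by simp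
  have "\<exists>!k. k < length Vs \<and> iso_obj C (Vs ! i) (Vs ! k)" using assms(1) s by (simp add: simple_reps_def)
  thus ?thesis using r assms by blast
qed

lemma hdim_reps:
  assumes "simple_reps C Vs" "i < length Vs" "j < length Vs"
  shows "hdim (Vs ! i) (Vs ! j) = (if i = j then 1 else 0)"
  using assms hdim_simple[of "Vs ! i" "Vs ! j"] simple_reps_iso[OF assms] by (simp add: simple_reps_def)

lemma simple_quotient:
  assumes X: "X \<in> Obj C" and nz: "Id C X \<noteq> Zero_arr C X X" and Vs: "simple_reps C Vs"
  obtains i p s where "i < length Vs" "p \<in> Hom C X (Vs ! i)" "s \<in> Hom C (Vs ! i) X" "p \<cdot> s = Id C (Vs ! i)"
proof -
  obtain Xs where Xs: "\<forall>V \<in> set Xs. simple_obj C V" "is_direct_sum C X Xs" using ex_decomposition[OF X] by blast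
  obtain \<iota> \<pi> where ip: "\<forall>k < length Xs. \<iota> k \<in> Hom C (Xs ! k) X \<and> \<pi> k \<in> Hom C X (Xs ! k)"
     "\<forall>k < length Xs. \<forall>l < length Xs.
          \<pi> k \<cdot> \<iota> l = (if k = l then Id C (Xs ! k) else Zero_arr C (Xs ! l) (Xs ! k))"
     "finsum (hom_space C X X) (\<lambda>k. \<iota> k \<cdot> \<pi> k) {..<length Xs} = Id C X"
    using Xs(2) unfolding is_direct_sum_def by blast
  interpret V: vectorspace class_ring "hom_space C X X" using hom_vectorspace[OF X X] .
  have "Xs \<noteq> []" using ip(3) nz by auto
  hence l: "0 < length Xs" by simp
  let ?S = "Xs ! 0"
  have S: "simple_obj C ?S" using Xs(1) l by simp
  obtain i where i: "i < length Vs" "iso_obj C ?S (Vs ! i)" using Vs S unfolding simple_reps_def by blast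
  then obtain h where h: "h \<in> Hom C ?S (Vs ! i)" "iso_arr C h" by (auto simp: iso_obj_def)
  have a: "\<iota> 0 \<in> Hom C ?S X" "\<pi> 0 \<in> Hom C X ?S" "\<pi> 0 \<cdot> \<iota> 0 = Id C ?S" using ip l by auto
  have pa: "\<pi> 0 \<cdot> (\<iota> 0 \<cdot> inv_arr C h) = inv_arr C h"
    using a h comp_tail[OF a(3), of "inv_arr C h"] by (simp add: Hom_arr)
  show ?thesis
    by (rule that[of i "h \<cdot> \<pi> 0" "\<iota> 0 \<cdot> inv_arr C h"]) (use a h i pa in \<open>auto simp: Hom_arr comp_assoc\<close>)
qed

text \<open>Induction on the total multiplicity of the simple objects. A nonzero \<open>X\<close> has a simple quotient with
  a section; its kernel has the same multiplicities except that one of them drops by one. For the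
  zero object, exactness of \<open>0 \<rightarrow> X \<rightarrow> X \<rightarrow> X \<rightarrow> 0\<close> shows that its class vanishes.\<close>

lemma K0_expansion:
  assumes Vs: "simple_reps C Vs" and X: "X \<in> Obj C"
  shows "frag_of X - (\<Sum>j<length Vs. frag_cmul (int (hdim (Vs ! j) X)) (frag_of (Vs ! j))) \<in> K0_relations C"
  using X
proof (induction "\<Sum>j<length Vs. hdim (Vs ! j) X" arbitrary: X rule: less_induct)
  case (less X)
  have VO: "Vs ! j \<in> Obj C" if "j < length Vs" for j using Vs that simple_Obj by (simp add: simple_reps_def)
  show ?case
  proof (cases "Id C X = Zero_arr C X X")
    case True
    note I = Id_hom[OF less.prems]
    have k: "is_kernel C (Id C X) (Id C X)"
      unfolding is_kernel_def using True[symmetric] less.prems by (auto simp: Hom_arr)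
    have q: "is_cokernel C (Id C X) (Id C X)"
      unfolding is_cokernel_def using True[symmetric] less.prems by (auto simp: Hom_arr)
    have "hdim (Vs ! j) X = 0" if "j < length Vs" for j
      using hdim_additive[OF k q VO[OF that]] less.prems by simp
    hence z: "(\<Sum>j<length Vs. frag_cmul (int (hdim (Vs ! j) X)) (frag_of (Vs ! j))) = 0" by simp
    have "- frag_of X \<in> K0_relations C" using K0_exact[OF k q] less.prems by simp
    hence "inv\<^bsub>free_Abelian_group (Obj C)\<^esub> (- frag_of X) \<in> K0_relations C"
      using subgroup.m_inv_closed[OF K0_subgroup] by blast
    thus ?thesis unfolding z using less.prems by simp
  next
    case False
    obtain i p s where i: "i < length Vs" and p: "p \<in> Hom C X (Vs ! i)" and s: "s \<in> Hom C (Vs ! i) X"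
      and ps: "p \<cdot> s = Id C (Vs ! i)"
      using simple_quotient[OF less.prems False Vs] .
    have dp: "Dom C p = X" "Cod C p = Vs ! i" "p \<in> Arr C" using p by (auto simp: Hom_arr)
    obtain k where k: "is_kernel C k p" using ex_kernel[OF dp(3)] by blast
    have q: "is_cokernel C p k" using split_epi_exact[OF p s ps k] .
    let ?K = "Dom C k"
    have ck: "Cod C k = X" "?K \<in> Obj C" using kernel_Hom[OF k] dp Hom_Obj by (auto simp: Hom_arr)
    have d: "hdim (Vs ! j) X = hdim (Vs ! j) ?K + (if j = i then 1 else 0)" if "j < length Vs" for j
      using hdim_additive[OF k q VO[OF that]] hdim_reps[OF Vs that i] ck dp by simp
    have "(\<Sum>j<length Vs. hdim (Vs ! j) X) = (\<Sum>j<length Vs. hdim (Vs ! j) ?K) + 1"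
      using i by (simp add: d sum.distrib)
    hence IH: "frag_of ?K - (\<Sum>j<length Vs. frag_cmul (int (hdim (Vs ! j) ?K)) (frag_of (Vs ! j))) \<in> K0_relations C"
      using less.hyps ck by simp
    have "(\<Sum>j<length Vs. frag_cmul (int (hdim (Vs ! j) X)) (frag_of (Vs ! j)))
      = (\<Sum>j<length Vs. frag_cmul (int (hdim (Vs ! j) ?K)) (frag_of (Vs ! j)) +
          (if j = i then frag_of (Vs ! j) else 0))"
      by (intro sum.cong refl) (simp add: d frag_cmul_distrib)
    also have "\<dots> = (\<Sum>j<length Vs. frag_cmul (int (hdim (Vs ! j) ?K)) (frag_of (Vs ! j))) + frag_of (Vs ! i)"
      using i by (simp add: sum.distrib)
    finally show ?thesis
      using K0_add[OF K0_exact[OF k q] IH] by (simp add: ck dp algebra_simps)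
  qed
qed

lemma simple_reps_reps: "simple_reps C (reps C)"
  unfolding reps_def using finitely_many_simples by (rule someI_ex)

text \<open>Existence of the coefficients is \<open>K0_expansion\<close>. They are unique because \<open>hom_rank\<close> vanishes on the
  relations and takes the value \<open>N k\<close> on \<open>\<Sum>\<^sub>j N\<^sub>j [V\<^sub>j]\<close> by Schur's lemma.\<close>

lemma fusion_coeff_eq:
  assumes V: "V \<in> Obj C" and i: "i < length (reps C)" and j: "j < length (reps C)"
  shows "fusion_coeff C V i j = int (hdim (reps C ! j) (V \<boxtimes> reps C ! i))"
proof -
  let ?Vs = "reps C" and ?n = "length (reps C)"
  let ?G = "free_Abelian_group (Obj C)"
  have VO: "?Vs ! k \<in> Obj C" if "k < ?n" for k
    using simple_reps_reps that simple_Obj by (simp add: simple_reps_def)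
  let ?X = "V \<boxtimes> ?Vs ! i"
  have X: "?X \<in> Obj C" using V VO[OF i] by simp
  have car: "(\<Sum>k<?n. frag_cmul (N k) (frag_of (?Vs ! k))) \<in> carrier ?G" for N :: "nat \<Rightarrow> int"
    using VO by (intro sum_closed_free_Abelian_group) auto
  have Xc: "frag_of ?X \<in> carrier ?G" using X by simp
  define M where "M = (\<lambda>k. if k < ?n then int (hdim (?Vs ! k) ?X) else 0)"
  have "fusion_coeff C V i = M"
    unfolding fusion_coeff_def
  proof (rule the_equality)
    have "(\<Sum>k<?n. frag_cmul (M k) (frag_of (?Vs ! k))) =
      (\<Sum>k<?n. frag_cmul (int (hdim (?Vs ! k) ?X)) (frag_of (?Vs ! k)))"
      by (intro sum.cong) (simp_all add: M_def)
    hence "frag_of ?X - (\<Sum>k<?n. frag_cmul (M k) (frag_of (?Vs ! k))) \<in> K0_relations C"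
      using K0_expansion[OF simple_reps_reps X] by simp
    thus "(\<forall>j\<ge>?n. M j = 0) \<and>
      K0_class C (frag_of ?X) = K0_class C (\<Sum>j<?n. frag_cmul (M j) (frag_of (?Vs ! j)))"
      using K0_class_eq_iff[OF Xc car] by (simp add: M_def)
  next
    fix N assume N: "(\<forall>j\<ge>?n. N j = 0) \<and>
      K0_class C (frag_of ?X) = K0_class C (\<Sum>j<?n. frag_cmul (N j) (frag_of (?Vs ! j)))"
    hence R: "frag_of ?X - (\<Sum>j<?n. frag_cmul (N j) (frag_of (?Vs ! j))) \<in> K0_relations C"
      using K0_class_eq_iff[OF Xc car] by simp
    have "N k = int (hdim (?Vs ! k) ?X)" if k: "k < ?n" for k
    proof -
      have "(\<Sum>j<?n. N j * int (hdim (?Vs ! k) (?Vs ! j))) = (\<Sum>j<?n. if j = k then N j else 0)"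
        using hdim_reps[OF simple_reps_reps k] by (intro sum.cong) auto
      thus ?thesis using hom_rank_relation[OF VO[OF k] R] k by (simp add: hom_rank_sum)
    qed
    thus "N = M" using N by (auto simp: M_def fun_eq_iff)
  qed
  thus ?thesis using j by (simp add: M_def)
qed

end

section \<open>Linear monoidal equivalences of fusion categories\<close>

lemma linear_iso_comp:
  assumes "linear_iso K U V T" "linear_iso K V W T'"
  shows "linear_iso K U W (\<lambda>x. T' (T x))"
proof -
  interpret T: linear_iso K U V T by fact
  interpret T': linear_iso K V W T' by fact
  have "linear_map K U W (\<lambda>x. T' (T x))"
    by (rule linear_mapI) (simp_all add: T.V.vectorspace_axioms T'.W.vectorspace_axioms)
  moreover have "bij_betw (\<lambda>x. T' (T x)) (carrier U) (carrier W)"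
    using bij_betw_trans[OF T.bij T'.bij] by (simp add: comp_def)
  ultimately show ?thesis by (simp add: linear_iso_def linear_iso_axioms_def)
qed

text \<open>Naturality of the first isomorphism recovers \<open>f\<close> from \<open>G (F f)\<close>, so \<open>F\<close> is faithful; in the same
  way \<open>G\<close> is faithful by the second one. Given \<open>h\<close>, the conjugate of \<open>G h\<close> is a morphism \<open>f\<close> with
  \<open>G (F f) = G h\<close>.\<close>

lemma equivalence_full_faithful:
  assumes "equivalence_functor C D Fo Fa" "X \<in> Obj C" "Y \<in> Obj C"
  shows "bij_betw Fa (Hom C X Y) (Hom D (Fo X) (Fo Y))"
proof -
  from assms(1) obtain Go Ga \<eta> \<epsilon> where F: "cat_functor C D Fo Fa" and G: "cat_functor D C Go Ga"
    and \<eta>: "nat_iso C C (\<lambda>X. X) (\<lambda>f. f) (Go \<circ> Fo) (Ga \<circ> Fa) \<eta>"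
    and \<epsilon>: "nat_iso D D (Fo \<circ> Go) (Fa \<circ> Ga) (\<lambda>X. X) (\<lambda>f. f) \<epsilon>"
    unfolding equivalence_functor_def by blast
  interpret F: cat_functor C D Fo Fa by fact
  interpret G: cat_functor D C Go Ga by fact
  have eta_arr: "\<eta> Z \<in> Arr C" "Dom C (\<eta> Z) = Z" "Cod C (\<eta> Z) = Go (Fo Z)" "iso_arr C (\<eta> Z)" if "Z \<in> Obj C" for Z
    using nat_iso.component_hom[OF \<eta> that] nat_iso.component_iso[OF \<eta> that] by (auto simp: F.C.Hom_arr)
  have eps_arr: "\<epsilon> Z \<in> Arr D" "Dom D (\<epsilon> Z) = Fo (Go Z)" "Cod D (\<epsilon> Z) = Z" "iso_arr D (\<epsilon> Z)" if "Z \<in> Obj D" for Z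
    using nat_iso.component_hom[OF \<epsilon> that] nat_iso.component_iso[OF \<epsilon> that] by (auto simp: F.D.Hom_arr)
  note e = eta_arr[OF assms(2)] eta_arr[OF assms(3)]
  have GF: "f = inv_arr C (\<eta> Y) \<cdot>\<^bsub>C\<^esub> (Ga (Fa f) \<cdot>\<^bsub>C\<^esub> \<eta> X)" if "f \<in> Hom C X Y" for f
    using nat_iso.naturality[OF \<eta> that, symmetric] e that by (simp add: F.C.Hom_arr)
  have FG: "h = \<epsilon> (Cod D h) \<cdot>\<^bsub>D\<^esub> (Fa (Ga h) \<cdot>\<^bsub>D\<^esub> inv_arr D (\<epsilon> (Dom D h)))" if h: "h \<in> Arr D" for h
  proof -
    have "\<epsilon> (Cod D h) \<cdot>\<^bsub>D\<^esub> Fa (Ga h) = h \<cdot>\<^bsub>D\<^esub> \<epsilon> (Dom D h)"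
      using nat_iso.naturality[OF \<epsilon>, of h "Dom D h" "Cod D h"] h by (simp add: F.D.Hom_arr)
    from F.D.comp_tail[OF this, of "inv_arr D (\<epsilon> (Dom D h))"]
    have "\<epsilon> (Cod D h) \<cdot>\<^bsub>D\<^esub> (Fa (Ga h) \<cdot>\<^bsub>D\<^esub> inv_arr D (\<epsilon> (Dom D h)))
        = (h \<cdot>\<^bsub>D\<^esub> \<epsilon> (Dom D h)) \<cdot>\<^bsub>D\<^esub> inv_arr D (\<epsilon> (Dom D h))"
      using h eps_arr[of "Dom D h"] eps_arr[of "Cod D h"] by simp
    also have "\<dots> = h" using h eps_arr[of "Dom D h"] by (simp add: F.D.comp_assoc)
    finally show ?thesis by (rule sym)
  qed
  show ?thesis
    unfolding bij_betw_def
  proof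
    show "inj_on Fa (Hom C X Y)" using GF by (metis inj_onI)
    show "Fa ` Hom C X Y = Hom D (Fo X) (Fo Y)"
    proof
      show "Fa ` Hom C X Y \<subseteq> Hom D (Fo X) (Fo Y)" using F.F_hom by blast
      show "Hom D (Fo X) (Fo Y) \<subseteq> Fa ` Hom C X Y"
      proof
        fix h assume h: "h \<in> Hom D (Fo X) (Fo Y)"
        let ?f = "inv_arr C (\<eta> Y) \<cdot>\<^bsub>C\<^esub> (Ga h \<cdot>\<^bsub>C\<^esub> \<eta> X)"
        have h': "h \<in> Arr D" "Dom D h = Fo X" "Cod D h = Fo Y" using h by (auto simp: F.D.Hom_arr)
        have f: "?f \<in> Hom C X Y" using e h' by (simp add: F.C.Hom_arr)
        have Gh: "Ga h = \<eta> Y \<cdot>\<^bsub>C\<^esub> (?f \<cdot>\<^bsub>C\<^esub> inv_arr C (\<eta> X))"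
          using e h' by (simp add: F.C.comp_assoc)
        have "\<eta> Y \<cdot>\<^bsub>C\<^esub> ?f = Ga (Fa ?f) \<cdot>\<^bsub>C\<^esub> \<eta> X" using nat_iso.naturality[OF \<eta> f] by simp
        from F.C.comp_tail[OF this, of "inv_arr C (\<eta> X)"]
        have "\<eta> Y \<cdot>\<^bsub>C\<^esub> (?f \<cdot>\<^bsub>C\<^esub> inv_arr C (\<eta> X)) = (Ga (Fa ?f) \<cdot>\<^bsub>C\<^esub> \<eta> X) \<cdot>\<^bsub>C\<^esub> inv_arr C (\<eta> X)"
          using e f by (simp add: F.C.Hom_arr)
        also have "\<dots> = Ga (Fa ?f)" using e f F.F_hom[OF f] by (simp add: F.C.comp_assoc F.C.Hom_arr F.D.Hom_arr)
        finally have "Ga h = Ga (Fa ?f)" using Gh by simp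
        moreover have "Fa ?f \<in> Arr D" "Dom D (Fa ?f) = Fo X" "Cod D (Fa ?f) = Fo Y"
          using F.F_hom[OF f] by (auto simp: F.D.Hom_arr)
        ultimately have "h = Fa ?f" using FG[OF h'(1)] FG[of "Fa ?f"] h' by simp
        thus "h \<in> Fa ` Hom C X Y" using f by blast
      qed
    qed
  qed
qed

lemma equivalence_ess_surj:
  assumes "equivalence_functor C D Fo Fa" "Y \<in> Obj D"
  obtains X where "X \<in> Obj C" "iso_obj D (Fo X) Y"
proof -
  from assms(1) obtain Go Ga \<epsilon> where G: "cat_functor D C Go Ga"
    and \<epsilon>: "nat_iso D D (Fo \<circ> Go) (Fa \<circ> Ga) (\<lambda>X. X) (\<lambda>f. f) \<epsilon>"
    unfolding equivalence_functor_def by blast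
  interpret G: cat_functor D C Go Ga by fact
  have "iso_obj D (Fo (Go Y)) Y"
    using nat_iso.component_hom[OF \<epsilon> assms(2)] nat_iso.component_iso[OF \<epsilon> assms(2)] by (auto simp: iso_obj_def)
  thus ?thesis using that[of "Go Y"] assms(2) by simp
qed

locale fusion_equivalence =
  C: fusion_category C + D: fusion_category D + linear_monoidal_equivalence C D F
  for C :: "('o, 'm, 'x) rigcat_scheme" and D :: "('p, 'n, 'y) rigcat_scheme"
    and F :: "('o, 'm, 'p, 'n) mfun"
begin

sublocale rigid_functor C D F ..

lemma linear_iso_F:
  assumes "X \<in> Obj C" "Y \<in> Obj C"
  shows "linear_iso class_ring (hom_space C X Y) (hom_space D (FO X) (FO Y)) FA"
proof -
  have "linear_map class_ring (hom_space C X Y) (hom_space D (FO X) (FO Y)) FA"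
    using assms F.F_hom F_Add F_Scale
    by (intro linear_mapI) (auto simp: C.hom_vectorspace D.hom_vectorspace)
  thus ?thesis
    using equivalence_full_faithful[OF F_equivalence assms]
    by (simp add: linear_iso_def linear_iso_axioms_def)
qed

lemma hdim_F:
  assumes "X \<in> Obj C" "Y \<in> Obj C" shows "D.hdim (FO X) (FO Y) = C.hdim X Y"
  using linear_iso.dim_eq[OF linear_iso_F[OF assms] C.hom_fin_dim[OF assms]]
  by (simp add: C.hdim_def D.hdim_def)

lemma F_full:
  assumes "X \<in> Obj C" "Y \<in> Obj C" "h \<in> Hom D (FO X) (FO Y)"
  obtains f where "f \<in> Hom C X Y" "FA f = h"
proof -
  have "h \<in> FA ` Hom C X Y"
    using bij_betw_imp_surj_on[OF equivalence_full_faithful[OF F_equivalence assms(1,2)]] assms(3) by simp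
  thus ?thesis using that by blast
qed

lemma F_faithful:
  assumes "f \<in> Hom C X Y" "g \<in> Hom C X Y" "FA f = FA g"
  shows "f = g"
  using bij_betw_imp_inj_on[OF equivalence_full_faithful[OF F_equivalence, of X Y]] C.Hom_Obj[OF assms(1)] assms
  by (meson inj_onD)

lemma simple_F:
  assumes X: "X \<in> Obj C" shows "simple_obj D (FO X) \<longleftrightarrow> simple_obj C X"
proof -
  note I = C.Id_hom[OF X]
  have b: "bij_betw FA (Hom C X X) (Hom D (FO X) (FO X))"
    using equivalence_full_faithful[OF F_equivalence X X] .
  have "(\<lambda>c. Scale_arr D c (Id D (FO X))) = FA \<circ> (\<lambda>c. Scale_arr C c (Id C X))"
    using F_Scale[OF I] X by (simp add: fun_eq_iff)
  moreover have "(\<lambda>c. Scale_arr C c (Id C X)) ` UNIV \<subseteq> Hom C X X" using C.Scale_hom[OF I] by blast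
  ultimately show ?thesis
    unfolding simple_obj_def using bij_betw_comp_iff2[OF b, of "\<lambda>c. Scale_arr C c (Id C X)" UNIV] X by simp
qed

lemma iso_F: "iso_obj C X Y \<Longrightarrow> iso_obj D (FO X) (FO Y)"
  unfolding iso_obj_def using F.F_hom F.F_iso by blast

lemma iso_reflect:
  assumes X: "X \<in> Obj C" and Y: "Y \<in> Obj C" and iso: "iso_obj D (FO X) (FO Y)"
  shows "iso_obj C X Y"
proof -
  obtain h where h: "h \<in> Hom D (FO X) (FO Y)" "iso_arr D h" using iso by (auto simp: iso_obj_def)
  have h': "inv_arr D h \<in> Hom D (FO Y) (FO X)" using h by (auto simp: D.Hom_arr)
  obtain f where f: "f \<in> Hom C X Y" "FA f = h" using F_full[OF X Y h(1)] .
  obtain g where g: "g \<in> Hom C Y X" "FA g = inv_arr D h" using F_full[OF Y X h'] .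
  have "g \<cdot>\<^bsub>C\<^esub> f = Id C X"
    using F_faithful[OF C.Comp_hom[OF f(1) g(1)] C.Id_hom[OF X]] f g h X by (simp add: C.Hom_arr D.Hom_arr)
  moreover have "f \<cdot>\<^bsub>C\<^esub> g = Id C Y"
    using F_faithful[OF C.Comp_hom[OF g(1) f(1)] C.Id_hom[OF Y]] f g h Y by (simp add: C.Hom_arr D.Hom_arr)
  ultimately have "is_inverse C f g" using f g by (auto simp: is_inverse_def C.Hom_arr)
  thus ?thesis using f by (auto simp: iso_obj_def iso_arr_def)
qed

end

section \<open>Invariance of the Frobenius-Perron dimension\<close>

text \<open>Relabelling the entries of an eigenvector gives an eigenvector of the relabelled matrix.\<close>

lemma eigenvalue_relabel:
  fixes A B :: "nat \<Rightarrow> nat \<Rightarrow> real"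
  assumes \<sigma>: "bij_betw \<sigma> {..<m} {..<n}"
    and AB: "\<And>i j. i < m \<Longrightarrow> j < m \<Longrightarrow> B (\<sigma> i) (\<sigma> j) = A i j"
    and ev: "eigenvalue (mat m m (\<lambda>(i, j). A i j)) x"
  shows "eigenvalue (mat n n (\<lambda>(i, j). B i j)) x"
proof -
  define \<tau> where "\<tau> = inv_into {..<m} \<sigma>"
  have \<tau>: "\<tau> k < m" "\<sigma> (\<tau> k) = k" if "k < n" for k
    using that \<sigma> bij_betw_inv_into_right[OF \<sigma>] bij_betwE[OF bij_betw_inv_into[OF \<sigma>]]
    by (auto simp: \<tau>_def)
  have \<sigma>': "\<sigma> i < n" "\<tau> (\<sigma> i) = i" if "i < m" for i
    using that bij_betw_inv_into_left[OF \<sigma>] bij_betwE[OF \<sigma>] by (auto simp: \<tau>_def)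
  obtain v where v: "v \<in> carrier_vec m" "v \<noteq> 0\<^sub>v m"
    "mat m m (\<lambda>(i, j). A i j) *\<^sub>v v = x \<cdot>\<^sub>v v"
    using ev by (auto simp: eigenvalue_def eigenvector_def)
  have vs: "(\<Sum>j<m. A i j * v $ j) = x * v $ i" if i: "i < m" for i
  proof -
    have "(mat m m (\<lambda>(i, j). A i j) *\<^sub>v v) $ i = (\<Sum>j<m. A i j * v $ j)"
      using i v(1) by (simp add: scalar_prod_def atLeast0LessThan)
    thus ?thesis using v i by simp
  qed
  define w where "w = vec n (\<lambda>k. v $ \<tau> k)"
  have "w \<noteq> 0\<^sub>v n"
  proof
    assume w: "w = 0\<^sub>v n"
    have "v $ i = 0" if "i < m" for i
    proof -
      have "w $ (\<sigma> i) = 0" using w \<sigma>'[OF that] by simp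
      thus ?thesis using \<sigma>'[OF that] by (simp add: w_def)
    qed
    thus False using v(1,2) by (auto simp: vec_eq_iff)
  qed
  moreover have "mat n n (\<lambda>(i, j). B i j) *\<^sub>v w = x \<cdot>\<^sub>v w"
  proof (rule eq_vecI)
    fix k assume "k < dim_vec (x \<cdot>\<^sub>v w)"
    hence k: "k < n" by (simp add: w_def)
    have "(mat n n (\<lambda>(i, j). B i j) *\<^sub>v w) $ k = (\<Sum>l<n. B k l * v $ \<tau> l)"
      using k by (simp add: scalar_prod_def atLeast0LessThan w_def)
    also have "\<dots> = (\<Sum>j<m. B k (\<sigma> j) * v $ \<tau> (\<sigma> j))"
      by (rule sum.reindex_bij_betw[OF \<sigma>, symmetric])
    also have "\<dots> = (\<Sum>j<m. A (\<tau> k) j * v $ j)"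
      using AB[OF \<tau>(1)[OF k]] \<tau>[OF k] \<sigma>' by (intro sum.cong) auto
    also have "\<dots> = x * v $ \<tau> k" using vs[OF \<tau>(1)[OF k]] .
    finally show "(mat n n (\<lambda>(i, j). B i j) *\<^sub>v w) $ k = (x \<cdot>\<^sub>v w) $ k" using k by (simp add: w_def)
  qed (simp add: w_def)
  ultimately show ?thesis by (auto simp: eigenvalue_def eigenvector_def w_def intro!: exI[of _ w])
qed

lemma eigenvalue_relabel_iff:
  fixes A B :: "nat \<Rightarrow> nat \<Rightarrow> real"
  assumes \<sigma>: "bij_betw \<sigma> {..<m} {..<n}"
    and AB: "\<And>i j. i < m \<Longrightarrow> j < m \<Longrightarrow> B (\<sigma> i) (\<sigma> j) = A i j"
  shows "eigenvalue (mat n n (\<lambda>(i, j). B i j)) x \<longleftrightarrow> eigenvalue (mat m m (\<lambda>(i, j). A i j)) x"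
proof
  assume "eigenvalue (mat n n (\<lambda>(i, j). B i j)) x"
  moreover have "A (inv_into {..<m} \<sigma> k) (inv_into {..<m} \<sigma> l) = B k l" if "k < n" "l < n" for k l
    using that AB[of "inv_into {..<m} \<sigma> k" "inv_into {..<m} \<sigma> l"] bij_betw_inv_into_right[OF \<sigma>]
      bij_betwE[OF bij_betw_inv_into[OF \<sigma>]] by auto
  ultimately show "eigenvalue (mat m m (\<lambda>(i, j). A i j)) x"
    using eigenvalue_relabel[OF bij_betw_inv_into[OF \<sigma>], of A B x] by blast
qed (rule eigenvalue_relabel[where A = A and B = B, OF \<sigma> AB])

context fusion_equivalence
begin

text \<open>The chosen representatives on the two sides are unrelated, but \<open>F\<close> induces a bijection between
  isomorphism classes of simple objects, hence one between the two index sets.\<close>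

lemma reps_bijection:
  "\<exists>\<sigma>. bij_betw \<sigma> {..<length (reps C)} {..<length (reps D)} \<and>
    (\<forall>i < length (reps C). iso_obj D (FO (reps C ! i)) (reps D ! \<sigma> i))"
proof -
  let ?m = "length (reps C)" and ?n = "length (reps D)"
  note rC = C.simple_reps_reps and rD = D.simple_reps_reps
  have sC: "simple_obj C (reps C ! i)" "reps C ! i \<in> Obj C" if "i < ?m" for i
    using rC that C.simple_Obj by (auto simp: simple_reps_def)
  have sD: "simple_obj D (reps D ! k)" "reps D ! k \<in> Obj D" if "k < ?n" for k
    using rD that D.simple_Obj by (auto simp: simple_reps_def)
  have "\<exists>k. k < ?n \<and> iso_obj D (FO (reps C ! i)) (reps D ! k)" if "i < ?m" for i
    using rD sC[OF that] simple_F[of "reps C ! i"] unfolding simple_reps_def by blast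
  then obtain \<sigma> where \<sigma>: "\<And>i. i < ?m \<Longrightarrow> \<sigma> i < ?n \<and> iso_obj D (FO (reps C ! i)) (reps D ! \<sigma> i)"
    by metis
  have "inj_on \<sigma> {..<?m}"
  proof (rule inj_onI)
    fix i j assume ij: "i \<in> {..<?m}" "j \<in> {..<?m}" "\<sigma> i = \<sigma> j"
    hence "iso_obj D (FO (reps C ! i)) (FO (reps C ! j))"
      using \<sigma>[of i] \<sigma>[of j] D.iso_obj_sym D.iso_obj_trans by (metis lessThan_iff)
    hence "iso_obj C (reps C ! i) (reps C ! j)" using iso_reflect sC ij by simp
    thus "i = j" using C.simple_reps_iso[OF rC] ij by simp
  qed
  moreover have "k \<in> \<sigma> ` {..<?m}" if k: "k < ?n" for k
  proof -
    obtain X where X: "X \<in> Obj C" "iso_obj D (FO X) (reps D ! k)"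
      using equivalence_ess_surj[OF F_equivalence sD(2)[OF k]] .
    have "simple_obj D (FO X)"
      using D.simple_iso[OF X(2)] sD(1)[OF k] by blast
    hence "simple_obj C X" using simple_F[OF X(1)] by simp
    then obtain i where i: "i < ?m" "iso_obj C X (reps C ! i)" using rC unfolding simple_reps_def by blast
    have "iso_obj D (reps D ! k) (reps D ! \<sigma> i)"
      using X(2) iso_F[OF i(2)] \<sigma>[OF i(1)] D.iso_obj_sym D.iso_obj_trans by metis
    hence "k = \<sigma> i" using D.simple_reps_iso[OF rD k] \<sigma>[OF i(1)] by blast
    thus ?thesis using i by blast
  qed
  ultimately have "bij_betw \<sigma> {..<?m} {..<?n}" using \<sigma> by (auto simp: bij_betw_def)
  thus ?thesis using \<sigma> by blast
qed

text \<open>Both matrices have dimensions of morphism spaces as entries. The structure isomorphism of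
  \<open>F (V \<otimes> V\<^sub>i)\<close> and full faithfulness identify the entries with indices \<open>i, j\<close> and
  \<open>\<sigma> i, \<sigma> j\<close>.\<close>

lemma FPdim_F:
  assumes V: "V \<in> Obj C" shows "FPdim D (FO V) = FPdim C V"
proof -
  obtain \<sigma> where \<sigma>: "bij_betw \<sigma> {..<length (reps C)} {..<length (reps D)}"
    "\<And>i. i < length (reps C) \<Longrightarrow> iso_obj D (FO (reps C ! i)) (reps D ! \<sigma> i)"
    using reps_bijection by blast
  have coeff: "fusion_coeff D (FO V) (\<sigma> i) (\<sigma> j) = fusion_coeff C V i j"
    if i: "i < length (reps C)" and j: "j < length (reps C)" for i j
  proof -
    let ?X = "reps C ! i" and ?Y = "reps C ! j" and ?X' = "reps D ! \<sigma> i" and ?Y' = "reps D ! \<sigma> j"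
    have O: "?X \<in> Obj C" "?Y \<in> Obj C"
      using C.simple_reps_reps C.simple_Obj i j by (auto simp: simple_reps_def)
    have s: "\<sigma> i < length (reps D)" "\<sigma> j < length (reps D)" using bij_betwE[OF \<sigma>(1)] i j by auto
    have O': "?X' \<in> Obj D" "?Y' \<in> Obj D"
      using D.simple_reps_reps D.simple_Obj s by (auto simp: simple_reps_def)
    obtain p where p: "p \<in> Hom D (FO ?X) ?X'" "iso_arr D p" using \<sigma>(2)[OF i] by (auto simp: iso_obj_def)
    have "iso_obj D (FO (V \<boxtimes>\<^bsub>C\<^esub> ?X)) (FO V \<boxtimes>\<^bsub>D\<^esub> ?X')"
      unfolding iso_obj_def
      by (rule bexI[of _ "(Id D (FO V) \<star>\<^bsub>D\<^esub> p) \<cdot>\<^bsub>D\<^esub> inv_arr D (t V ?X)"])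
        (use p V O in \<open>auto simp: D.Hom_arr\<close>)
    hence "D.hdim ?Y' (FO V \<boxtimes>\<^bsub>D\<^esub> ?X') = D.hdim ?Y' (FO (V \<boxtimes>\<^bsub>C\<^esub> ?X))"
      using D.hdim_iso_right O' by metis
    also have "\<dots> = D.hdim (FO ?Y) (FO (V \<boxtimes>\<^bsub>C\<^esub> ?X))"
      using D.hdim_iso_left[OF \<sigma>(2)[OF j]] V O by simp
    also have "\<dots> = C.hdim ?Y (V \<boxtimes>\<^bsub>C\<^esub> ?X)" using hdim_F V O by simp
    finally show ?thesis
      using C.fusion_coeff_eq[OF V i j] D.fusion_coeff_eq[OF F.F_Obj'[OF V] s] by simp
  qed
  show ?thesis
    unfolding FPdim_def
    using eigenvalue_relabel_iff[OF \<sigma>(1), of "\<lambda>i j. of_int (fusion_coeff D (FO V) i j)"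
        "\<lambda>i j. of_int (fusion_coeff C V i j)"] coeff by simp
qed

end

section \<open>Pivotal traces on simple objects\<close>

context fusion_category
begin

lemma ptrace_eq:
  assumes a: "a \<in> Hom C V (Dual C (Dual C V))" and V: "V \<in> Obj C"
  shows "twisted_ev C a \<cdot> Db C V = Scale_arr C (ptrace C a) (Id C (Unit C))"
proof -
  have a': "a \<in> Arr C" "Dom C a = V" "Cod C a = Dual C (Dual C V)" using a by (auto simp: Hom_arr)
  have eq: "Ev C (Dual C V) \<cdot> (a \<star> Id C (Dual C V)) \<cdot> Db C V = twisted_ev C a \<cdot> Db C V"
    using a' by (simp add: twisted_ev_def)
  have "twisted_ev C a \<cdot> Db C V \<in> Hom C (Unit C) (Unit C)"
    using a' V by (simp add: twisted_ev_def Hom_arr)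
  then obtain c where c: "twisted_ev C a \<cdot> Db C V = Scale_arr C c (Id C (Unit C))"
    using simple_End[OF Unit_simple] by blast
  have "ptrace C a = c"
    unfolding ptrace_def a'(2) eq c using simple_Scale_eq[OF Unit_simple] by (intro the_equality) auto
  thus ?thesis using c by simp
qed

text \<open>Currying identifies \<open>C(V \<otimes> V\<^sup>\<or>, I)\<close> with \<open>C(V, V\<^sup>\<or>\<^sup>\<or>)\<close>, which is spanned by \<open>a\<close> because \<open>End(V) = \<complex>\<close>.\<close>

lemma twisted_ev_spans:
  assumes V: "simple_obj C V" and a: "a \<in> Hom C V (Dual C (Dual C V))" "iso_arr C a"
    and k: "k \<in> Hom C (V \<boxtimes> Dual C V) (Unit C)"
  obtains c where "k = Scale_arr C c (twisted_ev C a)"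
proof -
  let ?V' = "Dual C V" and ?V'' = "Dual C (Dual C V)"
  have VO: "V \<in> Obj C" using simple_Obj[OF V] .
  have a': "a \<in> Arr C" "Dom C a = V" "Cod C a = ?V''" using a by (auto simp: Hom_arr)
  \<comment> \<open>The dual of \<open>V\<^sup>\<or>\<close> is used, since the factor to be split off \<open>V \<otimes> V\<^sup>\<or>\<close> is \<open>V\<^sup>\<or>\<close>.\<close>
  interpret P: dual_pair C ?V' ?V'' "Db C ?V'" "Ev C ?V'" using VO by (simp add: dual_pair_Dual)
  define h where "h = (k \<star> Id C ?V'') \<cdot> (inv_arr C (\<Phi> V ?V' ?V'') \<cdot> (Id C V \<star> Db C ?V'))"
  have kh: "k = Ev C ?V' \<cdot> (h \<star> Id C ?V')"
    using P.curry_ev[of k V] k VO by (simp add: Hom_arr h_def)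
  have h: "h \<in> Hom C V ?V''" using k VO by (simp add: h_def Hom_arr)
  have "inv_arr C a \<cdot> h \<in> Hom C V V" using h a a' by (simp add: Hom_arr)
  then obtain c where c: "inv_arr C a \<cdot> h = Scale_arr C c (Id C V)" using simple_End[OF V] by blast
  have "h = a \<cdot> (inv_arr C a \<cdot> h)" using h a a' by (simp add: Hom_arr)
  hence hc: "h = Scale_arr C c a" unfolding c using Scale_Id_comp(2)[OF a(1)] by simp
  have I: "Id C ?V' \<in> Hom C ?V' ?V'" using Id_hom VO by simp
  have "k = Ev C ?V' \<cdot> Scale_arr C c (a \<star> Id C ?V')"
    unfolding kh hc Scale_TensA[OF a(1) I] ..
  also have "\<dots> = Scale_arr C c (Ev C ?V' \<cdot> (a \<star> Id C ?V'))"
    by (rule Comp_Scale[OF TensA_hom[OF a(1) I]]) (use VO in \<open>simp add: Hom_arr\<close>)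
  finally show ?thesis using that a'(2) by (simp add: twisted_ev_def)
qed

text \<open>Otherwise the zigzag identity would make the identity of \<open>V\<close> zero.\<close>

lemma db_nonzero:
  assumes V: "simple_obj C V"
  shows "Db C V \<noteq> Zero_arr C (Unit C) (V \<boxtimes> Dual C V)"
proof
  assume 0: "Db C V = Zero_arr C (Unit C) (V \<boxtimes> Dual C V)"
  have VO [simp]: "V \<in> Obj C" using simple_Obj[OF V] .
  interpret P: dual_pair C V "Dual C V" "Db C V" "Ev C V" by (simp add: dual_pair_Dual)
  note I = Id_hom[OF VO]
  have db: "Db C V \<in> Hom C (Unit C) (V \<boxtimes> Dual C V)" by (simp add: Hom_arr)
  have "Db C V \<star> Id C V = Scale_arr C 0 (Db C V) \<star> Id C V" using Scale_0[OF db] 0 by simp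
  also have "\<dots> = Scale_arr C 0 (Db C V \<star> Id C V)" using Scale_TensA[OF db I] .
  also have "\<dots> = Zero_arr C V ((V \<boxtimes> Dual C V) \<boxtimes> V)"
    using Scale_0[OF TensA_hom[OF db I]] by simp
  finally have z: "Db C V \<star> Id C V = Zero_arr C V ((V \<boxtimes> Dual C V) \<boxtimes> V)" .
  have H1: "\<Phi> V (Dual C V) V \<in> Hom C ((V \<boxtimes> Dual C V) \<boxtimes> V) (V \<boxtimes> (Dual C V \<boxtimes> V))"
    and H2: "Id C V \<star> Ev C V \<in> Hom C (V \<boxtimes> (Dual C V \<boxtimes> V)) V" by (simp_all add: Hom_arr)
  have "Id C V = Zero_arr C V V"
    using P.zigzag_X' comp_Zero[OF H1 VO] comp_Zero[OF H2 VO] unfolding z by simp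
  thus False using simple_nonzero[OF V] by simp
qed

text \<open>The coevaluation is nonzero on the simple object \<open>I\<close>, hence has a left inverse. That left inverse is
  a multiple of the twisted evaluation, so the latter cannot vanish on the coevaluation.\<close>

lemma ptrace_nonzero:
  assumes V: "simple_obj C V" and a: "a \<in> Hom C V (Dual C (Dual C V))" "iso_arr C a"
  shows "ptrace C a \<noteq> 0"
proof
  assume 0: "ptrace C a = 0"
  have VO [simp]: "V \<in> Obj C" using simple_Obj[OF V] .
  have db: "Db C V \<in> Hom C (Unit C) (V \<boxtimes> Dual C V)" by (simp add: Hom_arr)
  obtain r where r: "r \<in> Hom C (V \<boxtimes> Dual C V) (Unit C)" "r \<cdot> Db C V = Id C (Unit C)"
    using simple_mono_split[OF Unit_simple db db_nonzero[OF V]] .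
  obtain c where c: "r = Scale_arr C c (twisted_ev C a)" using twisted_ev_spans[OF V a r(1)] .
  have tw: "twisted_ev C a \<in> Hom C (V \<boxtimes> Dual C V) (Unit C)"
    using twisted_arr[OF VO a] by (simp add: Hom_arr)
  note I = Id_hom[OF Unit_Obj]
  have "Id C (Unit C) = Scale_arr C c (twisted_ev C a \<cdot> Db C V)"
    using r(2) Scale_Comp[OF db tw] c by simp
  also have "\<dots> = Scale_arr C (c * ptrace C a) (Id C (Unit C))"
    unfolding ptrace_eq[OF a(1) VO] using Scale_Scale[OF I] .
  also have "\<dots> = Zero_arr C (Unit C) (Unit C)" using 0 Scale_0[OF I] by simp
  finally show False using simple_nonzero[OF Unit_simple] by simp
qed

end

lemma canonical_pivotalD:
  assumes "canonical_pivotal C j"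
  shows "V \<in> Obj C \<Longrightarrow> j V \<in> Hom C V (Dual C (Dual C V))" "V \<in> Obj C \<Longrightarrow> iso_arr C (j V)"
    "simple_obj C V \<Longrightarrow> ptrace C (j V) = of_real (FPdim C V)"
proof -
  have "monoidal_nat_iso C C (id_mfun C) (bidual C) j"
    using assms by (simp add: canonical_pivotal_def pivotal_structure_def)
  hence n: "nat_iso C C (Fobj (id_mfun C)) (Farr (id_mfun C)) (Fobj (bidual C)) (Farr (bidual C)) j"
    by (simp add: monoidal_nat_iso_def)
  show "j V \<in> Hom C V (Dual C (Dual C V))" "iso_arr C (j V)" if "V \<in> Obj C"
    using nat_iso.component_hom[OF n that] nat_iso.component_iso[OF n that]
    by (simp_all add: id_mfun_def bidual_def)
  show "ptrace C (j V) = of_real (FPdim C V)" if "simple_obj C V"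
    using assms that by (simp add: canonical_pivotal_def)
qed

section \<open>Invariance of the indicators\<close>

context fusion_equivalence
begin

text \<open>The image of the twisted evaluation of \<open>V\<close> is a multiple \<open>c\<close> of that of \<open>F V\<close>. Composing with the
  coevaluation of \<open>F V\<close> compares the traces, which agree and are nonzero; so \<open>c = 1\<close>.\<close>

lemma twisted_ev_F:
  assumes V: "simple_obj C V"
    and a: "a \<in> Hom C V (Dual C (Dual C V))" "iso_arr C a"
    and b: "b \<in> Hom D (FO V) (Dual D (Dual D (FO V)))" "iso_arr D b"
    and eq: "ptrace C a = ptrace D b"
  shows "twisted_ev D b = copush V (Dual C V) (twisted_ev C a) \<cdot>\<^bsub>D\<^esub> (Id D (FO V) \<star>\<^bsub>D\<^esub> dual_comparison V)"
    (is "_ = ?k")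
proof -
  have VO [simp]: "V \<in> Obj C" using C.simple_Obj[OF V] .
  have W: "simple_obj D (FO V)" using V simple_F[OF VO] by simp
  note [simp] = C.twisted_arr[OF VO a] D.twisted_arr[OF F.F_Obj'[OF VO] b]
  have k: "?k \<in> Hom D (FO V \<boxtimes>\<^bsub>D\<^esub> Dual D (FO V)) (Unit D)" by (simp add: D.Hom_arr)
  obtain c where c: "?k = Scale_arr D c (twisted_ev D b)" using D.twisted_ev_spans[OF W b k] .
  have I: "Id C (Unit C) \<in> Hom C (Unit C) (Unit C)" and J: "Id D (Unit D) \<in> Hom D (Unit D) (Unit D)"
    by (simp_all add: C.Hom_arr D.Hom_arr)
  have u: "u \<in> Hom D (Unit D) (FO (Unit C))" "inv_arr D u \<in> Hom D (FO (Unit C)) (Unit D)"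
    by (simp_all add: D.Hom_arr)
  have db: "Db D (FO V) \<in> Hom D (Unit D) (FO V \<boxtimes>\<^bsub>D\<^esub> Dual D (FO V))"
    and tw: "twisted_ev D b \<in> Hom D (FO V \<boxtimes>\<^bsub>D\<^esub> Dual D (FO V)) (Unit D)"
    by (simp_all add: D.Hom_arr)
  have "?k \<cdot>\<^bsub>D\<^esub> Db D (FO V) = copush V (Dual C V) (twisted_ev C a) \<cdot>\<^bsub>D\<^esub> push V (Dual C V) (Db C V)"
    using dual_comparison_db[OF VO] by (simp add: D.comp_assoc)
  also have "\<dots> = inv_arr D u \<cdot>\<^bsub>D\<^esub> (FA (twisted_ev C a \<cdot>\<^bsub>C\<^esub> Db C V) \<cdot>\<^bsub>D\<^esub> u)"
    by (rule copush_push) simp_all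
  also have "FA (twisted_ev C a \<cdot>\<^bsub>C\<^esub> Db C V) = Scale_arr D (ptrace C a) (Id D (FO (Unit C)))"
    unfolding C.ptrace_eq[OF a(1) VO] using F_Scale[OF I] by simp
  also have "Scale_arr D (ptrace C a) (Id D (FO (Unit C))) \<cdot>\<^bsub>D\<^esub> u = Scale_arr D (ptrace C a) u"
    using D.Scale_Id_comp(1)[OF u(1)] .
  also have "inv_arr D u \<cdot>\<^bsub>D\<^esub> Scale_arr D (ptrace C a) u = Scale_arr D (ptrace C a) (Id D (Unit D))"
    using D.Comp_Scale[OF u] by simp
  finally have 1: "?k \<cdot>\<^bsub>D\<^esub> Db D (FO V) = Scale_arr D (ptrace C a) (Id D (Unit D))" .
  have "?k \<cdot>\<^bsub>D\<^esub> Db D (FO V) = Scale_arr D c (twisted_ev D b \<cdot>\<^bsub>D\<^esub> Db D (FO V))"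
    unfolding c using D.Scale_Comp[OF db tw] .
  also have "\<dots> = Scale_arr D (c * ptrace D b) (Id D (Unit D))"
    unfolding D.ptrace_eq[OF b(1) F.F_Obj'[OF VO]] using D.Scale_Scale[OF J] .
  finally have "c * ptrace D b = ptrace D b"
    using 1 eq D.simple_Scale_eq[OF D.Unit_simple] by metis
  hence "c = 1" using D.ptrace_nonzero[OF W b] by simp
  thus ?thesis using c D.Scale_1[OF tw] by simp
qed

lemma pow_push_linear_iso:
  assumes V: "V \<in> Obj C"
  shows "linear_iso class_ring (hom_space C (Unit C) (ten_pow C V n))
    (hom_space D (Unit D) (ten_pow D (FO V) n)) (pow_push V n)"
proof -
  note [simp] = V
  have 1: "linear_iso class_ring (hom_space C (Unit C) (ten_pow C V n))
      (hom_space D (FO (Unit C)) (FO (ten_pow C V n))) FA"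
    by (rule linear_iso_F) simp_all
  have 2: "linear_iso class_ring (hom_space D (FO (Unit C)) (FO (ten_pow C V n)))
      (hom_space D (Unit D) (FO (ten_pow C V n))) (\<lambda>f. f \<cdot>\<^bsub>D\<^esub> u)"
    by (rule D.linear_iso_pre) (simp_all add: D.Hom_arr)
  have 3: "linear_iso class_ring (hom_space D (Unit D) (FO (ten_pow C V n)))
      (hom_space D (Unit D) (ten_pow D (FO V) n)) (\<lambda>f. pow_iso V n \<cdot>\<^bsub>D\<^esub> f)"
    by (rule D.linear_iso_post) (simp_all add: D.Hom_arr)
  have "pow_push V n = (\<lambda>f. pow_iso V n \<cdot>\<^bsub>D\<^esub> (FA f \<cdot>\<^bsub>D\<^esub> u))" by (simp add: pow_push_def fun_eq_iff)
  thus ?thesis using linear_iso_comp[OF linear_iso_comp[OF 1 2] 3] by simp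
qed

text \<open>The identification of \<open>C(I, V\<^sup>n)\<close> with \<open>D(I, (F V)\<^sup>n)\<close> intertwines the operators and therefore all
  their powers.\<close>

theorem FS_indicator_F:
  assumes V: "simple_obj C V" and n: "n \<ge> 1"
    and a: "jC V \<in> Hom C V (Dual C (Dual C V))" "iso_arr C (jC V)"
    and b: "jD (FO V) \<in> Hom D (FO V) (Dual D (Dual D (FO V)))" "iso_arr D (jD (FO V))"
    and eq: "ptrace C (jC V) = ptrace D (jD (FO V))"
  shows "FS_indicator C jC n r V = FS_indicator D jD n r (FO V)"
proof -
  have VO: "V \<in> Obj C" using C.simple_Obj[OF V] .
  note tw = twisted_ev_F[OF V a b eq]
  let ?E = "E_pow C jC n V" and ?E' = "E_pow D jD n (FO V)"
  let ?M = "hom_space C (Unit C) (ten_pow C V n)"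
  have step: "?E f \<in> carrier ?M" "?E' (pow_push V n f) = pow_push V n (?E f)" if "f \<in> carrier ?M" for f
    using that C.E_pow_arr[where j = jC, OF VO a _ n] E_pow_push[where jC = jC and jD = jD, OF VO a b tw _ n] by simp_all
  have iter: "(?E ^^ r) f \<in> carrier ?M \<and> (?E' ^^ r) (pow_push V n f) = pow_push V n ((?E ^^ r) f)"
    if f: "f \<in> carrier ?M" for f
    using f by (induction r) (simp_all add: step del: C.hom_space_simps)
  show ?thesis
    unfolding FS_indicator_def
    by (rule lin_trace_conjugate[OF pow_push_linear_iso[OF VO]]) (use iter in blast)+
qed

end

theorem corollary6p3:
  fixes C :: "('o, 'm) rigcat" and D :: "('p, 'n) rigcat"
    and j\<^sub>C :: "'o \<Rightarrow> 'm" and j\<^sub>D :: "'p \<Rightarrow> 'n"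
    and F :: "('o, 'm, 'p, 'n) mfun"
    and V :: 'o and n r :: nat
  assumes "fusion_category C" and "pseudo_unitary C"
    and "fusion_category D" and "pseudo_unitary D"
    and "canonical_pivotal C j\<^sub>C" and "canonical_pivotal D j\<^sub>D"
    and "linear_monoidal_equivalence C D F"
    and "simple_obj C V"
    and "n \<ge> 1" and "r \<ge> 1"
  shows "FS_indicator C j\<^sub>C n r V = FS_indicator D j\<^sub>D n r (Fobj F V)"
proof -
  interpret fusion_equivalence C D F
    using assms(1,3,7) by (rule fusion_equivalence.intro)
  have V: "V \<in> Obj C" using C.simple_Obj[OF assms(8)] .
  have W: "simple_obj D (FO V)" using simple_F[OF V] assms(8) by simp
  show ?thesis
  proof (rule FS_indicator_F[where jC = j\<^sub>C and jD = j\<^sub>D, OF assms(8,9)])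
    show "j\<^sub>C V \<in> Hom C V (Dual C (Dual C V))" "iso_arr C (j\<^sub>C V)"
      using canonical_pivotalD(1,2)[OF assms(5) V] .
    show "j\<^sub>D (FO V) \<in> Hom D (FO V) (Dual D (Dual D (FO V)))" "iso_arr D (j\<^sub>D (FO V))"
      using canonical_pivotalD(1,2)[OF assms(6) F.F_Obj'[OF V]] .
    show "ptrace C (j\<^sub>C V) = ptrace D (j\<^sub>D (FO V))"
      using canonical_pivotalD(3)[OF assms(5,8)] canonical_pivotalD(3)[OF assms(6) W] FPdim_F[OF V] by simp
  qed
qed

end
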